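(* The complex $\Delta_{12,33}$ (defined in the context), which has $12$ vertices, has the minimum number of vertices among all flag simplicial $d$-spheres $\Delta$ ($d\geq 0$) satisfying the following three conditions: (i) $\Delta$ is not a suspension; (ii) $\Delta$ has no contractible edge; (iii) all the induced equators of $\Delta$ are vertex links. In other words, every flag simplicial $d$-sphere satisfying (i), (ii) and (iii) has at least $12$ vertices, and $\Delta_{12,33}$ is a flag simplicial $3$-sphere on $12$ vertices satisfying (i), (ii) and (iii).
   Context: Simplicial complexes are finite abstract simplicial complexes; faces are written as strings of vertices (e.g. $x_1x_2y_3=\{x_1,x_2,y_3\}$), and $\langle F_1,\dots,F_k\rangle$ is the complex whose facets (inclusion-maximal faces) are $F_1,\dots,F_k$. The join is $\Delta*\Gamma=\{F\cup G: F\in\Delta, G\in\Gamma\}$, and $\{v\}*\Delta:=\Delta*\langle\{v\}\rangle$ is the cone. A complex is a suspension if it equals $\Delta*\langle\{v\},\{w\}\rangle$ for some simplicial complex $\Delta$ (possibly $\{\emptyset\}$) and two distinct vertices $v,w$ not in $\Delta$. For a subset $W$ of the vertex set, the induced subcomplex is $\Delta[W]=\{F\in\Delta: F\subseteq W\}$. The link of a face $F$ is $\mathrm{lk}_\Delta(F)=\{G\in\Delta: F\cup G\in\Delta,\ F\cap G=\emptyset\}$; vertex links are links of faces $\{v\}$. A complex is a simplicial $d$-sphere if its geometric realization is homeomorphic to $\mathbb{S}^d$. A complex is flag if every inclusion-minimal non-face (subset of the vertex set that is not a face) has cardinality $2$. An edge of $\Delta$ is contractible if it is not contained in any induced subcomplex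 of $\Delta$ isomorphic to a $4$-cycle (for a flag sphere this is the condition for the edge to be contracted to give another flag sphere). An induced equator of a simplicial $d$-sphere is an induced subcomplex that is a simplicial $(d-1)$-sphere. For distinct elements $p_1,p_2,p_3,q_1,q_2,q_3$ put $$\Diamond([p_1,p_2,p_3],[q_1,q_2,q_3])=\langle\{p_1\},\{q_1\}\rangle*\langle\{p_2\},\{q_2\}\rangle*\langle\{p_3\},\{q_3\}\rangle.$$ Definition of $\Delta_{12,33}$: the vertex set is $\{x_1,x_2,x_3,y_1,y_2,y_3,z_1,z_2,z_3,v_1,v_2,v_3\}$ ($12$ distinct elements) and $\Delta_{12,33}=\Gamma_1\cup\Gamma_2$, where $$\Gamma_1=\{v_1\}*\Diamond([x_1,x_2,x_3],[y_1,y_2,y_3])\ \cup\ \{v_2\}*\Diamond([y_1,y_2,y_3],[z_1,z_2,z_3])\ \cup\ \{v_3\}*\Diamond([x_1,x_2,x_3],[z_3,z_1,z_2])$$ and $$\Gamma_2=\langle x_1x_2y_3z_2,\ x_2y_1y_3z_2,\ x_2y_1z_2z_3,\ x_2x_3y_1z_3,\ x_3y_1y_2z_3,\ x_3y_2z_1z_3,\ x_1x_3y_2z_1,\ x_1y_2y_3z_1,\ x_1y_3z_1z_2\rangle.$$ *)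

theory Defs
  imports "HOL-Analysis.Analysis"
begin

definition vertices :: "'a set set \<Rightarrow> 'a set" where
  "vertices \<Delta> = \<Union>\<Delta>"

(* The name "simplicial_complex" is taken by the geometric complexes of HOL-Analysis. *)
definition abstract_complex :: "'a set set \<Rightarrow> bool" where
  "abstract_complex \<Delta> \<longleftrightarrow>
     finite (vertices \<Delta>) \<and> {} \<in> \<Delta> \<and> (\<forall>F\<in>\<Delta>. \<forall>G. G \<subseteq> F \<longrightarrow> G \<in> \<Delta>)"

(* For finite, pairwise incomparable faces this is the complex having exactly these facets. *)
definition generated_by :: "'a set set \<Rightarrow> 'a set set" where
  "generated_by \<F> = {G. \<exists>F\<in>\<F>. G \<subseteq> F}"

definition join :: "'a set set \<Rightarrow> 'a set set \<Rightarrow> 'a set set" where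
  "join \<Delta> \<Gamma> = {F \<union> G | F G. F \<in> \<Delta> \<and> G \<in> \<Gamma>}"

definition cone :: "'a \<Rightarrow> 'a set set \<Rightarrow> 'a set set" where
  "cone v \<Delta> = join \<Delta> (generated_by {{v}})"

definition is_suspension :: "'a set set \<Rightarrow> bool" where
  "is_suspension \<Delta> \<longleftrightarrow>
     (\<exists>\<Gamma> v w. abstract_complex \<Gamma> \<and> v \<noteq> w \<and> v \<notin> vertices \<Gamma> \<and> w \<notin> vertices \<Gamma> \<and>
        \<Delta> = join \<Gamma> (generated_by {{v}, {w}}))"

definition induced :: "'a set set \<Rightarrow> 'a set \<Rightarrow> 'a set set" where
  "induced \<Delta> W = {F \<in> \<Delta>. F \<subseteq> W}"

definition link :: "'a set set \<Rightarrow> 'a set \<Rightarrow> 'a set set" where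
  "link \<Delta> F = {G \<in> \<Delta>. F \<union> G \<in> \<Delta> \<and> F \<inter> G = {}}"

(* Barycentric coordinates: the points are the convex combinations of vertices whose
   support is a face. For a finite complex the product topology is the usual one. *)
definition geometric_realization :: "'a set set \<Rightarrow> ('a \<Rightarrow> real) topology" where
  "geometric_realization \<Delta> =
     subtopology (powertop_real UNIV)
       {f. (\<forall>v. 0 \<le> f v) \<and> {v. f v \<noteq> 0} \<in> \<Delta> \<and> (\<Sum>v | f v \<noteq> 0. f v) = 1}"

definition simplicial_sphere :: "nat \<Rightarrow> 'a set set \<Rightarrow> bool" where
  "simplicial_sphere d \<Delta> \<longleftrightarrow>
     abstract_complex \<Delta> \<and> geometric_realization \<Delta> homeomorphic_space nsphere d"

definition flag :: "'a set set \<Rightarrow> bool" where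
  "flag \<Delta> \<longleftrightarrow>
     (\<forall>N. N \<subseteq> vertices \<Delta> \<and> N \<notin> \<Delta> \<and> (\<forall>M. M \<subset> N \<longrightarrow> M \<in> \<Delta>) \<longrightarrow> card N = 2)"

definition isomorphic_complexes :: "'a set set \<Rightarrow> 'b set set \<Rightarrow> bool" where
  "isomorphic_complexes \<Delta> \<Gamma> \<longleftrightarrow>
     (\<exists>f. bij_betw f (vertices \<Delta>) (vertices \<Gamma>) \<and> \<Gamma> = (\<lambda>F. f ` F) ` \<Delta>)"

definition four_cycle :: "nat set set" where
  "four_cycle = generated_by {{0, 1}, {1, 2}, {2, 3}, {3, 0}}"

definition contractible_edge :: "'a set set \<Rightarrow> 'a set \<Rightarrow> bool" where
  "contractible_edge \<Delta> e \<longleftrightarrow> e \<in> \<Delta> \<and> card e = 2 \<and>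
     \<not> (\<exists>W \<subseteq> vertices \<Delta>. isomorphic_complexes (induced \<Delta> W) four_cycle \<and> e \<in> induced \<Delta> W)"

(* "induced_equator d \<Delta> \<Gamma>": \<Gamma> is an induced equator of the d-sphere \<Delta>. The sphere of
   dimension -1 is empty, and the only complex with empty realization is {{}}. *)
definition induced_equator :: "nat \<Rightarrow> 'a set set \<Rightarrow> 'a set set \<Rightarrow> bool" where
  "induced_equator d \<Delta> \<Gamma> \<longleftrightarrow>
     (\<exists>W \<subseteq> vertices \<Delta>. \<Gamma> = induced \<Delta> W) \<and>
     (case d of 0 \<Rightarrow> \<Gamma> = {{}} | Suc e \<Rightarrow> simplicial_sphere e \<Gamma>)"

definition equators_are_vertex_links :: "nat \<Rightarrow> 'a set set \<Rightarrow> bool" where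
  "equators_are_vertex_links d \<Delta> \<longleftrightarrow>
     (\<forall>\<Gamma>. induced_equator d \<Delta> \<Gamma> \<longrightarrow> (\<exists>v \<in> vertices \<Delta>. \<Gamma> = link \<Delta> {v}))"

fun diamond :: "'a \<times> 'a \<times> 'a \<Rightarrow> 'a \<times> 'a \<times> 'a \<Rightarrow> 'a set set" where
  "diamond (p1, p2, p3) (q1, q2, q3) =
     join (join (generated_by {{p1}, {q1}}) (generated_by {{p2}, {q2}}))
          (generated_by {{p3}, {q3}})"

datatype vertex12 = X1 | X2 | X3 | Y1 | Y2 | Y3 | Z1 | Z2 | Z3 | V1 | V2 | V3

definition Gamma1 :: "vertex12 set set" where
  "Gamma1 =
     cone V1 (diamond (X1, X2, X3) (Y1, Y2, Y3)) \<union>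
     cone V2 (diamond (Y1, Y2, Y3) (Z1, Z2, Z3)) \<union>
     cone V3 (diamond (X1, X2, X3) (Z3, Z1, Z2))"

definition Gamma2 :: "vertex12 set set" where
  "Gamma2 = generated_by
     {{X1, X2, Y3, Z2}, {X2, Y1, Y3, Z2}, {X2, Y1, Z2, Z3},
      {X2, X3, Y1, Z3}, {X3, Y1, Y2, Z3}, {X3, Y2, Z1, Z3},
      {X1, X3, Y2, Z1}, {X1, Y2, Y3, Z1}, {X1, Y3, Z1, Z2}}"

definition Delta_12_33 :: "vertex12 set set" where
  "Delta_12_33 = Gamma1 \<union> Gamma2"

end

(* Conditions (i) and (ii) alone force twelve vertices. In the graph of a flag sphere, a vertex with
   exactly one non-neighbour makes the complex a suspension. A vertex with exactly two non-neighbours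
   gives a contractible edge if they are adjacent; if they are not, one needs 2d + 7 vertices, and for
   d = 2 the vertex would cut the sphere. So with at most eleven vertices every vertex has at least
   three non-neighbours, all degrees are at most 7, and as links are flag (d-1)-spheres with at least
   2d vertices, d is at most 3. For d = 3 all links are octahedra or suspensions of a pentagon, and
   the complex is a join of two cycles of length 4 or 5, in which some vertex has too few
   non-neighbours. For d = 2 induced 4-cycles separate the sphere; a smallest side is a single vertex,
   and this forces the octahedron. The only properties of a topological sphere that enter are that it
   is a pseudomanifold, by invariance of domain, and the Jordan curve theorem.

   That the complex on 12 vertices is a 3-sphere is shown by seven bistellar flips that lead to the
   boundary of a 4-simplex; its equators are found by a finite search. *)

theory Submission
  imports Defs "HOL-Homology.Invariance_of_Domain"
begin

subsection \<open>Flag pseudomanifolds as graphs\<close>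

text \<open>In high dimensions the vertex links of a triangulated sphere need not be spheres, so an
  induction over links cannot stay within spheres. \<open>pm\<close> is chosen because it passes to
  vertex links by its very form. The price is that a \<open>pm\<close> graph may be disconnected.
  Connectedness is recovered by counting: a union of components is again \<open>pm\<close>, so in
  dimension d it has at least 2(d+1) vertices, and fewer than 4(d+1) vertices admit no proper one.
  This is where eleven and seven matter: 11 < 12 for a surface and 7 < 8 for a one-dimensional link.
  Counting does not suffice for a whole circle, as two disjoint 4-cycles have only eight vertices,
  nor for a 2-sphere with a vertex or an induced 4-cycle removed; only there does the global
  topology of the sphere enter.\<close>

text \<open>A flag complex is determined by its graph. \<open>pm E d V\<close> says that the clique complex of \<open>E\<close> on \<open>V\<close> is
  pure of dimension \<open>d\<close> and that every ridge lies in exactly two facets: this is the condition that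
  all links of \<open>(d-1)\<close>-faces are two points, unfolded one vertex at a time.\<close>

fun pm :: "('a \<Rightarrow> 'a \<Rightarrow> bool) \<Rightarrow> nat \<Rightarrow> 'a set \<Rightarrow> bool" where
  "pm E 0 V \<longleftrightarrow> (\<exists>a b. a \<noteq> b \<and> \<not> E a b \<and> V = {a, b})"
| "pm E (Suc d) V \<longleftrightarrow> finite V \<and> V \<noteq> {} \<and> (\<forall>v\<in>V. pm E d {w \<in> V. E v w})"

text \<open>Splittings instead of paths, because a splitting of the vertices turns directly into two
  open sets of the realization and back. The empty set counts as connected.\<close>

definition connected_on :: "('a \<Rightarrow> 'a \<Rightarrow> bool) \<Rightarrow> 'a set \<Rightarrow> bool" where
  "connected_on E S \<longleftrightarrow>
     (\<forall>P Q. P \<union> Q = S \<and> P \<inter> Q = {} \<and> P \<noteq> {} \<and> Q \<noteq> {} \<longrightarrow> (\<exists>p\<in>P. \<exists>q\<in>Q. E p q))"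

lemma not_connected_onE:
  assumes "\<not> connected_on E S"
  obtains P Q where "P \<union> Q = S" "P \<inter> Q = {}" "P \<noteq> {}" "Q \<noteq> {}"
    "\<And>p q. p \<in> P \<Longrightarrow> q \<in> Q \<Longrightarrow> \<not> E p q"
proof -
  from assms have "\<exists>P Q. P \<union> Q = S \<and> P \<inter> Q = {} \<and> P \<noteq> {} \<and> Q \<noteq> {} \<and> (\<forall>p\<in>P. \<forall>q\<in>Q. \<not> E p q)"
    by (simp add: connected_on_def)
  then show thesis using that by (elim exE conjE) simp
qed

definition induced_C4 :: "('a \<Rightarrow> 'a \<Rightarrow> bool) \<Rightarrow> 'a \<Rightarrow> 'a \<Rightarrow> 'a \<Rightarrow> 'a \<Rightarrow> bool" where
  "induced_C4 E a b c d \<longleftrightarrow>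
     E a b \<and> E b c \<and> E c d \<and> E d a \<and> \<not> E a c \<and> \<not> E b d \<and> a \<noteq> c \<and> b \<noteq> d"

locale graph =
  fixes E :: "'a \<Rightarrow> 'a \<Rightarrow> bool"
  assumes sym: "E x y \<Longrightarrow> E y x" and irrefl: "\<not> E x x"
begin

abbreviation nb :: "'a set \<Rightarrow> 'a \<Rightarrow> 'a set" where
  "nb V v \<equiv> {w \<in> V. E v w}"

lemma pm_finite: "pm E d V \<Longrightarrow> finite V"
  by (cases d) auto

lemma pm_nonempty: "pm E d V \<Longrightarrow> V \<noteq> {}"
  by (cases d) auto

lemma pm_nb: "pm E (Suc d) V \<Longrightarrow> v \<in> V \<Longrightarrow> pm E d (nb V v)"
  by simp

text \<open>A vertex adjacent to all others would keep this property in the link of any neighbour,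
  and so down to a 0-sphere, whose two points are not adjacent.\<close>

lemma no_cone: "pm E d V \<Longrightarrow> v \<in> V \<Longrightarrow> \<exists>w\<in>V. w \<noteq> v \<and> \<not> E v w"
proof (induction d arbitrary: V)
  case 0
  then show ?case using sym by auto
next
  case (Suc d)
  obtain x where x: "x \<in> nb V v"
    using pm_nonempty[OF pm_nb[OF Suc.prems]] by auto
  then have "v \<in> nb V x" using Suc.prems sym by auto
  moreover have "pm E d (nb V x)" using Suc.prems x pm_nb by auto
  ultimately show ?case using Suc.IH by blast
qed

text \<open>The link of \<open>v\<close> together with \<open>v\<close> and one non-neighbour: two
  more vertices per dimension. The bound is attained by the boundary of the cross-polytope.\<close>

lemma card_pm: "pm E d V \<Longrightarrow> 2 * (d + 1) \<le> card V"
proof (induction d arbitrary: V)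
  case 0
  then show ?case by auto
next
  case (Suc d)
  obtain v where v: "v \<in> V" using pm_nonempty[OF Suc.prems] by auto
  obtain w where w: "w \<in> V" "w \<noteq> v" "\<not> E v w" using no_cone[OF Suc.prems v] by auto
  have fin: "finite V" using pm_finite[OF Suc.prems] .
  have "card (insert v (insert w (nb V v))) = card (nb V v) + 2"
    using fin w irrefl by simp
  moreover have "card (insert v (insert w (nb V v))) \<le> card V"
    using fin v w by (intro card_mono) auto
  moreover have "2 * (d + 1) \<le> card (nb V v)"
    using Suc.IH[OF pm_nb[OF Suc.prems v]] .
  ultimately show ?case by simp
qed

lemma pm_closed_subset:
  assumes "pm E (Suc d) V" "S \<subseteq> V" "S \<noteq> {}" "\<And>s w. s \<in> S \<Longrightarrow> w \<in> V \<Longrightarrow> E s w \<Longrightarrow> w \<in> S"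
  shows "pm E (Suc d) S"
proof -
  have "nb S s = nb V s" if "s \<in> S" for s using assms that by auto
  moreover have "finite S" using assms(1,2) by (auto intro: finite_subset)
  ultimately show ?thesis using assms(1-3) by auto
qed

text \<open>The substitute for connectedness: \<open>S\<close> and its complement would both be
  \<open>pm\<close>, each with at least 2(d+2) vertices.\<close>

lemma closed_subset_eq:
  assumes V: "pm E (Suc d) V" "card V < 4 * (d + 2)"
    and S: "S \<subseteq> V" "S \<noteq> {}" "\<And>s w. s \<in> S \<Longrightarrow> w \<in> V \<Longrightarrow> E s w \<Longrightarrow> w \<in> S"
  shows "S = V"
proof (rule ccontr)
  assume "S \<noteq> V"
  then have "V - S \<noteq> {}" using S by auto
  then have "pm E (Suc d) (V - S)"
    by (intro pm_closed_subset[OF V(1)]) (use S sym in blast)+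
  moreover have "pm E (Suc d) S" by (rule pm_closed_subset[OF V(1) S])
  moreover have "card V = card S + card (V - S)"
    using S pm_finite[OF V(1)] by (simp add: card_Diff_subset card_mono finite_subset)
  ultimately show False using V(2) card_pm[of "Suc d" S] card_pm[of "Suc d" "V - S"] by simp
qed

section \<open>Vertices with one or two non-neighbours\<close>

text \<open>In the link of \<open>x\<close> the vertex \<open>v\<close> must again have a
  non-neighbour, and only \<open>w\<close> is available.\<close>

lemma unique_non_neighbour:
  assumes "pm E d V" "v \<in> V" "w \<in> V" "\<And>x. x \<in> V \<Longrightarrow> x \<noteq> v \<Longrightarrow> x \<noteq> w \<Longrightarrow> E v x"
    and "x \<in> V" "x \<noteq> v" "x \<noteq> w"
  shows "E w x"
proof (cases d)
  case 0
  then show ?thesis using assms no_cone[OF assms(1,2)] sym by auto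
next
  case (Suc e)
  have "v \<in> nb V x" using assms sym by auto
  moreover have "pm E e (nb V x)" using assms Suc by auto
  ultimately obtain y where "y \<in> nb V x" "y \<noteq> v" "\<not> E v y" using no_cone by meson
  then show ?thesis using assms(4) sym by auto
qed

text \<open>The link of \<open>w\<close> omits \<open>a\<close>, so \<open>b\<close> is the only
  non-neighbour of \<open>v\<close> there. Hence \<open>b\<close> is joined to everything else in
  that link, in particular to \<open>t\<close>, which is a diagonal of the cycle.\<close>

lemma two_adjacent_non_neighbours:
  assumes V: "pm E d V" "v \<in> V" "a \<in> V" "b \<in> V"
    and nn: "v \<noteq> a" "v \<noteq> b" "\<not> E v a" "\<not> E v b"
      "\<And>x. x \<in> V \<Longrightarrow> x \<noteq> v \<Longrightarrow> x \<noteq> a \<Longrightarrow> x \<noteq> b \<Longrightarrow> E v x"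
    and C: "w \<in> V" "t \<in> V" "induced_C4 E a b w t"
  shows False
proof (cases d)
  case 0
  have "a \<noteq> b" using C irrefl unfolding induced_C4_def by blast
  then show False using 0 V nn by auto
next
  case (Suc e)
  have C': "E a b" "E b w" "E w t" "E t a" "\<not> E a w" "\<not> E b t" "a \<noteq> w" "b \<noteq> t"
    using C unfolding induced_C4_def by auto
  have "w \<noteq> v" "t \<noteq> v" "w \<noteq> b" "t \<noteq> a" using C' nn sym irrefl by blast+
  then have vw: "E v w" "E v t" using nn C C' by auto
  have "E b t"
  proof (rule unique_non_neighbour[where V = "nb V w" and v = v and d = e])
    show "pm E e (nb V w)" using V C Suc by auto
    show "E v x" if "x \<in> nb V w" "x \<noteq> v" "x \<noteq> b" for x
      using that nn(5)[of x] C' sym by blast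
  qed (use V C C' vw sym \<open>t \<noteq> v\<close> in auto)
  then show False using C' by simp
qed

text \<open>A common neighbour \<open>x\<close> of \<open>a\<close> and \<open>b\<close> carries the
  same configuration in its link, and \<open>x\<close> with a non-neighbour adds two vertices.
  Without a common neighbour the links of \<open>a\<close> and \<open>b\<close> are disjoint inside
  the link of \<open>v\<close>, which makes that link large: impossible in dimension 1, and enough
  from dimension 2 on.\<close>

lemma two_nonadjacent_non_neighbours:
  assumes "pm E d V" "v \<in> V" "a \<in> V" "b \<in> V"
    and "v \<noteq> a" "v \<noteq> b" "a \<noteq> b" "\<not> E v a" "\<not> E v b" "\<not> E a b"
      "\<And>x. x \<in> V \<Longrightarrow> x \<noteq> v \<Longrightarrow> x \<noteq> a \<Longrightarrow> x \<noteq> b \<Longrightarrow> E v x"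
  shows "2 \<le> d \<and> 2 * d + 7 \<le> card V"
  using assms
proof (induction d arbitrary: V)
  case 0
  then show ?case by auto
next
  case (Suc d)
  note pm = Suc.prems(1) and in_V = Suc.prems(2-4) and nn = Suc.prems(5-10) and adj = Suc.prems(11)
  have fin: "finite V" using pm_finite[OF pm] .
  have sub: "nb V a \<subseteq> nb V v" "nb V b \<subseteq> nb V v"
    using adj nn sym irrefl by blast+
  show ?case
  proof (cases "\<exists>x\<in>V. E x a \<and> E x b")
    case True
    then obtain x where x: "x \<in> V" "E x a" "E x b" by auto
    then have "E x v" using sub sym by blast
    obtain y where y: "y \<in> V" "y \<noteq> x" "\<not> E x y" using no_cone[OF pm x(1)] by auto
    have *: "2 \<le> d \<and> 2 * d + 7 \<le> card (nb V x)"
      by (rule Suc.IH) (use pm in_V nn adj x \<open>E x v\<close> in auto)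
    have "card (insert x (insert y (nb V x))) = card (nb V x) + 2"
      using fin y irrefl by simp
    moreover have "card (insert x (insert y (nb V x))) \<le> card V"
      using fin x y by (intro card_mono) auto
    ultimately show ?thesis using * by simp
  next
    case False
    then have disj: "nb V a \<inter> nb V b = {}" using sym by blast
    have "2 * (d + 1) \<le> card (nb V a)" "2 * (d + 1) \<le> card (nb V b)"
      using card_pm pm_nb[OF pm] in_V by blast+
    moreover have "card (nb V a \<union> nb V b) = card (nb V a) + card (nb V b)"
      using fin disj by (intro card_Un_disjoint) auto
    moreover have "card (nb V a \<union> nb V b) \<le> card (nb V v)"
      using fin sub by (intro card_mono) auto
    ultimately have 1: "4 * (d + 1) \<le> card (nb V v)" by simp
    have "d \<noteq> 0"
    proof
      assume "d = 0"
      then have "pm E 0 (nb V v)" using pm_nb[OF pm in_V(1)] by simp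
      then have "card (nb V v) = 2" by auto
      then show False using 1 by simp
    qed
    \<comment> \<open>The dimension here is \<open>Suc d\<close>, and 4(d+1) + 3 reaches 2(d+1) + 7
      because d is not 0.\<close>
    have "card (insert v (insert a (insert b (nb V v)))) = card (nb V v) + 3"
      using fin nn irrefl by simp
    moreover have "card (insert v (insert a (insert b (nb V v)))) \<le> card V"
      using fin in_V by (intro card_mono) auto
    ultimately show ?thesis using 1 \<open>d \<noteq> 0\<close> by simp
  qed
qed

text \<open>\<open>a\<close> and \<open>b\<close> have no common neighbour, since its link would
  show the configuration excluded in dimension 1. An edge \<open>p q\<close> with \<open>p\<close>
  but not \<open>q\<close> next to \<open>a\<close> would have both ends adjacent to
  \<open>v\<close>, so besides \<open>v\<close> its link needs a point not adjacent to
  \<open>v\<close>, and neither \<open>a\<close> nor \<open>b\<close> can serve. So \<open>v\<close>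
  cuts off \<open>a\<close> and its neighbours.\<close>

lemma surface_cut_vertex:
  assumes V: "pm E 2 V" "v \<in> V" "a \<in> V" "b \<in> V"
    and nn: "v \<noteq> a" "v \<noteq> b" "a \<noteq> b" "\<not> E v a" "\<not> E v b" "\<not> E a b"
      and adj: "\<And>x. x \<in> V \<Longrightarrow> x \<noteq> v \<Longrightarrow> x \<noteq> a \<Longrightarrow> x \<noteq> b \<Longrightarrow> E v x"
  shows "\<not> connected_on E (V - {v})"
proof -
  have V1: "pm E (Suc (Suc 0)) V" using V(1) by (simp add: numeral_2_eq_2)
  have no_common: False if x: "x \<in> V" "E x a" "E x b" for x
  proof -
    have "E v x" using x nn sym irrefl adj by blast
    then have "2 \<le> Suc 0 \<and> 2 * Suc 0 + 7 \<le> card (nb V x)"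
      by (intro two_nonadjacent_non_neighbours[of "Suc 0" "nb V x" v a b] pm_nb[OF V1 x(1)])
        (use V nn x adj sym in auto)
    then show False by simp
  qed
  have no_edge: False if pq: "p \<in> V" "q \<in> V" "E a p" "q \<noteq> v" "q \<noteq> a" "\<not> E a q" "E p q" for p q
  proof -
    have "q \<noteq> b" using no_common[of p] pq sym by blast
    then have vq: "E v q" using pq adj by blast
    have "p \<noteq> v" "p \<noteq> a" "p \<noteq> b" using pq nn sym irrefl by blast+
    then have vp: "E v p" using adj[of p] pq by blast
    have "pm E 0 (nb (nb V p) q)"
      using pm_nb[OF pm_nb[OF V1 pq(1)], of q] pq by simp
    moreover have "v \<in> nb (nb V p) q" using V vp vq sym by auto
    ultimately obtain y where y: "y \<in> nb (nb V p) q" "y \<noteq> v" "\<not> E v y" using no_cone by meson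
    then have "y = a \<or> y = b" using adj by blast
    then show False using y pq no_common[of p] sym by blast
  qed
  let ?P = "insert a (nb V a)" and ?Q = "V - {v} - insert a (nb V a)"
  have "?P \<union> ?Q = V - {v}" "?P \<inter> ?Q = {}" "?P \<noteq> {}" "?Q \<noteq> {}"
    using V nn sym by blast+
  moreover have "\<not> (\<exists>p\<in>?P. \<exists>q\<in>?Q. E p q)"
    using no_edge by blast
  ultimately show ?thesis unfolding connected_on_def by blast
qed

section \<open>Vertex links of surfaces as short cycles\<close>

text \<open>If both neighbours of \<open>b\<close> were on the same side, the other side would be
  closed in \<open>L\<close>, which seven vertices do not allow. If they were on different sides,
  the walk from each of them away from \<open>b\<close> would stay on its side, and four vertices on
  each side exceed the six available.\<close>

lemma cycle_minus_vertex:
  assumes L: "pm E 1 L" "card L \<le> 7" and b: "b \<in> L"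
  shows "connected_on E (L - {b})"
proof (rule ccontr)
  assume "\<not> connected_on E (L - {b})"
  then obtain X Y where XY: "X \<union> Y = L - {b}" "X \<inter> Y = {}" "X \<noteq> {}" "Y \<noteq> {}"
    and no: "\<And>x y. x \<in> X \<Longrightarrow> y \<in> Y \<Longrightarrow> \<not> E x y"
    by (rule not_connected_onE) (rule that)
  have L1: "pm E (Suc 0) L" using L by simp
  have deg: "\<exists>p q. p \<noteq> q \<and> \<not> E p q \<and> nb L x = {p, q}" if "x \<in> L" for x
    using L1 that by simp
  obtain p q where pq: "p \<noteq> q" "nb L b = {p, q}" using deg[OF b] by blast
  have pqL: "p \<in> X \<union> Y" "q \<in> X \<union> Y" using pq XY irrefl by blast+
  have fin: "finite L" using pm_finite[OF L(1)] .
  \<comment> \<open>The walk \<open>p\<close>, \<open>x2\<close>, \<open>x3\<close>,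
    \<open>x4\<close> cannot return to \<open>b\<close>, whose only other neighbour \<open>q\<close>
    lies outside \<open>Z\<close>, nor close up early, since the two neighbours of a vertex are
    never adjacent.\<close>
  have big: "4 \<le> card Z" if Z: "Z \<subseteq> L - {b}" "\<forall>x\<in>Z. \<forall>y\<in>L - {b}. E x y \<longrightarrow> y \<in> Z"
    and p: "p \<in> Z" and q: "q \<notin> Z" and pq: "nb L b = {p, q}" for Z p q
  proof -
    have bp: "E b p" "p \<in> L" using pq by blast+
    have deg': "\<exists>z. nb L x = {y, z} \<and> z \<noteq> y \<and> \<not> E y z" if xy: "x \<in> L" "y \<in> L" "E y x" for x y
    proof -
      obtain r s where rs: "r \<noteq> s" "\<not> E r s" "nb L x = {r, s}" using deg[OF xy(1)] by blast
      then have "y = r \<or> y = s" using xy sym by blast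
      then show ?thesis using rs sym by (elim disjE) blast+
    qed
    obtain x2 where x2: "nb L p = {b, x2}" "x2 \<noteq> b"
      using deg'[of p b] bp b by blast
    have x2Z: "x2 \<in> Z" using Z(2) p x2 by blast
    have "x2 \<noteq> q" "x2 \<noteq> p" using x2Z q x2 irrefl by blast+
    have "E x2 p" "x2 \<in> L" using x2 sym by blast+
    then obtain x3 where x3: "nb L x2 = {p, x3}" "x3 \<noteq> p" "\<not> E p x3"
      using deg'[of x2 p] bp sym by blast
    have "x3 \<noteq> b" using x3 pq \<open>x2 \<noteq> q\<close> \<open>x2 \<noteq> p\<close> sym \<open>x2 \<in> L\<close> by blast
    then have x3Z: "x3 \<in> Z" using Z(2) x2Z x3 by blast
    have "E x2 x3" "x3 \<in> L" using x3 by blast+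
    then obtain x4 where x4: "nb L x3 = {x2, x4}" "x4 \<noteq> x2"
      using deg'[of x3 x2] \<open>x2 \<in> L\<close> by blast
    have "x4 \<noteq> p" using x3 x4 sym by blast
    have "x4 \<noteq> b" using x4 pq x3 x3Z q sym \<open>x3 \<in> L\<close> by blast
    then have x4Z: "x4 \<in> Z" using Z(2) x3Z x4 by blast
    have "x3 \<noteq> x2" "x4 \<noteq> x3" using x3 x4 irrefl by blast+
    then have "card {p, x2, x3, x4} = 4"
      using \<open>x2 \<noteq> p\<close> \<open>x3 \<noteq> p\<close> \<open>x4 \<noteq> p\<close> \<open>x4 \<noteq> x2\<close> by simp
    moreover have "card {p, x2, x3, x4} \<le> card Z"
      using p x2Z x3Z x4Z Z(1) fin by (intro card_mono) (auto intro: finite_subset)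
    ultimately show ?thesis by simp
  qed
  have clX: "\<forall>x\<in>X. \<forall>y\<in>L - {b}. E x y \<longrightarrow> y \<in> X"
    and clY: "\<forall>x\<in>Y. \<forall>y\<in>L - {b}. E x y \<longrightarrow> y \<in> Y"
    using XY no sym by blast+
  have small: "card L < 4 * (0 + 2)" using L by simp
  have "card X + card Y = card (L - {b})"
    using XY fin by (metis card_Un_disjoint finite_Diff finite_Un)
  then have sum: "card X + card Y \<le> 6" using b fin L by simp
  have not_b: "\<not> E z b" if "z \<in> L" "z \<noteq> p" "z \<noteq> q" for z
    using pq(2) that sym[of z b] by blast
  have cl: False if Z: "Z \<subseteq> L - {b}" "\<forall>x\<in>Z. \<forall>y\<in>L - {b}. E x y \<longrightarrow> y \<in> Z"
    "Z \<noteq> {}" "p \<notin> Z" "q \<notin> Z" for Z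
  proof -
    have "Z = L"
    proof (rule closed_subset_eq[OF L1 small])
      show "w \<in> Z" if "s \<in> Z" "w \<in> L" "E s w" for s w
      proof (cases "w = b")
        case True
        then show ?thesis using not_b[of s] that Z by blast
      next
        case False
        then show ?thesis using Z(2) that by blast
      qed
    qed (use Z in auto)
    then show False using b Z(1) by blast
  qed
  have sub: "X \<subseteq> L - {b}" "Y \<subseteq> L - {b}" using XY by blast+
  have disj: "\<And>z. z \<in> X \<Longrightarrow> z \<notin> Y" using XY by blast
  have qp: "nb L b = {q, p}" using pq by blast
  consider "p \<in> X" "q \<in> X" | "p \<in> Y" "q \<in> Y" | "p \<in> X" "q \<in> Y" | "p \<in> Y" "q \<in> X"
    using pqL by blast
  then show False
  proof cases
    case 1
    then show False using cl[OF sub(2) clY XY(4)] disj by blast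
  next
    case 2
    then show False using cl[OF sub(1) clX XY(3)] disj by blast
  next
    case 3
    then show False
      using big[OF sub(1) clX _ _ pq(2)] big[OF sub(2) clY _ _ qp] disj sum by fastforce
  next
    case 4
    then show False
      using big[OF sub(1) clX _ _ qp] big[OF sub(2) clY _ _ pq(2)] disj sum by fastforce
  qed
qed


lemma C4_neq:
  assumes "induced_C4 E a b c d"
  shows "a \<noteq> b" "b \<noteq> c" "c \<noteq> d" "d \<noteq> a" "a \<noteq> c" "b \<noteq> d"
  using assms irrefl unfolding induced_C4_def by auto

lemma C4_rot: "induced_C4 E a b c d \<Longrightarrow> induced_C4 E b c d a"
  unfolding induced_C4_def using sym by blast

text \<open>The link is 2-regular, so the four vertices already have all their neighbours in it; as
  7 < 8 there is no second component.\<close>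

lemma link_is_C4:
  assumes V: "pm E 2 V" "x \<in> V" "card (nb V x) \<le> 7"
    and C: "induced_C4 E a b c d" "{a, b, c, d} \<subseteq> nb V x"
  shows "nb V x = {a, b, c, d}"
proof -
  have pmx: "pm E (Suc 0) (nb V x)" using V by (simp add: numeral_2_eq_2)
  have two: "nb (nb V x) s = {p, q}"
    if "s \<in> nb V x" "E s p" "E s q" "p \<noteq> q" "p \<in> nb V x" "q \<in> nb V x" for s p q
  proof -
    have "pm E 0 (nb (nb V x) s)" by (rule pm_nb[OF pmx that(1)])
    then obtain p' q' where "nb (nb V x) s = {p', q'}" by (simp only: pm.simps) blast
    moreover have "p \<in> nb (nb V x) s" "q \<in> nb (nb V x) s" using that by auto
    ultimately show ?thesis using \<open>p \<noteq> q\<close> by auto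
  qed
  have edges: "E a b" "E b c" "E c d" "E d a" "E b a" "E c b" "E d c" "E a d"
    using C(1) sym unfolding induced_C4_def by auto
  have "nb (nb V x) a = {b, d}" "nb (nb V x) b = {a, c}"
    "nb (nb V x) c = {b, d}" "nb (nb V x) d = {a, c}"
    by (rule two; use C(2) C4_neq[OF C(1)] edges in simp)+
  then have cl: "w \<in> {a, b, c, d}" if "s \<in> {a, b, c, d}" "w \<in> nb V x" "E s w" for s w
    using that by blast
  have "{a, b, c, d} = nb V x"
    by (rule closed_subset_eq[OF pmx _ C(2) _ cl]) (use V(3) in auto)
  then show ?thesis by simp
qed

text \<open>The link of \<open>a\<close> without \<open>b\<close> is connected and is met by
  \<open>K\<close>, so some edge of it leaves \<open>K\<close>; the only exit allowed is
  \<open>d\<close>. Thus contact with one vertex of a 4-cycle passes on to the next one.\<close>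

lemma touch_step:
  assumes V: "pm E 2 V" "a \<in> V" "card (nb V a) \<le> 7"
    and bd: "b \<in> nb V a" "d \<in> nb V a" "b \<noteq> d" "b \<notin> K" "d \<notin> K"
    and K: "K \<subseteq> V" "k \<in> K" "E k a"
      "\<And>k x. k \<in> K \<Longrightarrow> x \<in> nb V a \<Longrightarrow> E k x \<Longrightarrow> x \<in> K \<or> x = b \<or> x = d"
  shows "\<exists>k\<in>K. E k d"
proof -
  have "pm E 1 (nb V a)" using V by (simp add: numeral_2_eq_2)
  then have conn: "connected_on E (nb V a - {b})"
    using cycle_minus_vertex V(3) bd(1) by blast
  have "k \<in> nb V a" using K(1-3) sym by blast
  have "\<exists>p\<in>K \<inter> nb V a. \<exists>q\<in>nb V a - {b} - K. E p q"
    using conn[unfolded connected_on_def, rule_format, of "K \<inter> nb V a" "nb V a - {b} - K"]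
      \<open>k \<in> nb V a\<close> K(2) bd by blast
  then obtain p q where pq: "p \<in> K" "q \<in> nb V a" "q \<noteq> b" "q \<notin> K" "E p q" by blast
  then have "q = d" using K(4)[of p q] by blast
  then show ?thesis using pq by blast
qed

subsection \<open>Surfaces\<close>

text \<open>A union of connected components of \<open>V - C\<close>; for an induced 4-cycle \<open>C\<close> with at least two
  components we look for such a side with the fewest vertices.\<close>

definition sides :: "'a set \<Rightarrow> 'a set \<Rightarrow> 'a set \<Rightarrow> bool" where
  "sides V C P \<longleftrightarrow> P \<subseteq> V - C \<and> P \<noteq> {} \<and> (\<forall>p\<in>P. \<forall>x\<in>V - C. E p x \<longrightarrow> x \<in> P)"

text \<open>A side without contact to the cycle would be closed in \<open>V\<close>, which eleven
  vertices do not allow; contact with one vertex travels round the cycle by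
  \<open>touch_step\<close>.\<close>

lemma side_touches:
  assumes V: "pm E 2 V" "card V \<le> 11" "\<And>v. v \<in> V \<Longrightarrow> card (nb V v) \<le> 7"
    and C: "induced_C4 E a b c d" "{a, b, c, d} \<subseteq> V"
    and K: "sides V {a, b, c, d} K"
  shows "\<forall>z\<in>{a, b, c, d}. \<exists>k\<in>K. E k z"
proof -
  have K': "K \<subseteq> V" "K \<inter> {a, b, c, d} = {}" "K \<noteq> {}"
    "\<And>k x. k \<in> K \<Longrightarrow> x \<in> V \<Longrightarrow> E k x \<Longrightarrow> x \<in> K \<or> x \<in> {a, b, c, d}"
    using K unfolding sides_def by blast+
  have step: "\<exists>k\<in>K. E k s"
    if C': "induced_C4 E p q r s" "{p, q, r, s} = {a, b, c, d}" and k: "\<exists>k\<in>K. E k p" for p q r s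
  proof -
    obtain k0 where k0: "k0 \<in> K" "E k0 p" using k by blast
    have inV: "{p, q, r, s} \<subseteq> V" using C' C by simp
    have e: "E p q" "E p s" "\<not> E p r" "q \<noteq> s"
      using C'(1) sym unfolding induced_C4_def by auto
    have disj: "K \<inter> {p, q, r, s} = {}" using K'(2) C'(2) by simp
    show ?thesis
    proof (rule touch_step[where a = p and b = q and V = V and k = k0])
      show "x \<in> K \<or> x = q \<or> x = s" if "k \<in> K" "x \<in> nb V p" "E k x" for k x
      proof -
        have "x \<in> K \<or> x \<in> {p, q, r, s}" using K'(4)[of k x] that unfolding C'(2) by blast
        moreover have "x \<noteq> p" "x \<noteq> r" using that(2) e irrefl by auto
        ultimately show ?thesis by blast
      qed
    qed (use V inV e disj k0 K'(1) in auto)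
  qed
  have "\<exists>k\<in>K. \<exists>z\<in>{a, b, c, d}. E k z"
  proof (rule ccontr)
    assume no: "\<not> ?thesis"
    have V2: "pm E (Suc 1) V" using V(1) by (simp add: numeral_2_eq_2)
    have "K = V"
    proof (rule closed_subset_eq[OF V2])
      show "w \<in> K" if "s \<in> K" "w \<in> V" "E s w" for s w
        using K'(4)[OF that] no that by blast
    qed (use V(2) K' in auto)
    then show False using K'(2) C(2) by blast
  qed
  then have some: "(\<exists>k\<in>K. E k a) \<or> (\<exists>k\<in>K. E k b) \<or> (\<exists>k\<in>K. E k c) \<or> (\<exists>k\<in>K. E k d)"
    by blast
  note C2 = C4_rot[OF C(1)]
  note C3 = C4_rot[OF C2]
  note C4 = C4_rot[OF C3]
  have "(\<exists>k\<in>K. E k a) \<longrightarrow> (\<exists>k\<in>K. E k d)" by (rule impI, rule step[OF C(1)]) auto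
  moreover have "(\<exists>k\<in>K. E k b) \<longrightarrow> (\<exists>k\<in>K. E k a)" by (rule impI, rule step[OF C2]) auto
  moreover have "(\<exists>k\<in>K. E k c) \<longrightarrow> (\<exists>k\<in>K. E k b)" by (rule impI, rule step[OF C3]) auto
  moreover have "(\<exists>k\<in>K. E k d) \<longrightarrow> (\<exists>k\<in>K. E k c)" by (rule impI, rule step[OF C4]) auto
  ultimately have "(\<exists>k\<in>K. E k a) \<and> (\<exists>k\<in>K. E k b) \<and> (\<exists>k\<in>K. E k c) \<and> (\<exists>k\<in>K. E k d)"
    using some by argo
  then show ?thesis by simp
qed

text \<open>Let \<open>Q\<close> be the part opposite to \<open>P\<close>. As every side of the old
  cycle touches each of its vertices, \<open>Q\<close> lies entirely in the part \<open>X\<close>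
  that contains an old vertex \<open>c0\<close> off the new cycle, and then no old vertex can lie in
  the other part \<open>Y\<close>. So \<open>Y\<close> is inside \<open>P\<close>, and properly,
  because the new cycle uses up a vertex of \<open>P\<close>.\<close>

lemma smaller_side:
  assumes V: "pm E 2 V" "card V \<le> 11" "\<And>v. v \<in> V \<Longrightarrow> card (nb V v) \<le> 7"
    and C: "induced_C4 E a b c d" "{a, b, c, d} \<subseteq> V"
    and P: "sides V {a, b, c, d} P" "P \<noteq> V - {a, b, c, d}"
    and C': "induced_C4 E a' b' c' d'" "{a', b', c', d'} \<subseteq> P \<union> {a, b, c, d}"
      "{a', b', c', d'} \<inter> P \<noteq> {}" "\<not> connected_on E (V - {a', b', c', d'})"
  shows "\<exists>P'. sides V {a', b', c', d'} P' \<and> P' \<noteq> V - {a', b', c', d'} \<and> P' \<subset> P"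
proof -
  define D where "D = {a, b, c, d}"
  define D' where "D' = {a', b', c', d'}"
  define Q where "Q = V - D - P"
  have card4: "card D = 4" "card D' = 4"
    using C4_neq[OF C(1)] C4_neq[OF C'(1)] unfolding D_def D'_def by auto
  have P': "P \<subseteq> V" "P \<inter> D = {}" "P \<noteq> {}" "\<And>p x. p \<in> P \<Longrightarrow> x \<in> V - D \<Longrightarrow> E p x \<Longrightarrow> x \<in> P"
    using P(1) unfolding sides_def D_def by blast+
  have Q: "sides V D Q"
    unfolding sides_def
  proof (intro conjI ballI impI)
    show "Q \<noteq> {}" using P(2) P(1) unfolding sides_def Q_def D_def by blast
    show "x \<in> Q" if "q \<in> Q" "x \<in> V - D" "E q x" for q x
      using P'(4)[of x q] that sym[of q x] unfolding Q_def by blast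
  qed (auto simp: Q_def)
  have sub: "D \<subseteq> V" "D' \<subseteq> P \<union> D" "D' \<inter> P \<noteq> {}"
    using C(2) C'(2,3) unfolding D_def D'_def by auto
  have "\<not> D \<subseteq> D'"
  proof
    assume "D \<subseteq> D'"
    then have "D = D'" using card4 by (metis card_subset_eq card.infinite zero_neq_numeral)
    then show False using sub(3) P'(2) by blast
  qed
  then obtain c0 where c0: "c0 \<in> D" "c0 \<notin> D'" by blast
  have touch: "\<exists>k\<in>K. E k z" if "sides V D K" "z \<in> D" for K z
    using side_touches[OF V C] that unfolding D_def by blast
  obtain X0 Y0 where XY0: "X0 \<union> Y0 = V - D'" "X0 \<inter> Y0 = {}" "X0 \<noteq> {}" "Y0 \<noteq> {}"
    "\<And>x y. x \<in> X0 \<Longrightarrow> y \<in> Y0 \<Longrightarrow> \<not> E x y"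
    using C'(4)[folded D'_def] by (rule not_connected_onE) (rule that)
  obtain X Y where XY: "X \<union> Y = V - D'" "X \<inter> Y = {}" "X \<noteq> {}" "Y \<noteq> {}"
    "\<And>x y. x \<in> X \<Longrightarrow> y \<in> Y \<Longrightarrow> \<not> E x y" "c0 \<in> X"
  proof (cases "c0 \<in> X0")
    case True
    then show ?thesis using that[of X0 Y0] XY0 by blast
  next
    case False
    then have "c0 \<in> Y0" using XY0(1) c0 sub(1) by blast
    then show ?thesis using that[of Y0 X0] XY0 sym by blast
  qed
  have QD': "Q \<inter> D' = {}" using sub(2) Q_def by blast
  have Qcl: "\<And>q x. q \<in> Q \<Longrightarrow> x \<in> V - D \<Longrightarrow> E q x \<Longrightarrow> x \<in> Q" and Qsub: "Q \<subseteq> V - D" "Q \<noteq> {}"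
    using Q unfolding sides_def by blast+
  \<comment> \<open>\<open>Q \<inter> Y\<close> would itself be a side of the old cycle and hence
    touch \<open>c0\<close>, which lies in \<open>X\<close>.\<close>
  have "Q \<inter> Y = {}"
  proof (rule ccontr)
    assume ne: "Q \<inter> Y \<noteq> {}"
    have "x \<in> Q \<inter> Y" if "q \<in> Q \<inter> Y" "x \<in> V - D" "E q x" for q x
    proof -
      have "x \<in> Q" using Qcl that by blast
      moreover have "x \<notin> X" using XY(5)[of x q] that sym by blast
      ultimately show ?thesis using XY(1) QD' Qsub(1) by blast
    qed
    then have "sides V D (Q \<inter> Y)" using ne Qsub unfolding sides_def by blast
    then obtain k where "k \<in> Q \<inter> Y" "E k c0" using touch c0(1) by blast
    then show False using XY(5)[of c0 k] XY(6) sym by blast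
  qed
  then have QX: "Q \<subseteq> X" using XY(1) QD' Qsub by blast
  have "Y \<inter> D = {}"
  proof (rule ccontr)
    assume "Y \<inter> D \<noteq> {}"
    then obtain c1 where "c1 \<in> Y" "c1 \<in> D" by blast
    then obtain k where "k \<in> Q" "E k c1" using touch[OF Q] by blast
    then show False using XY(5)[of k c1] QX \<open>c1 \<in> Y\<close> by blast
  qed
  then have YP: "Y \<subseteq> P" using XY(1) QX XY(2) unfolding Q_def by blast
  have "sides V D' Y"
    unfolding sides_def using XY(1,2,4,5) sym by blast
  moreover have "Y \<noteq> V - D'" using XY(1-3) by blast
  moreover have "Y \<subset> P" using YP sub(3) XY(1) by blast
  ultimately show ?thesis unfolding D'_def by blast
qed

text \<open>By induction no induced 4-cycle within \<open>P\<close> and the given cycle may use a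
  vertex of \<open>P\<close>. The 4-cycle that \<open>H\<close> gives for the edge from
  \<open>a\<close> to a vertex \<open>x\<close> of \<open>P\<close> must therefore cross to the far
  side, which it can do only through \<open>c\<close>. So \<open>x\<close> is joined to
  \<open>c\<close>, and then also to \<open>b\<close> and \<open>d\<close>, as otherwise a forbidden
  cycle appears.\<close>

lemma surface_degree_four:
  assumes V: "pm E 2 V" "card V \<le> 11" "\<And>v. v \<in> V \<Longrightarrow> card (nb V v) \<le> 7"
    and H: "\<And>u v. u \<in> V \<Longrightarrow> v \<in> V \<Longrightarrow> E u v \<Longrightarrow> \<exists>w\<in>V. \<exists>t\<in>V. induced_C4 E u v w t"
    and J: "\<And>a b c d. induced_C4 E a b c d \<Longrightarrow> {a, b, c, d} \<subseteq> V \<Longrightarrow> \<not> connected_on E (V - {a, b, c, d})"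
    and C: "induced_C4 E a b c d" "{a, b, c, d} \<subseteq> V"
    and P: "sides V {a, b, c, d} P" "P \<noteq> V - {a, b, c, d}"
  shows "\<exists>x\<in>V. \<exists>a b c d. induced_C4 E a b c d \<and> nb V x = {a, b, c, d}"
  using C P
proof (induction "card P" arbitrary: a b c d P rule: less_induct)
  case less
  note C = less.prems(1,2) and P = less.prems(3,4)
  have P': "P \<subseteq> V" "P \<inter> {a, b, c, d} = {}"
    "\<And>p x. p \<in> P \<Longrightarrow> x \<in> V \<Longrightarrow> E p x \<Longrightarrow> x \<in> P \<or> x \<in> {a, b, c, d}"
    using P unfolding sides_def by blast+
  have edges: "E a b" "E b c" "E c d" "E d a" "E b a" "E c b" "E d c" "E a d"
    "\<not> E a c" "\<not> E c a" "\<not> E b d" "\<not> E d b"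
    using C(1) sym unfolding induced_C4_def by auto
  note neq = C4_neq[OF C(1)]
  obtain x where x: "x \<in> P" "E x a" using side_touches[OF V C P(1)] by blast
  then have "x \<in> V" "E a x" using P'(1) sym by blast+
  show ?case
  proof (rule ccontr)
    assume no: "\<not> ?case"
    have inner: False
      if C': "induced_C4 E a' b' c' d'" "{a', b', c', d'} \<subseteq> P \<union> {a, b, c, d}"
        "{a', b', c', d'} \<inter> P \<noteq> {}" for a' b' c' d'
    proof -
      have C'V: "{a', b', c', d'} \<subseteq> V" using C' C(2) P'(1) by blast
      then obtain P1 where P1: "sides V {a', b', c', d'} P1" "P1 \<noteq> V - {a', b', c', d'}" "P1 \<subset> P"
        using smaller_side[OF V C P C' J[OF C'(1)]] by blast
      have "finite P" using P'(1) pm_finite[OF V(1)] finite_subset by blast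
      then have "card P1 < card P" using P1(3) psubset_card_mono by blast
      then show False using less.hyps[OF _ C'(1) C'V P1(1,2)] no by blast
    qed
    obtain y z where yz: "y \<in> V" "z \<in> V" "induced_C4 E a x y z"
      using H[OF _ \<open>x \<in> V\<close> \<open>E a x\<close>] C(2) by blast
    have e: "E x y" "E y z" "E z a" "\<not> E a y" "\<not> E x z" "a \<noteq> y" "x \<noteq> z" "E a z"
      using yz(3) sym unfolding induced_C4_def by auto
    have yPC: "y \<in> P \<union> {a, b, c, d}" using P'(3)[OF x(1) yz(1) e(1)] by blast
    have "z \<notin> P \<union> {a, b, c, d}"
    proof
      assume "z \<in> P \<union> {a, b, c, d}"
      then have "{a, x, y, z} \<subseteq> P \<union> {a, b, c, d}" using yPC x(1) by blast
      then show False using inner[OF yz(3)] x(1) by blast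
    qed
    moreover have "y \<notin> P" using P'(3)[of y z] e(2) yz(2) calculation by blast
    ultimately have yc: "y = c" using yPC e edges by blast
    then have xc: "E x c" "E c x" using e(1) sym by blast+
    have xb: "E x b"
    proof (rule ccontr)
      assume "\<not> E x b"
      then have "induced_C4 E a x c b"
        unfolding induced_C4_def using \<open>E a x\<close> xc edges x(1) P'(2) neq by auto
      then show False using inner[of a x c b] x(1) by blast
    qed
    have xd: "E x d"
    proof (rule ccontr)
      assume "\<not> E x d"
      then have "induced_C4 E a x c d"
        unfolding induced_C4_def using \<open>E a x\<close> xc edges x(1) P'(2) neq by auto
      then show False using inner[of a x c d] x(1) by blast
    qed
    have "nb V x = {a, b, c, d}"
      by (rule link_is_C4[OF V(1) \<open>x \<in> V\<close> V(3)[OF \<open>x \<in> V\<close>] C(1)])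
        (use C(2) x(2) xc xb xd in auto)
    then show False using no \<open>x \<in> V\<close> C(1) by blast
  qed
qed

text \<open>Start from a vertex \<open>x\<close> whose link is a 4-cycle. \<open>H\<close> for the
  edges at \<open>x\<close> yields \<open>y\<close> opposite to \<open>x\<close> on a 4-cycle
  through \<open>a\<close> and \<open>c\<close>, and \<open>y'\<close> likewise through
  \<open>b\<close> and \<open>d\<close>. Separation forces \<open>y' = y\<close>, so
  \<open>x\<close> and \<open>y\<close> have the same link and the six vertices are closed under
  adjacency.\<close>

lemma surface_octahedron:
  assumes V: "pm E 2 V" "card V \<le> 11" "\<And>v. v \<in> V \<Longrightarrow> card (nb V v) \<le> 7"
    and H: "\<And>u v. u \<in> V \<Longrightarrow> v \<in> V \<Longrightarrow> E u v \<Longrightarrow> \<exists>w\<in>V. \<exists>t\<in>V. induced_C4 E u v w t"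
    and J: "\<And>a b c d. induced_C4 E a b c d \<Longrightarrow> {a, b, c, d} \<subseteq> V \<Longrightarrow> \<not> connected_on E (V - {a, b, c, d})"
  shows "\<exists>x\<in>V. \<exists>y\<in>V. V - nb V x = {x, y}"
proof -
  have V2: "pm E (Suc 1) V" using V(1) by (simp add: numeral_2_eq_2)
  obtain u where u: "u \<in> V" using pm_nonempty[OF V(1)] by blast
  obtain v where v: "v \<in> V" "E u v" using pm_nonempty[OF pm_nb[OF V2 u]] by blast
  obtain w t where wt: "w \<in> V" "t \<in> V" "induced_C4 E u v w t" using H[OF u v] by blast
  have uvwt: "{u, v, w, t} \<subseteq> V" using u v wt by blast
  obtain P Q where PQ: "P \<union> Q = V - {u, v, w, t}" "P \<inter> Q = {}" "P \<noteq> {}" "Q \<noteq> {}"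
    "\<And>x y. x \<in> P \<Longrightarrow> y \<in> Q \<Longrightarrow> \<not> E x y"
    using J[OF wt(3) uvwt] by (rule not_connected_onE) (rule that)
  have "sides V {u, v, w, t} P" "P \<noteq> V - {u, v, w, t}"
    using PQ unfolding sides_def by blast+
  then obtain x a b c d where x: "x \<in> V" "induced_C4 E a b c d" "nb V x = {a, b, c, d}"
    using surface_degree_four[OF V H J wt(3) uvwt] by blast
  have CV: "{a, b, c, d} \<subseteq> V" using x(3) by blast
  have edges: "E a b" "E b c" "E c d" "E d a" "E b a" "E c b" "E d c" "E a d"
    "\<not> E a c" "\<not> E c a" "\<not> E b d" "\<not> E d b"
    using x(2) sym unfolding induced_C4_def by auto
  have xe: "E x a" "E x b" "E x c" "E x d" using x(3) by blast+
  note neq = C4_neq[OF x(2)]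
  have opp: "\<exists>y\<in>V. induced_C4 E x p y r"
    if C': "induced_C4 E p q r s" "{p, q, r, s} = {a, b, c, d}" for p q r s
  proof -
    have p: "p \<in> V" "E x p" using C' x(3) CV by blast+
    obtain y z where yz: "y \<in> V" "z \<in> V" "induced_C4 E x p y z" using H[OF x(1) p] by blast
    have "z \<in> nb V x" "\<not> E p z" "p \<noteq> z" using yz sym unfolding induced_C4_def by auto
    moreover have "E p q" "E p s" using C'(1) sym unfolding induced_C4_def by auto
    moreover have "z \<in> {p, q, r, s}" using calculation(1) x(3) unfolding C'(2) by simp
    ultimately have "z = r" by blast
    then show ?thesis using yz by blast
  qed
  obtain y where y: "y \<in> V" "induced_C4 E x a y c" using opp[OF x(2)] by blast
  have "{b, c, d, a} = {a, b, c, d}" by auto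
  then obtain y' where y': "y' \<in> V" "induced_C4 E x b y' d"
    using opp[OF C4_rot[OF x(2)]] by blast
  have ye: "E y a" "E y c" "\<not> E x y" "x \<noteq> y" using y sym unfolding induced_C4_def by auto
  have y'e: "E y' b" "E y' d" "\<not> E x y'" "x \<noteq> y'" using y' sym unfolding induced_C4_def by auto
  have D: "{x, a, y, c} \<subseteq> V" using x(1) y(1) CV by blast
  obtain X Y where XY: "X \<union> Y = V - {x, a, y, c}" "X \<inter> Y = {}" "X \<noteq> {}" "Y \<noteq> {}"
    "\<And>x y. x \<in> X \<Longrightarrow> y \<in> Y \<Longrightarrow> \<not> E x y"
    using J[OF y(2) D] by (rule not_connected_onE) (rule that)
  \<comment> \<open>Both sides touch \<open>x\<close>, whose neighbours off this cycle are
    \<open>b\<close> and \<open>d\<close>, so these two are separated. Being adjacent to both,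
    \<open>y'\<close> lies on the cycle; it is neither \<open>x\<close> nor a neighbour of
    \<open>x\<close>, which leaves \<open>y\<close>.\<close>
  have "sides V {x, a, y, c} X" "sides V {x, a, y, c} Y"
    using XY sym unfolding sides_def by blast+
  then obtain k l where kl: "k \<in> X" "E k x" "l \<in> Y" "E l x"
    using side_touches[OF V y(2) D] by blast
  then have "k \<in> {b, d}" "l \<in> {b, d}" "k \<noteq> l"
    using x(3) XY(1,2) sym by blast+
  moreover have "\<not> E p q" if "p \<in> Y" "q \<in> X" for p q using XY(5) that sym by blast
  ultimately have "y' \<notin> X \<union> Y" using kl y'e XY(5) sym by blast
  then have "y' \<in> {x, a, y, c}" using XY(1) y'(1) by blast
  then have "y' = y" using y'e xe by blast
  then have yb: "E y b" "E y d" using y'e by blast+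
  have nby: "nb V y = {a, b, c, d}"
    by (rule link_is_C4[OF V(1) y(1) V(3)[OF y(1)] x(2)]) (use CV ye yb in auto)
  let ?S = "{x, y, a, b, c, d}"
  have V0: "pm E (Suc (Suc 0)) V" using V(1) by (simp add: numeral_2_eq_2)
  have cl: "nb V p \<subseteq> ?S"
    if C': "induced_C4 E p q r s" "{p, q, r, s} = {a, b, c, d}" for p q r s
  proof -
    have e: "E p q" "E p s" "q \<noteq> s" using C'(1) sym unfolding induced_C4_def by auto
    have in4: "p \<in> {a, b, c, d}" "q \<in> {a, b, c, d}" "s \<in> {a, b, c, d}" using C'(2) by blast+
    then have "p \<in> nb V x" "q \<in> nb V x" "s \<in> nb V x" "p \<in> nb V y" "q \<in> nb V y" "s \<in> nb V y"
      unfolding x(3) nby by simp_all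
    then have pV: "p \<in> V" "E p x" "E p y"
      and qs: "q \<in> nb V p" "s \<in> nb V p" "E q x" "E q y" "E s x" "E s y" "E x q" "E y s"
      using e by (auto intro: sym)
    have "nb V p = {x, q, y, s}"
    proof (rule link_is_C4[OF V(1) pV(1) V(3)[OF pV(1)]])
      show "induced_C4 E x q y s"
        using qs ye e C'(1) unfolding induced_C4_def by simp
    qed (use qs pV x(1) y(1) in auto)
    then show ?thesis using in4 by blast
  qed
  have "?S = V"
  proof (rule closed_subset_eq[OF V0])
    have perms: "{b, c, d, a} = {a, b, c, d}" "{c, d, a, b} = {a, b, c, d}" "{d, a, b, c} = {a, b, c, d}"
      by auto
    note C2 = C4_rot[OF x(2)]
    note C3 = C4_rot[OF C2]
    note C4 = C4_rot[OF C3]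
    have "nb V a \<subseteq> ?S" "nb V b \<subseteq> ?S" "nb V c \<subseteq> ?S" "nb V d \<subseteq> ?S" "nb V x \<subseteq> ?S" "nb V y \<subseteq> ?S"
      using cl[OF x(2)] cl[OF C2 perms(1)] cl[OF C3 perms(2)] cl[OF C4 perms(3)] x(3) nby by auto
    then show "w \<in> ?S" if "s \<in> ?S" "w \<in> V" "E s w" for s w
      using that by blast
  qed (use V(2) CV x(1) y(1) in auto)
  then have "V - nb V x = {x, y}" using x(3) ye xe y(1) neq irrefl by blast
  then show ?thesis using x(1) y(1) by blast
qed


subsection \<open>Three-manifolds with at most eleven vertices\<close>

text \<open>The surfaces in question are the octahedron and the suspension of a pentagon. If every
  vertex had two non-neighbours, there would be exactly seven vertices, all of degree 4. With
  \<open>a\<close> and \<open>b\<close> the non-neighbours of \<open>u\<close>, each vertex on the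
  link of \<open>u\<close> is joined to at most one of them, and to the same one along the whole
  link, although both need a neighbour there.\<close>

lemma small_surface_unique_non_neighbour:
  assumes L: "pm E 2 L" "card L \<le> 7"
  shows "\<exists>u\<in>L. \<exists>u'\<in>L. L - nb L u = {u, u'} \<and> u \<noteq> u'"
proof (rule ccontr)
  assume none: "\<not> ?thesis"
  have L2: "pm E (Suc (Suc 0)) L" using L(1) by (simp add: numeral_2_eq_2)
  have fin: "finite L" using pm_finite[OF L(1)] .
  have card_nb: "card (L - nb L x) = card L - card (nb L x)" for x
    using fin by (intro card_Diff_subset) auto
  have deg_ge: "4 \<le> card (nb L x)" if "x \<in> L" for x
    using card_pm[OF pm_nb[OF L2 that]] by simp
  have non_ge: "3 \<le> card (L - nb L x)" if x: "x \<in> L" for x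
  proof -
    obtain y where y: "y \<in> L" "y \<noteq> x" "\<not> E x y" using no_cone[OF L(1) x] by auto
    have xy: "{x, y} \<subseteq> L - nb L x" using x y irrefl by blast
    then have "{x, y} \<noteq> L - nb L x" using none x y by metis
    then have "{x, y} \<subset> L - nb L x" using xy by blast
    then have "card {x, y} < card (L - nb L x)" using fin by (intro psubset_card_mono) auto
    then show ?thesis using y by simp
  qed
  have deg: "card (nb L x) = 4" if "x \<in> L" for x
    using deg_ge[OF that] non_ge[OF that] L(2) card_nb[of x] by linarith
  obtain u where u: "u \<in> L" using pm_nonempty[OF L(1)] by blast
  let ?N = "nb L u"
  have N: "pm E (Suc 0) ?N" using pm_nb[OF L2 u] .
  have "card L = 7" using non_ge[OF u] deg[OF u] L(2) card_nb[of u] by linarith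
  then have "card (L - ?N - {u}) = 2"
    using card_nb[of u] deg[OF u] u irrefl fin by simp
  then obtain a b where ab: "L - ?N - {u} = {a, b}" "a \<noteq> b" by (meson card_2_iff)
  then have abL: "a \<in> L" "b \<in> L" "\<not> E u a" "\<not> E u b" "a \<noteq> u" "b \<noteq> u" by blast+
  have Lu: "x \<in> ?N \<or> x = u \<or> x = a \<or> x = b" if "x \<in> L" for x using ab that by blast
  have one: "nb L c = insert u (insert y (nb ?N c))"
    if c: "c \<in> ?N" and y: "y \<in> {a, b}" "E c y" for c y
  proof -
    have "pm E 0 (nb ?N c)" using pm_nb[OF N c] .
    then have "card (nb ?N c) = 2" by auto
    moreover have "u \<noteq> y" "u \<notin> nb ?N c" "y \<notin> nb ?N c" using y abL irrefl by auto
    moreover have "finite (nb ?N c)" using fin by simp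
    ultimately have "card (insert u (insert y (nb ?N c))) = 4" by simp
    moreover have "insert u (insert y (nb ?N c)) \<subseteq> nb L c"
      using c y u abL sym[of u c] by auto
    moreover have "card (nb L c) = 4" "finite (nb L c)" using deg c fin by auto
    ultimately show ?thesis using card_subset_eq by metis
  qed
  have share: "E c' y" if c: "c \<in> ?N" "c' \<in> ?N" "E c c'" and y: "y \<in> {a, b}" "E c y" for c c' y
  proof -
    have "pm E 0 (nb (nb L c) c')"
      by (rule pm_nb[OF pm_nb[OF L2]]) (use c in auto)
    moreover have "u \<in> nb (nb L c) c'" using c u sym by auto
    ultimately obtain z where z: "z \<in> nb (nb L c) c'" "z \<noteq> u" "\<not> E u z" using no_cone by meson
    then have "z \<in> insert u (insert y (nb ?N c))" using one[OF c(1) y] by blast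
    then have "z = y" using z by blast
    then show ?thesis using z by blast
  qed
  have all: "\<forall>c\<in>?N. E c y" if "y \<in> {a, b}" "c0 \<in> ?N" "E c0 y" for y c0
  proof -
    have "{c \<in> ?N. E c y} = ?N"
    proof (rule closed_subset_eq[OF N])
      show "w \<in> {c \<in> ?N. E c y}" if "s \<in> {c \<in> ?N. E c y}" "w \<in> ?N" "E s w" for s w
        using share[of s w y] \<open>y \<in> {a, b}\<close> that by blast
    qed (use deg[OF u] that in auto)
    then show ?thesis by blast
  qed
  have "\<exists>c\<in>?N. E c y" if "y \<in> {a, b}" for y
  proof (rule ccontr)
    assume "\<not> ?thesis"
    then have "nb L y \<subseteq> {a, b}" using Lu that abL sym by blast
    then have "card (nb L y) \<le> card {a, b}" by (intro card_mono) auto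
    then show False using deg[of y] that abL ab(2) by auto
  qed
  then have "\<forall>c\<in>?N. E c a" "\<forall>c\<in>?N. E c b" using all by blast+
  moreover obtain c where c: "c \<in> ?N" using pm_nonempty[OF N] by blast
  ultimately have "b \<in> nb L c" "E c a" using abL by blast+
  then have "b \<in> insert u (insert a (nb ?N c))" using one[OF c, of a] by blast
  then show False using ab(2) abL irrefl by blast
qed

text \<open>The bound in \<open>non\<close> counts the vertex itself, so it asks for three
  non-neighbours. In the join of two cycles of length 4 or 5 the vertex \<open>v\<close> misses only
  one or two vertices.\<close>

lemma no_small_three_manifold:
  assumes V: "pm E 3 V" "card V \<le> 11"
    and deg7: "\<And>v. v \<in> V \<Longrightarrow> card (nb V v) \<le> 7"
    and non: "\<And>v. v \<in> V \<Longrightarrow> 4 \<le> card (V - nb V v)"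
  shows False
proof -
  have V3: "pm E (Suc 2) V" using V(1) by (simp add: eval_nat_numeral)
  have fin: "finite V" using pm_finite[OF V(1)] .
  define m where "m = Max ((\<lambda>v. card (nb V v)) ` V)"
  have "m \<in> (\<lambda>v. card (nb V v)) ` V"
    unfolding m_def using fin pm_nonempty[OF V(1)] by (intro Max_in) auto
  then obtain v where v: "v \<in> V" "card (nb V v) = m" by auto
  have deg: "card (nb V w) \<le> m" if "w \<in> V" for w
    unfolding m_def using fin that by (intro Max_ge) auto
  have m7: "m \<le> 7" using v deg7 by blast
  \<comment> \<open>The link of \<open>v\<close> is the suspension with poles \<open>u\<close> and
    \<open>u'\<close> of the cycle \<open>C\<close>, whose length m - 2 is four or five.\<close>
  obtain u u' where uu': "u \<in> nb V v" "u' \<in> nb V v" "nb V v - nb (nb V v) u = {u, u'}" "u \<noteq> u'"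
    using small_surface_unique_non_neighbour[OF pm_nb[OF V3 v(1)] deg7[OF v(1)]] by blast
  define C where "C = nb V v - {u, u'}"
  have C: "C = nb (nb V v) u" using uu' irrefl unfolding C_def by blast
  have finC: "finite C" using fin unfolding C_def by simp
  have cardC: "card C = m - 2"
    using v(2) uu' fin unfolding C_def by (simp add: card_Diff_subset)
  have "2 * (2 + 1) \<le> card (nb V v)" by (rule card_pm[OF pm_nb[OF V3 v(1)]])
  then have m6: "6 \<le> m" using v by simp
  have uV: "u \<in> V" "u' \<in> V" "E v u" "E v u'" "\<not> E u u'" using uu' by blast+
  have nbv: "nb V v = C \<union> {u, u'}" using uu' unfolding C_def by blast
  have CV: "C \<subseteq> V" using C by blast
  \<comment> \<open>By maximality of \<open>m\<close>, the link of \<open>t\<close> is the suspension of \<open>C\<close> by \<open>s\<close> and a next vertex \<open>s'\<close>; the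
    vertices met in this way form a cycle whose join with \<open>C\<close> is everything.\<close>
  have next_vertex: "\<exists>s'. nb V t = C \<union> {s, s'} \<and> s' \<in> V \<and> s' \<notin> C \<and> s' \<noteq> s \<and> \<not> E s s' \<and> (\<forall>x\<in>C. E x s')"
    if st: "s \<in> V" "t \<in> V" "E s t" "\<forall>x\<in>C. E x t" "\<forall>x\<in>C. E x s" "nb V s \<inter> nb V t \<subseteq> C" for s t
  proof -
    have pmt: "pm E 2 (nb V t)" by (rule pm_nb[OF V3 st(2)])
    have Ct: "C \<subseteq> nb V t" using CV st(4) sym by blast
    have sN: "s \<in> nb V t" "s \<notin> C" using st irrefl sym by blast+
    obtain s' where s': "s' \<in> nb V t" "s' \<noteq> s" "\<not> E s s'" using no_cone[OF pmt sN(1)] by blast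
    have s'C: "s' \<notin> C" using s'(3) st(5) sym by blast
    have "card (C \<union> {s, s'}) = m"
      using finC cardC m6 sN s'C s'(2) by simp
    then have "card (nb V t) \<le> card (C \<union> {s, s'})" using deg[OF st(2)] by simp
    then have eq: "C \<union> {s, s'} = nb V t"
      using Ct sN s' fin by (intro card_seteq) auto
    have "E x s'" if x: "x \<in> C" for x
    proof -
      have "E s' x"
      proof (rule unique_non_neighbour[OF pmt sN(1) s'(1)])
        show "E s y" if "y \<in> nb V t" "y \<noteq> s" "y \<noteq> s'" for y
          using that st(5) sym unfolding eq[symmetric] by blast
      qed (use x Ct sN s'C in auto)
      then show ?thesis using sym by blast
    qed
    then show ?thesis using eq s' s'C by blast
  qed
  have Cv: "\<forall>x\<in>C. E x v" and Cu: "\<forall>x\<in>C. E x u" using C sym by blast+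
  have "\<forall>x\<in>C. E u' x"
  proof
    fix x assume x: "x \<in> C"
    show "E u' x"
      by (rule unique_non_neighbour[OF pm_nb[OF V3 v(1)] uu'(1,2), of x])
        (use x uu' in \<open>auto simp: C_def\<close>)
  qed
  then have Cu': "\<forall>x\<in>C. E x u'" using sym by blast
  obtain v' where v': "nb V u = C \<union> {v, v'}" "v' \<in> V" "v' \<notin> C" "v' \<noteq> v" "\<not> E v v'" "\<forall>x\<in>C. E x v'"
    using next_vertex[OF v(1) uV(1,3) Cu Cv] C by blast
  have "nb V v \<inter> nb V u' \<subseteq> C" using nbv irrefl uV(5) sym by blast
  then obtain u'' where u'': "nb V u' = C \<union> {v, u''}" "u'' \<in> V" "u'' \<notin> C" "u'' \<noteq> v" "\<not> E v u''" "\<forall>x\<in>C. E x u''"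
    using next_vertex[OF v(1) uV(2,4) Cu' Cv] by blast
  have uv': "E u v'" using v' by blast
  have "nb V u \<inter> nb V v' \<subseteq> C" using v'(1,5) irrefl sym by blast
  then obtain v'' where v'': "nb V v' = C \<union> {u, v''}" "v'' \<in> V" "v'' \<notin> C" "v'' \<noteq> u" "\<not> E u v''" "\<forall>x\<in>C. E x v''"
    using next_vertex[OF uV(1) v'(2) uv' v'(6) Cu] by blast
  have v'u': "v' \<noteq> u'" using uv' uV by blast
  have notC: "u \<notin> C" "u' \<notin> C" "v \<notin> C" unfolding C_def using irrefl by auto
  have u'v: "E u' v" "E u v" using uV sym by blast+
  have uneqv: "u \<noteq> v" "u' \<noteq> v" "v' \<noteq> u" using uV irrefl uv' by blast+
  have pmC: "pm E (Suc 0) C" 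
    using pm_nb[OF pm_nb[OF V3[unfolded numeral_2_eq_2] v(1)] uu'(1)] C by simp
  have nbC: "card (nb C x) = 2" if "x \<in> C" for x
  proof -
    have "pm E 0 (nb C x)" using pm_nb[OF pmC that] .
    then show ?thesis by auto
  qed
  have pmx: "pm E 2 (nb V x)" and cardx: "card (nb V x) \<le> 7" if "x \<in> C" for x
    using pm_nb[OF V3] deg7 that CV by blast+
  have deg4: "4 \<le> card (nb (nb V x) z)" if "x \<in> C" "z \<in> nb V x" for x z
  proof -
    have "pm E (Suc 1) (nb V x)" using pmx[OF that(1)] by (simp add: numeral_2_eq_2)
    then have "2 * (1 + 1) \<le> card (nb (nb V x) z)"
      using card_pm[OF pm_nb] that(2) by blast
    then show ?thesis by simp
  qed
  have whole: "W = V" if "W \<subseteq> V" "W \<noteq> {}" "\<And>s w. s \<in> W \<Longrightarrow> w \<in> V \<Longrightarrow> E s w \<Longrightarrow> w \<in> W" for W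
    by (rule closed_subset_eq[OF V3 _ that]) (use V(2) in auto)
  \<comment> \<open>The second cycle runs through \<open>v'\<close>, \<open>u\<close>,
    \<open>v\<close>, \<open>u'\<close>. If \<open>u'\<close> and \<open>v'\<close> are adjacent it
    closes with length 4; otherwise \<open>u''\<close> is a fifth vertex, and it closes because
    \<open>v'' = u''\<close>.\<close>
  show False
  proof (cases "E u' v'")
    case True
    have nbu': "nb V u' = C \<union> {v, v'}"
      using u''(1) True v' v'u' by blast
    have nbv': "nb V v' = C \<union> {u, u'}"
    proof -
      have "u' \<in> nb V v'" using True sym uV by blast
      then show ?thesis using v''(1) uu'(4) notC by blast
    qed
    let ?K = "{v', u, v, u'}"
    have cardK: "card ?K = 4" using v' v'u' uneqv uu'(4) by auto
    have Kx: "?K \<subseteq> nb V x" if "x \<in> C" for x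
      using that v' uV v Cv Cu Cu' by blast
    \<comment> \<open>A further neighbour \<open>z\<close> of \<open>x\<close> would exhaust the
      degree bound 7 and be adjacent to nothing in the 4-cycle. Within the link of \<open>x\<close>
      it would have at most the two neighbours of \<open>x\<close> in \<open>C\<close>, but degree 4
      is required there.\<close>
    have nbx: "nb V x \<subseteq> ?K \<union> C" if x: "x \<in> C" for x
    proof
      fix z assume z: "z \<in> nb V x"
      show "z \<in> ?K \<union> C"
      proof (rule ccontr)
        assume zn: "z \<notin> ?K \<union> C"
        let ?X = "insert z (?K \<union> nb C x)"
        have "?K \<inter> nb C x = {}" using notC v'(3) by blast
        then have "card (?K \<union> nb C x) = 6"
          using card_Un_disjoint[of ?K "nb C x"] finC cardK nbC[OF x] by simp
        moreover have "finite (?K \<union> nb C x)" "z \<notin> ?K \<union> nb C x" using finC zn by auto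
        ultimately have "card ?X = 7" by simp
        moreover have "?X \<subseteq> nb V x" using Kx[OF x] z CV by blast
        ultimately have X: "?X = nb V x" using cardx[OF x] fin by (intro card_seteq) auto
        have nK: "\<not> E z k" if "k \<in> ?K" for k
        proof
          assume "E z k"
          then have "z \<in> nb V k" using z sym by blast
          then show False using zn that nbv v'(1) nbu' nbv' by blast
        qed
        have "nb (nb V x) z \<subseteq> nb C x"
        proof
          fix y assume y: "y \<in> nb (nb V x) z"
          then have "y \<in> ?X" unfolding X by simp
          moreover have "y \<noteq> z" "y \<notin> ?K" using y irrefl nK by auto
          ultimately show "y \<in> nb C x" by blast
        qed
        then have "card (nb (nb V x) z) \<le> card (nb C x)" using finC by (intro card_mono) auto
        then show False using deg4[OF x z] nbC[OF x] by simp
      qed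
    qed
    have "?K \<union> C = V"
    proof (rule whole)
      show "w \<in> ?K \<union> C" if s: "s \<in> ?K \<union> C" and w: "w \<in> V" "E s w" for s w
      proof (cases "s \<in> C")
        case True
        then show ?thesis using nbx[OF True] w by blast
      next
        case False
        then have "w \<in> nb V v' \<or> w \<in> nb V u \<or> w \<in> nb V v \<or> w \<in> nb V u'" using s w by blast
        then show ?thesis using nbv v'(1) nbu' nbv' by blast
      qed
    qed (use CV v' uV v in auto)
    then have "V - nb V v \<subseteq> {v, v'}" using nbv by blast
    then have "card (V - nb V v) \<le> card {v, v'}" by (intro card_mono) auto
    also have "\<dots> \<le> 2" by (simp add: card_insert_if)
    finally show False using non[OF v(1)] by simp
  next
    case False
    then have nE: "\<not> E v' u'" using sym by blast
    let ?K = "{v', u, v, u', u''}"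
    have u''u': "E u' u''" using u'' by blast
    have "u'' \<noteq> v'" "u'' \<noteq> u" "u'' \<noteq> u'" using u''u' False uV(5) sym irrefl by blast+
    then have cardK: "card ?K = 5" using v' v'u' uneqv uu'(4) u''(4) by auto
    have Kx: "?K \<subseteq> nb V x" if "x \<in> C" for x
      using that v' uV v Cv Cu Cu' u'' by blast
    \<comment> \<open>Five vertices of the second cycle and two of \<open>C\<close> attain the
      degree bound 7, so the link of \<open>x\<close> is known; this will leave only
      \<open>u''\<close> for \<open>v''\<close>.\<close>
    have nbx: "nb V x = ?K \<union> nb C x" if x: "x \<in> C" for x
    proof -
      have "?K \<inter> nb C x = {}" using notC v'(3) u''(3) by blast
      then have "card (?K \<union> nb C x) = 7"
        using card_Un_disjoint[of ?K "nb C x"] finC cardK nbC[OF x] by simp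
      moreover have "?K \<union> nb C x \<subseteq> nb V x" using Kx[OF x] CV by blast
      ultimately show ?thesis using cardx[OF x] fin by (intro card_seteq[symmetric]) auto
    qed
    obtain x where x: "x \<in> C" using pm_nonempty[OF pmC] by blast
    have v'v'': "E v' v''" using v'' by blast
    have "v'' \<in> nb V x" using v'' x by blast
    then have "v'' \<in> ?K" using nbx[OF x] v''(3) by blast
    moreover have "v'' \<noteq> v'" "v'' \<noteq> v" "v'' \<noteq> u'" using v'v'' v'(5) nE irrefl sym by blast+
    ultimately have v''eq: "v'' = u''" using v''(4) by blast
    have Ku: "C \<union> {u', v'} \<subseteq> nb V u''"
      using CV u''(6) u''u' v'v'' v''eq uV v' sym by blast
    have "card (C \<union> {u', v'}) = m" using finC cardC m6 notC v'(3) v'u' by simp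
    then have nbu'': "C \<union> {u', v'} = nb V u''"
      using Ku deg[OF u''(2)] fin by (intro card_seteq) auto
    have "?K \<union> C = V"
    proof (rule whole)
      show "w \<in> ?K \<union> C" if s: "s \<in> ?K \<union> C" and w: "w \<in> V" "E s w" for s w
      proof (cases "s \<in> C")
        case True
        then show ?thesis using nbx[OF True] w by blast
      next
        case False
        then have "w \<in> nb V v' \<or> w \<in> nb V u \<or> w \<in> nb V v \<or> w \<in> nb V u' \<or> w \<in> nb V u''"
          using s w by blast
        then show ?thesis unfolding nbv v'(1) u''(1) v''(1) v''eq nbu''[symmetric] by auto
      qed
    qed (use CV v' uV v u'' in auto)
    then have "V - nb V v \<subseteq> {v, v', u''}" using nbv by blast
    then have "card (V - nb V v) \<le> card {v, v', u''}" by (intro card_mono) auto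
    also have "\<dots> \<le> 3" by (simp add: card_insert_if)
    finally show False using non[OF v(1)] by simp
  qed
qed

subsection \<open>The lower bound for graphs\<close>

text \<open>\<open>H\<close> expresses the absence of contractible edges and \<open>S\<close> that
  of a suspension. \<open>C1\<close>, \<open>C2\<close> and \<open>J\<close> are the topological
  input beyond \<open>pm\<close>: the circle is connected, a 2-sphere stays connected without a
  vertex, and an induced 4-cycle separates it.\<close>

theorem twelve_vertices:
  assumes V: "pm E d V"
    and H: "\<And>u v. u \<in> V \<Longrightarrow> v \<in> V \<Longrightarrow> E u v \<Longrightarrow> \<exists>w\<in>V. \<exists>t\<in>V. induced_C4 E u v w t"
    and S: "\<And>v w. v \<in> V \<Longrightarrow> w \<in> V \<Longrightarrow> v \<noteq> w \<Longrightarrow> V - nb V v = {v, w} \<Longrightarrow> V - nb V w = {v, w} \<Longrightarrow> False"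
    and C1: "d = 1 \<Longrightarrow> connected_on E V"
    and C2: "\<And>v. d = 2 \<Longrightarrow> v \<in> V \<Longrightarrow> connected_on E (V - {v})"
    and J: "\<And>a b c e. d = 2 \<Longrightarrow> induced_C4 E a b c e \<Longrightarrow> {a, b, c, e} \<subseteq> V \<Longrightarrow>
      \<not> connected_on E (V - {a, b, c, e})"
  shows "12 \<le> card V"
proof (rule ccontr)
  assume "\<not> ?thesis"
  then have V11: "card V \<le> 11" by simp
  have fin: "finite V" using pm_finite[OF V] .
  have S': "V - nb V v \<noteq> {v, w}" if "v \<in> V" "w \<in> V" "v \<noteq> w" for v w
  proof
    assume eq: "V - nb V v = {v, w}"
    have vw: "\<not> E v w" "\<not> E w v" using eq that sym by blast+
    have "E w x" if "x \<in> V" "x \<noteq> v" "x \<noteq> w" for x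
      by (rule unique_non_neighbour[OF V \<open>v \<in> V\<close> \<open>w \<in> V\<close> _ that]) (use eq in blast)
    then have "V - nb V w = {v, w}" using that vw irrefl by blast
    then show False using S that eq by blast
  qed
  have "d \<noteq> 0"
  proof
    assume "d = 0"
    then obtain a b where ab: "a \<noteq> b" "\<not> E a b" "V = {a, b}" using V by auto
    then have "V - nb V a = {a, b}" using irrefl by blast
    then show False using S' ab by blast
  qed
  have "d \<noteq> 1"
  proof
    assume d: "d = 1"
    have V1: "pm E (Suc 0) V" using V d by simp
    obtain u where u: "u \<in> V" using pm_nonempty[OF V] by blast
    obtain v where v: "v \<in> V" "E u v" using pm_nonempty[OF pm_nb[OF V1 u]] by blast
    obtain w t where wt: "w \<in> V" "t \<in> V" "induced_C4 E u v w t" using H[OF u v] by blast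
    \<comment> \<open>Every vertex of a 4-cycle in dimension 1 has both its neighbours on the cycle,
      so by \<open>C1\<close> the cycle is all of \<open>V\<close>, and \<open>w\<close> is the only
      non-neighbour of \<open>u\<close>.\<close>
    have two: "nb V p = {q, s}" if "induced_C4 E p q r s" "{p, q, r, s} \<subseteq> V" for p q r s
    proof -
      have "pm E 0 (nb V p)" using pm_nb[OF V1] that(2) by blast
      then obtain x y where "nb V p = {x, y}" by (simp only: pm.simps) blast
      moreover have "q \<in> nb V p" "s \<in> nb V p" "q \<noteq> s"
        using that sym unfolding induced_C4_def by auto
      ultimately show ?thesis by auto
    qed
    note r1 = C4_rot[OF wt(3)]
    note r2 = C4_rot[OF r1]
    note r3 = C4_rot[OF r2]
    have nbs: "nb V u = {v, t}" "nb V v = {w, u}" "nb V w = {t, v}" "nb V t = {u, w}"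
      using two[OF wt(3)] two[OF r1] two[OF r2] two[OF r3] u v wt by auto
    let ?S = "{u, v, w, t}"
    have "?S = V"
    proof (rule ccontr)
      assume "?S \<noteq> V"
      then have "?S \<union> (V - ?S) = V" "?S \<inter> (V - ?S) = {}" "?S \<noteq> {}" "V - ?S \<noteq> {}"
        using u v wt by blast+
      then obtain p q where "p \<in> ?S" "q \<in> V - ?S" "E p q"
        using C1[OF d, unfolded connected_on_def, rule_format, of ?S "V - ?S"] by blast
      then show False using nbs by blast
    qed
    then have "V - nb V u = {u, w}" using nbs(1) C4_neq[OF wt(3)] by auto
    then show False using S' u wt(1) C4_neq[OF wt(3)] by blast
  qed
  have non: "4 \<le> card (V - nb V v)" if v: "v \<in> V" for v
  proof (rule ccontr)
    assume "\<not> ?thesis"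
    then have le3: "card (V - nb V v) \<le> 3" by simp
    obtain a where a: "a \<in> V" "a \<noteq> v" "\<not> E v a" using no_cone[OF V v] by blast
    have va: "{v, a} \<subseteq> V - nb V v" using v a irrefl by blast
    have "{v, a} \<noteq> V - nb V v" using S'[OF v a(1)] a(2) by blast
    then obtain b where b: "b \<in> V" "\<not> E v b" "b \<noteq> v" "b \<noteq> a" using va by blast
    have "{v, a, b} = V - nb V v"
      using va b le3 a fin by (intro card_seteq) auto
    then have adj: "E v x" if "x \<in> V" "x \<noteq> v" "x \<noteq> a" "x \<noteq> b" for x using that by blast
    show False
    proof (cases "E a b")
      case True
      obtain w t where "w \<in> V" "t \<in> V" "induced_C4 E a b w t" using H[OF a(1) b(1) True] by blast
      then show False
        using two_adjacent_non_neighbours[OF V v a(1) b(1) a(2)[symmetric] b(3)[symmetric] a(3) b(2) adj] by blast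
    next
      case False
      have d2: "2 \<le> d \<and> 2 * d + 7 \<le> card V"
        by (rule two_nonadjacent_non_neighbours[OF V v a(1) b(1)]) (use a b False adj in auto)
      then have "d = 2" using V11 by linarith
      moreover have "pm E 2 V" using V \<open>d = 2\<close> by simp
      ultimately show False
        using surface_cut_vertex[of V v a b] v a b False adj C2 by auto
    qed
  qed
  have deg7: "card (nb V v) \<le> 7" if "v \<in> V" for v
  proof -
    have "card (V - nb V v) = card V - card (nb V v)" using fin by (intro card_Diff_subset) auto
    then show ?thesis using non[OF that] V11 by linarith
  qed
  have "d \<le> 3"
  proof (rule ccontr)
    assume "\<not> d \<le> 3"
    then obtain e where e: "d = Suc e" "3 \<le> e" by (metis Suc_le_D not_less_eq_eq numeral_3_eq_3)
    obtain v where v: "v \<in> V" using pm_nonempty[OF V] by blast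
    have "2 * (e + 1) \<le> card (nb V v)" using V e by (intro card_pm pm_nb v) simp
    then show False using deg7[OF v] e by simp
  qed
  then consider "d = 2" | "d = 3" using \<open>d \<noteq> 0\<close> \<open>d \<noteq> 1\<close> by linarith
  then show False
  proof cases
    case 1
    have V2: "pm E 2 V" using V 1 by simp
    obtain x y where xy: "x \<in> V" "V - nb V x = {x, y}"
      using surface_octahedron[OF V2 V11 deg7 H J[OF 1]] by blast
    have "card {x, y} \<le> 2" by (simp add: card_insert_if)
    then show False using non[OF xy(1)] xy(2) by simp
  next
    case 2
    have V3: "pm E 3 V" using V 2 by simp
    show False by (rule no_small_three_manifold[OF V3 V11 deg7 non])
  qed
qed

end

subsection \<open>Invariance of domain for spheres\<close>

definition realization :: "'a set set \<Rightarrow> ('a \<Rightarrow> real) set" where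
  "realization \<Delta> = {f. (\<forall>v. 0 \<le> f v) \<and> {v. f v \<noteq> 0} \<in> \<Delta> \<and> (\<Sum>v | f v \<noteq> 0. f v) = 1}"

text \<open>Models inside the product space of real sequences: \<open>sph d\<close> below lies in
  \<open>eucl (Suc d)\<close>, with coordinates 0 to d.\<close>

definition eucl :: "nat \<Rightarrow> (nat \<Rightarrow> real) set" where
  "eucl n = {x. \<forall>i\<ge>n. x i = 0}"

definition sph :: "nat \<Rightarrow> (nat \<Rightarrow> real) set" where
  "sph n = {x. (\<Sum>i\<le>n. (x i)\<^sup>2) = 1 \<and> (\<forall>i>n. x i = 0)}"

lemma geometric_realization_eq: "geometric_realization \<Delta> = top_of_set (realization \<Delta>)"
  unfolding geometric_realization_def realization_def by (simp add: euclidean_product_topology)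

lemma nsphere_eq: "nsphere n = top_of_set (sph n)"
  unfolding nsphere sph_def by (simp add: euclidean_product_topology)

lemma Euclidean_space_eq: "Euclidean_space n = top_of_set (eucl n)"
  unfolding Euclidean_space_def eucl_def by (simp add: euclidean_product_topology)

lemma simplicial_sphere_iff:
  "simplicial_sphere d \<Delta> \<longleftrightarrow> abstract_complex \<Delta> \<and> realization \<Delta> homeomorphic sph d"
  unfolding simplicial_sphere_def geometric_realization_eq nsphere_eq
  by simp

lemma continuous_on_coordinate: "continuous_on S (\<lambda>f::'a \<Rightarrow> real. f v)"
  by (rule continuous_on_product_then_coordinatewise) (rule continuous_on_id)

lemma invariance_of_domain_eucl:
  assumes "openin (top_of_set (eucl n)) U" "continuous_on U f" "f \<in> U \<rightarrow> eucl n" "inj_on f U"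
  shows "openin (top_of_set (eucl n)) (f ` U)"
proof -
  have "U \<subseteq> eucl n" using assms(1) openin_imp_subset by blast
  then have "continuous_map (subtopology (Euclidean_space n) U) (Euclidean_space n) f"
    using assms by (simp add: Euclidean_space_eq subtopology_subtopology Int_absorb1 continuous_map_in_subtopology Pi_iff image_subset_iff)
  then show ?thesis
    using invariance_of_domain_Euclidean_space[of n U f] assms by (simp add: Euclidean_space_eq)
qed

text \<open>The Euclidean norm of \<open>eucl (Suc n)\<close>, not of \<open>eucl n\<close>: its
  unit sphere is \<open>sph n\<close>.\<close>

definition nrm :: "nat \<Rightarrow> (nat \<Rightarrow> real) \<Rightarrow> real" where
  "nrm n x = sqrt (\<Sum>i\<le>n. (x i)\<^sup>2)"

lemma continuous_on_nrm: "continuous_on S (nrm n)"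
  unfolding nrm_def by (intro continuous_intros continuous_on_coordinate)

lemma nrm_scale: "nrm n (\<lambda>i. c * x i) = \<bar>c\<bar> * nrm n x"
proof -
  have "(\<Sum>i\<le>n. (c * x i)\<^sup>2) = c\<^sup>2 * (\<Sum>i\<le>n. (x i)\<^sup>2)"
    by (simp add: power_mult_distrib sum_distrib_left)
  then show ?thesis unfolding nrm_def by (simp add: real_sqrt_mult)
qed

lemma nrm_nonneg: "0 \<le> nrm n x"
  unfolding nrm_def by (simp add: sum_nonneg)

lemma sph_iff_nrm: "x \<in> sph n \<longleftrightarrow> x \<in> eucl (Suc n) \<and> nrm n x = 1"
  unfolding sph_def eucl_def nrm_def by (auto simp: Suc_le_eq real_sqrt_eq_1_iff)

lemma normalize_in_sph:
  assumes "x \<in> eucl (Suc n)" "nrm n x > 0"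
  shows "(\<lambda>i. inverse (nrm n x) * x i) \<in> sph n"
  using assms unfolding sph_iff_nrm by (auto simp: nrm_scale) (auto simp: eucl_def)

text \<open>Coning a map from an open subset of \<open>\<real>\<^sup>d\<close> to the \<open>d\<close>-sphere gives a map between open
  subsets of \<open>\<real>\<^sup>d\<^sup>+\<^sup>1\<close>, to which invariance of domain applies; likewise in the other direction.\<close>

lemma invariance_of_domain_into_sph:
  assumes U: "openin (top_of_set (eucl d)) U"
    and g: "continuous_on U g" "g \<in> U \<rightarrow> sph d" "inj_on g U"
  shows "openin (top_of_set (sph d)) (g ` U)"
proof -
  \<comment> \<open>\<open>W\<close> is the open cylinder over \<open>U\<close> with coordinate d as
    positive height; \<open>G\<close> turns the height into the radius along the ray through a point
    of the sphere.\<close>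
  define W where "W = (eucl (Suc d) \<inter> (\<lambda>x. x(d := 0)) -` U) \<inter> {x. 0 < x d}"
  define G where "G = (\<lambda>x i. x d * g (x(d := 0)) i)"
  have proj: "continuous_on S (\<lambda>x::nat \<Rightarrow> real. x(d := 0))" for S
  proof (rule continuous_on_coordinatewise_then_product)
    fix i show "continuous_on S (\<lambda>x::nat \<Rightarrow> real. (x(d := 0)) i)"
      by (cases "i = d") (auto intro: continuous_on_coordinate)
  qed
  have "openin (top_of_set (eucl (Suc d))) (eucl (Suc d) \<inter> (\<lambda>x. x(d := 0)) -` U)"
    by (rule continuous_openin_preimage[OF proj _ U]) (auto simp: eucl_def)
  moreover have "open {x::nat \<Rightarrow> real. 0 < x d}"
    by (intro open_Collect_less continuous_on_const continuous_on_coordinate)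
  ultimately have W: "openin (top_of_set (eucl (Suc d))) W"
    unfolding W_def by (metis openin_Int_open)
  have gW: "g (x(d := 0)) \<in> sph d" if "x \<in> W" for x
    using that g(2) unfolding W_def by auto
  have nG: "nrm d (G x) = x d" if "x \<in> W" for x
    using gW[OF that] that unfolding G_def sph_iff_nrm W_def by (simp add: nrm_scale)
  have "openin (top_of_set (eucl (Suc d))) (G ` W)"
  proof (rule invariance_of_domain_eucl[OF W])
    have "continuous_on W (\<lambda>x. g (x(d := 0)))"
      by (rule continuous_on_compose2[OF g(1) proj]) (auto simp: W_def)
    then show "continuous_on W G"
      unfolding G_def
      by (intro continuous_on_coordinatewise_then_product continuous_intros continuous_on_coordinate)
        (rule continuous_on_product_then_coordinatewise)
    show "G \<in> W \<rightarrow> eucl (Suc d)"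
      using gW unfolding G_def sph_iff_nrm eucl_def by auto
    show "inj_on G W"
    proof (rule inj_onI)
      fix x y assume xy: "x \<in> W" "y \<in> W" "G x = G y"
      then have eq: "x d = y d" using nG by metis
      have "x d > 0" using xy unfolding W_def by auto
      then have "g (x(d := 0)) = g (y(d := 0))"
        using xy(3) eq unfolding G_def fun_eq_iff by simp
      then have "x(d := 0) = y(d := 0)"
        using g(3) xy(1,2) unfolding W_def inj_on_def by blast
      then show "x = y" using eq by (metis fun_upd_triv fun_upd_upd)
    qed
  qed
  then obtain T where T: "open T" "G ` W = eucl (Suc d) \<inter> T"
    unfolding openin_open by blast
  have "g ` U = sph d \<inter> G ` W"
  proof
    show "g ` U \<subseteq> sph d \<inter> G ` W"
    proof clarify
      fix u assume u: "u \<in> U"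
      then have "u \<in> eucl d" using U openin_imp_subset by blast
      then have "u(d := 0) = u" by (auto simp: eucl_def)
      then have ud: "(u(d := 1))(d := 0) = u" by simp
      have "u(d := 1) \<in> W" using u ud \<open>u \<in> eucl d\<close> unfolding W_def by (auto simp: eucl_def)
      moreover have "G (u(d := 1)) = g u" unfolding G_def ud by simp
      ultimately show "g u \<in> sph d \<inter> G ` W" using g(2) u by (metis IntI Pi_mem image_eqI)
    qed
    show "sph d \<inter> G ` W \<subseteq> g ` U"
    proof
      fix y assume y: "y \<in> sph d \<inter> G ` W"
      then obtain x where x: "x \<in> W" "y = G x" by blast
      then have "nrm d (G x) = 1" using y by (simp add: sph_iff_nrm)
      then have "x d = 1" using nG[OF x(1)] by simp
      then have "y = g (x(d := 0))" using x(2) unfolding G_def by simp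
      moreover have "x(d := 0) \<in> U" using x unfolding W_def by simp
      ultimately show "y \<in> g ` U" by blast
    qed
  qed
  also have "\<dots> = sph d \<inter> T" using T(2) by (auto simp: sph_iff_nrm)
  finally show ?thesis using T(1) unfolding openin_open by blast
qed

lemma invariance_of_domain_from_sph:
  assumes V: "openin (top_of_set (sph d)) V"
    and g: "continuous_on V g" "g \<in> V \<rightarrow> eucl d" "inj_on g V"
  shows "openin (top_of_set (eucl d)) (g ` V)"
proof -
  define N where "N = (\<lambda>x i. inverse (nrm d x) * x i)"
  define S where "S = eucl (Suc d) \<inter> {x. 0 < nrm d x}"
  define W where "W = S \<inter> N -` V"
  \<comment> \<open>The radius goes into coordinate d, where the values of \<open>g\<close> are 0;
    the slice at radius 1 gives back \<open>g\<close> on \<open>V\<close>.\<close>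
  define G where "G = (\<lambda>x. (g (N x))(d := nrm d x))"
  have contN: "continuous_on S N"
    unfolding N_def S_def
    by (intro continuous_on_coordinatewise_then_product continuous_intros continuous_on_coordinate continuous_on_nrm) auto
  have "open {x. 0 < nrm d x}"
    by (intro open_Collect_less continuous_on_const continuous_on_nrm)
  then have S: "openin (top_of_set (eucl (Suc d))) S" unfolding S_def by blast
  have "openin (top_of_set S) W"
    unfolding W_def
    by (rule continuous_openin_preimage[OF contN _ V]) (auto simp: S_def N_def normalize_in_sph)
  then have W: "openin (top_of_set (eucl (Suc d))) W" using S openin_trans by blast
  have NV: "N x \<in> V" if "x \<in> W" for x using that unfolding W_def by simp
  have contgN: "continuous_on W (\<lambda>x. g (N x))"
    by (rule continuous_on_compose2[OF g(1) continuous_on_subset[OF contN]]) (auto simp: W_def)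
  have GW: "openin (top_of_set (eucl (Suc d))) (G ` W)"
  proof (rule invariance_of_domain_eucl[OF W])
    show "continuous_on W G"
    proof (rule continuous_on_coordinatewise_then_product)
      fix i show "continuous_on W (\<lambda>x. G x i)"
        unfolding G_def
        by (cases "i = d")
          (auto intro: continuous_on_nrm continuous_on_product_then_coordinatewise[OF contgN])
    qed
    show "G \<in> W \<rightarrow> eucl (Suc d)"
    proof
      fix x assume "x \<in> W"
      then have "g (N x) \<in> eucl d" using g(2) NV by blast
      then show "G x \<in> eucl (Suc d)" unfolding G_def eucl_def by simp
    qed
    show "inj_on G W"
    proof (rule inj_onI)
      fix x y assume xy: "x \<in> W" "y \<in> W" "G x = G y"
      have eq: "nrm d x = nrm d y" using fun_cong[OF xy(3), of d] unfolding G_def by simp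
      have "g (N x) i = g (N y) i" for i
      proof (cases "i = d")
        case True
        then show ?thesis using g(2) NV[OF xy(1)] NV[OF xy(2)] by (auto simp: eucl_def Pi_iff)
      next
        case False
        then show ?thesis using fun_cong[OF xy(3), of i] unfolding G_def by simp
      qed
      then have "g (N x) = g (N y)" by blast
      then have "N x = N y" using g(3) NV[OF xy(1)] NV[OF xy(2)] unfolding inj_on_def by blast
      have "inverse (nrm d x) * x i = inverse (nrm d x) * y i" for i
        using fun_cong[of "N x" "N y" i] \<open>N x = N y\<close> eq unfolding N_def by simp
      moreover have "nrm d x \<noteq> 0" using xy(1) unfolding W_def S_def by simp
      ultimately show "x = y" by (simp add: fun_eq_iff)
    qed
  qed
  have lift: "continuous_on T (\<lambda>x::nat \<Rightarrow> real. x(d := 1))" for T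
  proof (rule continuous_on_coordinatewise_then_product)
    fix i show "continuous_on T (\<lambda>x::nat \<Rightarrow> real. (x(d := 1)) i)"
      by (cases "i = d") (auto intro: continuous_on_coordinate)
  qed
  have "openin (top_of_set (eucl d)) (eucl d \<inter> (\<lambda>x. x(d := 1)) -` (G ` W))"
    by (rule continuous_openin_preimage[OF lift _ GW]) (auto simp: eucl_def)
  moreover have "eucl d \<inter> (\<lambda>x. x(d := 1)) -` (G ` W) = g ` V"
  proof
    show "eucl d \<inter> (\<lambda>x. x(d := 1)) -` (G ` W) \<subseteq> g ` V"
    proof clarify
      fix u x assume u: "u \<in> eucl d" "u(d := 1) = G x" and x: "x \<in> W"
      have "u i = g (N x) i" for i
      proof (cases "i = d")
        case True
        then show ?thesis using u(1) g(2) NV[OF x] by (auto simp: eucl_def Pi_iff)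
      next
        case False
        then show ?thesis using fun_cong[OF u(2), of i] unfolding G_def by simp
      qed
      then have "u = g (N x)" by blast
      then show "u \<in> g ` V" using NV[OF x] by blast
    qed
    show "g ` V \<subseteq> eucl d \<inter> (\<lambda>x. x(d := 1)) -` (G ` W)"
    proof clarify
      fix v assume v: "v \<in> V"
      then have "v \<in> sph d" using V openin_imp_subset by blast
      then have n: "nrm d v = 1" "v \<in> eucl (Suc d)" unfolding sph_iff_nrm by auto
      then have "N v = v" unfolding N_def by simp
      then have "v \<in> W" "G v = (g v)(d := 1)"
        using n v unfolding W_def S_def G_def by auto
      moreover have "g v \<in> eucl d" using v g(2) by blast
      ultimately show "g v \<in> eucl d \<inter> (\<lambda>x. x(d := 1)) -` (G ` W)" by force
    qed
  qed
  ultimately show ?thesis by simp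
qed

lemma invariance_of_domain_to_sphere:
  fixes X :: "('a \<Rightarrow> real) set"
  assumes X: "X homeomorphic sph d"
    and U: "openin (top_of_set (eucl d)) U"
    and g: "continuous_on U g" "g \<in> U \<rightarrow> X" "inj_on g U"
  shows "openin (top_of_set X) (g ` U)"
proof -
  obtain h k where hk: "homeomorphism X (sph d) h k" using X homeomorphic_def by blast
  have hX: "h ` X = sph d" "continuous_on X h" "inj_on h X"
    using hk homeomorphism_image1 homeomorphism_cont1 homeomorphism_apply1 inj_on_inverseI[of X k h]
    by blast+
  have op: "openin (top_of_set (sph d)) ((h \<circ> g) ` U)"
  proof (rule invariance_of_domain_into_sph[OF U])
    show "continuous_on U (h \<circ> g)"
      using g(2) by (intro continuous_on_compose g(1) continuous_on_subset[OF hX(2)]) auto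
    show "h \<circ> g \<in> U \<rightarrow> sph d" using g(2) hX(1) by (auto simp: Pi_iff)
    show "inj_on (h \<circ> g) U" using g(2,3) hX(3) by (auto intro!: comp_inj_on intro: inj_on_subset)
  qed
  have "openin (top_of_set X) (X \<inter> h -` ((h \<circ> g) ` U))"
    by (rule continuous_openin_preimage[OF hX(2) _ op]) (use hX in auto)
  moreover have "X \<inter> h -` ((h \<circ> g) ` U) = g ` U"
  proof
    show "X \<inter> h -` ((h \<circ> g) ` U) \<subseteq> g ` U"
    proof clarify
      fix x u assume "x \<in> X" "u \<in> U" "h x = (h \<circ> g) u"
      then have "x = g u" using hX(3) g(2) by (auto simp: inj_on_def Pi_iff)
      then show "x \<in> g ` U" using \<open>u \<in> U\<close> by blast
    qed
  qed (use g(2) in auto)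
  ultimately show ?thesis by simp
qed

lemma invariance_of_domain_from_sphere:
  fixes X :: "('a \<Rightarrow> real) set"
  assumes X: "X homeomorphic sph d"
    and V: "openin (top_of_set X) V"
    and g: "continuous_on V g" "g \<in> V \<rightarrow> eucl d" "inj_on g V"
  shows "openin (top_of_set (eucl d)) (g ` V)"
proof -
  obtain h k where hk: "homeomorphism X (sph d) h k" using X homeomorphic_def by blast
  have VX: "V \<subseteq> X" using V openin_imp_subset by blast
  have hV: "openin (top_of_set (sph d)) (h ` V)"
    using homeomorphism_imp_open_map[OF hk V] .
  have kh: "k (h x) = x" if "x \<in> X" for x using hk that by (simp add: homeomorphism_def)
  have k: "continuous_on (h ` V) k" "k ` h ` V = V"
  proof -
    show "continuous_on (h ` V) k"
      using hk hV openin_imp_subset by (metis continuous_on_subset homeomorphism_def)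
    show "k ` h ` V = V" using kh VX by (force simp: image_image)
  qed
  have "openin (top_of_set (eucl d)) ((g \<circ> k) ` h ` V)"
  proof (rule invariance_of_domain_from_sph[OF hV])
    show "continuous_on (h ` V) (g \<circ> k)" using k g(1) by (metis continuous_on_compose)
    show "g \<circ> k \<in> h ` V \<rightarrow> eucl d" using g(2) kh VX by (auto simp: Pi_iff subset_iff)
    show "inj_on (g \<circ> k) (h ` V)" using g(3) kh VX by (auto simp: inj_on_def subset_iff)
  qed
  moreover have "(g \<circ> k) ` h ` V = g ` V" using k(2) by (metis image_comp)
  ultimately show ?thesis by simp
qed

subsection \<open>Flag spheres are pseudomanifolds\<close>

lemma realization_iff:
  "f \<in> realization \<Delta> \<longleftrightarrow> (\<forall>v. 0 \<le> f v) \<and> {v. f v \<noteq> 0} \<in> \<Delta> \<and> (\<Sum>v | f v \<noteq> 0. f v) = 1"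
  unfolding realization_def by simp

lemma realizationI:
  assumes "finite F" "{v. f v \<noteq> 0} \<subseteq> F" "\<And>v. 0 \<le> f v" "{v. f v \<noteq> 0} \<in> \<Delta>" "sum f F = 1"
  shows "f \<in> realization \<Delta>"
proof -
  have "(\<Sum>v | f v \<noteq> 0. f v) = sum f F"
    using assms(1,2) by (intro sum.mono_neutral_left) auto
  then show ?thesis using assms unfolding realization_iff by simp
qed

lemma realization_sum:
  assumes "f \<in> realization \<Delta>" "finite F" "{v. f v \<noteq> 0} \<subseteq> F"
  shows "sum f F = 1"
proof -
  have "(\<Sum>v | f v \<noteq> 0. f v) = sum f F"
    using assms(2,3) by (intro sum.mono_neutral_left) auto
  then show ?thesis using assms(1) unfolding realization_iff by simp
qed

lemma complex_face_finite: "abstract_complex \<Delta> \<Longrightarrow> F \<in> \<Delta> \<Longrightarrow> finite F"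
  unfolding abstract_complex_def vertices_def by (auto intro: finite_subset[of F "\<Union>\<Delta>"])

lemma complex_subset: "abstract_complex \<Delta> \<Longrightarrow> F \<in> \<Delta> \<Longrightarrow> G \<subseteq> F \<Longrightarrow> G \<in> \<Delta>"
  unfolding abstract_complex_def by blast

definition bary :: "'a set \<Rightarrow> 'a \<Rightarrow> real" where
  "bary F v = (if v \<in> F then 1 / card F else 0)"

lemma supp_bary: "finite F \<Longrightarrow> {v. bary F v \<noteq> 0} = F"
  unfolding bary_def by (auto simp: card_eq_0_iff)

lemma bary_in_realization:
  assumes "abstract_complex \<Delta>" "F \<in> \<Delta>" "F \<noteq> {}"
  shows "bary F \<in> realization \<Delta>"
proof -
  have fin: "finite F" using assms complex_face_finite by blast
  then have "sum (bary F) F = 1" using assms(3) by (simp add: bary_def)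
  then show ?thesis
    using assms(2) fin supp_bary[OF fin]
    by (intro realizationI[of F]) (auto simp: bary_def[of F])
qed

definition seg :: "('a \<Rightarrow> real) \<Rightarrow> ('a \<Rightarrow> real) \<Rightarrow> real \<Rightarrow> 'a \<Rightarrow> real" where
  "seg f g t v = (1 - t) * f v + t * g v"

lemma seg_0 [simp]: "seg f g 0 = f" and seg_1 [simp]: "seg f g 1 = g"
  by (simp_all add: seg_def fun_eq_iff)

lemma continuous_on_seg: "continuous_on S (seg f g)"
  by (rule continuous_on_coordinatewise_then_product) (auto simp: seg_def intro!: continuous_intros)

lemma supp_seg:
  assumes "\<And>v. 0 \<le> f v" "\<And>v. 0 \<le> g v" "0 < t" "t < 1"
  shows "{v. seg f g t v \<noteq> 0} = {v. f v \<noteq> 0} \<union> {v. g v \<noteq> 0}"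
proof -
  have "seg f g t v = 0 \<longleftrightarrow> f v = 0 \<and> g v = 0" for v
    using assms(1,2)[of v] assms(3,4) unfolding seg_def
    by (simp add: add_nonneg_eq_0_iff)
  then show ?thesis by auto
qed

lemma seg_in_realization:
  assumes "abstract_complex \<Delta>" "f \<in> realization \<Delta>" "g \<in> realization \<Delta>"
    and F: "{v. f v \<noteq> 0} \<union> {v. g v \<noteq> 0} \<in> \<Delta>" and t: "t \<in> {0..1}"
  shows "seg f g t \<in> realization \<Delta>"
proof -
  let ?F = "{v. f v \<noteq> 0} \<union> {v. g v \<noteq> 0}"
  have fin: "finite ?F" using assms complex_face_finite by blast
  have nn: "0 \<le> f v" "0 \<le> g v" for v using assms(2,3) unfolding realization_iff by auto
  have sub: "{v. seg f g t v \<noteq> 0} \<subseteq> ?F" unfolding seg_def by auto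
  have "sum f ?F = 1" "sum g ?F = 1"
    using realization_sum[OF assms(2) fin] realization_sum[OF assms(3) fin] by blast+
  then have "sum (seg f g t) ?F = 1"
    unfolding seg_def by (simp add: sum.distrib flip: sum_distrib_left)
  moreover have "0 \<le> seg f g t v" for v using nn t unfolding seg_def by simp
  ultimately show ?thesis
    using realizationI[OF fin sub] complex_subset[OF assms(1) F sub] by blast
qed

text \<open>Moving from \<open>f\<close> a little towards \<open>g\<close> stays in \<open>U\<close>
  and at once makes all vertices of both supports positive. In this way an open set detects the
  faces around a point.\<close>

lemma open_meets_segment:
  assumes D: "abstract_complex \<Delta>" "f \<in> realization \<Delta>" "g \<in> realization \<Delta>"
    and F: "{v. f v \<noteq> 0} \<union> {v. g v \<noteq> 0} \<in> \<Delta>"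
    and U: "openin (top_of_set (realization \<Delta>)) U" "f \<in> U"
  shows "\<exists>h\<in>U. {v. h v \<noteq> 0} = {v. f v \<noteq> 0} \<union> {v. g v \<noteq> 0}"
proof -
  have "seg f g \<in> {0..1} \<rightarrow> realization \<Delta>" using seg_in_realization[OF D F] by blast
  then have "openin (top_of_set {0..1}) ({0..1} \<inter> seg f g -` U)"
    by (rule continuous_openin_preimage[OF continuous_on_seg _ U(1)])
  then obtain T where T: "open T" "{0..1} \<inter> seg f g -` U = {0..1} \<inter> T"
    unfolding openin_open by blast
  have "0 \<in> {0..1} \<inter> seg f g -` U" using U(2) by simp
  then have "0 \<in> T" using T(2) by blast
  then obtain e where e: "e > 0" "ball 0 e \<subseteq> T" using T(1) open_contains_ball by blast
  define t where "t = min (e / 2) (1 / 2)"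
  have t: "0 < t" "t < 1" "t < e" using e unfolding t_def by auto
  then have "t \<in> {0..1} \<inter> T" using e(2) by (auto simp: dist_real_def)
  then have "seg f g t \<in> U" using T(2) by blast
  moreover have "{v. seg f g t v \<noteq> 0} = {v. f v \<noteq> 0} \<union> {v. g v \<noteq> 0}"
    using D(2,3) t unfolding realization_iff by (intro supp_seg) auto
  ultimately show ?thesis by blast
qed

lemma sum_insert2:
  assumes "finite A" "x \<notin> A" "y \<notin> A" "x \<noteq> y"
  shows "sum f (insert x (insert y A)) = f x + f y + sum f A"
  using assms by (simp add: add.assoc)

text \<open>Two facets through a ridge fill a neighbourhood of the barycentre of the ridge.\<close>

lemma ridge_in_two_facets:
  assumes D: "abstract_complex \<Delta>" "realization \<Delta> homeomorphic sph d" "1 \<le> d"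
    and r: "card \<rho> = d" "x \<notin> \<rho>" "y \<notin> \<rho>" "x \<noteq> y" "insert x \<rho> \<in> \<Delta>" "insert y \<rho> \<in> \<Delta>"
    and F: "F \<in> \<Delta>" "\<rho> \<subseteq> F"
  shows "F \<subseteq> insert x \<rho> \<or> F \<subseteq> insert y \<rho>"
proof -
  have fin: "finite \<rho>" using r(1) D(3) by (metis card.infinite not_one_le_zero)
  have "\<rho> \<noteq> {}" using r(1) D(3) by auto
  \<comment> \<open>The weight of \<open>z\<close> is determined by the total 1, so the other
    vertices of the ridge supply d - 1 coordinates.\<close>
  then obtain z where z: "z \<in> \<rho>" by blast
  define R where "R = \<rho> - {z}"
  have finR: "finite R" and cardR: "card R = d - 1" and rho: "\<rho> = insert z R" "z \<notin> R"
    using fin z r(1) unfolding R_def by auto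
  obtain q where q: "bij_betw q R {..<d - 1}"
    using ex_bij_betw_finite_nat[OF finR] cardR by (auto simp: atLeast0LessThan)
  have qi: "q v < d - 1" if "v \<in> R" for v using q that by (auto simp: bij_betw_def)
  define sm where "sm u = (\<Sum>v\<in>R. u (q v)) + \<bar>u (d - 1)\<bar>" for u :: "nat \<Rightarrow> real"
  define U where "U = eucl d \<inter> {u. sm u < 1} \<inter> (\<Inter>v\<in>R. {u. 0 < u (q v)})"
  \<comment> \<open>The last coordinate is signed: positive values are weight on \<open>x\<close>,
    negative ones weight on \<open>y\<close>. This glues the two facets along the ridge into a chart
    of dimension d.\<close>
  define g where "g u v = (if v \<in> R then u (q v) else if v = z then 1 - sm u
    else if v = x then max (u (d - 1)) 0 else if v = y then max (- u (d - 1)) 0 else 0)"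
    for u :: "nat \<Rightarrow> real" and v
  have zxy: "x \<notin> R" "y \<notin> R" "x \<noteq> z" "y \<noteq> z" using r(2,3) rho by auto
  have cont_sm: "continuous_on S sm" for S
    unfolding sm_def by (intro continuous_intros continuous_on_coordinate)
  have "open {u. sm u < 1}" by (intro open_Collect_less cont_sm continuous_on_const)
  moreover have "open (\<Inter>v\<in>R. {u::nat \<Rightarrow> real. 0 < u (q v)})"
    using finR by (intro open_INT ballI open_Collect_less continuous_on_const continuous_on_coordinate)
  ultimately have U: "openin (top_of_set (eucl d)) U"
    unfolding U_def by (metis Int_assoc open_Int openin_open_Int)
  have supp_le: "{v. g u v \<noteq> 0} \<subseteq> insert x (insert y \<rho>)" for u
    unfolding g_def rho(1) by auto
  have supp: "{v. g u v \<noteq> 0} \<subseteq> insert x \<rho> \<or> {v. g u v \<noteq> 0} \<subseteq> insert y \<rho>" for u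
  proof (cases "0 \<le> u (d - 1)")
    case True
    then have "g u y = 0" using zxy r(4) unfolding g_def by simp
    then show ?thesis using supp_le[of u] by blast
  next
    case False
    then have "g u x = 0" using zxy r(4) unfolding g_def by simp
    then show ?thesis using supp_le[of u] by blast
  qed
  have gX: "g u \<in> realization \<Delta>" if u: "u \<in> U" for u
  proof (rule realizationI[OF _ supp_le])
    have "sum (g u) R = (\<Sum>v\<in>R. u (q v))" by (rule sum.cong) (auto simp: g_def)
    moreover have "g u x + g u y = \<bar>u (d - 1)\<bar>"
      using zxy r(4) unfolding g_def by auto
    moreover have "g u z = 1 - sm u" using rho unfolding g_def by simp
    moreover have "sum (g u) (insert x (insert y \<rho>)) = g u x + g u y + (g u z + sum (g u) R)"
      using sum_insert2[OF fin r(2-4)] finR rho by simp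
    ultimately show "sum (g u) (insert x (insert y \<rho>)) = 1" unfolding sm_def by simp
    show "{v. g u v \<noteq> 0} \<in> \<Delta>" using supp[of u] complex_subset[OF D(1)] r(5,6) by blast
    show "0 \<le> g u v" for v using u unfolding g_def U_def by auto
  qed (use fin in auto)
  have contg: "continuous_on U g"
  proof (rule continuous_on_coordinatewise_then_product)
    fix v
    have "continuous_on U (\<lambda>u. u (q v))" "continuous_on U (\<lambda>u. 1 - sm u)"
      "continuous_on U (\<lambda>u. max (u (d - 1)) (0::real))"
      "continuous_on U (\<lambda>u. max (- u (d - 1)) (0::real))"
      by (intro continuous_intros continuous_on_coordinate cont_sm)+
    then show "continuous_on U (\<lambda>u. g u v)"
      unfolding g_def by (cases "v \<in> R"; cases "v = z"; cases "v = x"; cases "v = y") simp_all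
  qed
  have inj: "inj_on g U"
  proof (rule inj_onI)
    fix u w assume uw: "u \<in> U" "w \<in> U" "g u = g w"
    show "u = w"
    proof
      fix i
      consider "i < d - 1" | "i = d - 1" | "d \<le> i" by linarith
      then show "u i = w i"
      proof cases
        case 1
        then have "i \<in> q ` R" using q by (simp add: bij_betw_def)
        then obtain v where "v \<in> R" "q v = i" by blast
        then show ?thesis using fun_cong[OF uw(3), of v] unfolding g_def by simp
      next
        case 2
        have "g u x - g u y = u (d - 1)" "g w x - g w y = w (d - 1)"
          using zxy r(4) unfolding g_def by auto
        then show ?thesis using uw(3) 2 by simp
      next
        case 3
        then show ?thesis using uw unfolding U_def eucl_def by simp
      qed
    qed
  qed
  have op: "openin (top_of_set (realization \<Delta>)) (g ` U)"
    by (rule invariance_of_domain_to_sphere[OF D(2) U contg _ inj]) (use gX in auto)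
  \<comment> \<open>The chart coordinates of the barycentre of the ridge.\<close>
  define u0 :: "nat \<Rightarrow> real" where "u0 i = (if i < d - 1 then 1 / d else 0)" for i
  have "sm u0 = (\<Sum>v\<in>R. 1 / d)" unfolding sm_def u0_def using qi by simp
  then have sm0: "sm u0 = (d - 1) / d" using cardR by simp
  have "u0 \<in> eucl d" "\<forall>v\<in>R. 0 < u0 (q v)" using D(3) qi by (auto simp: eucl_def u0_def)
  moreover have "sm u0 < 1" unfolding sm0 using D(3) by simp
  ultimately have "u0 \<in> U" unfolding U_def by simp
  moreover have "g u0 = bary \<rho>"
  proof
    fix v
    have "1 - sm u0 = 1 / d" unfolding sm0 using D(3) by (simp add: field_simps of_nat_diff)
    then show "g u0 v = bary \<rho> v"
      using qi r(1) unfolding g_def bary_def rho(1) by (simp add: u0_def)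
  qed
  ultimately have b: "bary \<rho> \<in> g ` U" by (metis imageI)
  have finF: "finite F" and "F \<noteq> {}" using complex_face_finite[OF D(1) F(1)] F(2) z by auto
  have "\<rho> \<in> \<Delta>" using complex_subset[OF D(1) F] .
  \<comment> \<open>If \<open>F\<close> is a face through the ridge, some point with support
    \<open>F\<close> is close enough to the barycentre to lie in the chart, and supports in the
    chart stay within one of the two facets.\<close>
  then have "\<exists>h\<in>g ` U. {v. h v \<noteq> 0} = {v. bary \<rho> v \<noteq> 0} \<union> {v. bary F v \<noteq> 0}"
    using open_meets_segment[OF D(1) bary_in_realization[OF D(1) _ \<open>\<rho> \<noteq> {}\<close>]
        bary_in_realization[OF D(1) F(1) \<open>F \<noteq> {}\<close>] _ op b] F finF fin
    by (simp add: supp_bary Un_absorb1)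
  then obtain u where "{v. g u v \<noteq> 0} = F"
    unfolding supp_bary[OF fin] supp_bary[OF finF] Un_absorb1[OF F(2)] by blast
  then show ?thesis using supp[of u] by simp
qed

text \<open>With at most one vertex extending \<open>\<sigma>\<close>, the open star of
  \<open>\<sigma>\<close> embeds into a half-space of dimension d with the barycentre of
  \<open>\<sigma>\<close> on the boundary, while invariance of domain makes the image open. Since
  surplus coordinates are set to 0, the argument also excludes maximal faces of too small a
  dimension.\<close>

lemma face_extends_twice:
  assumes D: "abstract_complex \<Delta>" "realization \<Delta> homeomorphic sph d"
    and s: "\<sigma> \<in> \<Delta>" "\<sigma> \<noteq> {}" "card \<sigma> \<le> d"
  shows "\<exists>x y. x \<noteq> y \<and> x \<notin> \<sigma> \<and> y \<notin> \<sigma> \<and> insert x \<sigma> \<in> \<Delta> \<and> insert y \<sigma> \<in> \<Delta>"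
proof (rule ccontr)
  assume no: "\<not> ?thesis"
  have fin: "finite \<sigma>" using complex_face_finite[OF D(1) s(1)] .
  define m where "m = card \<sigma>"
  have m: "0 < m" "m \<le> d" unfolding m_def using fin s by (auto simp: card_gt_0_iff)
  obtain z where z: "z \<in> \<sigma>" using s(2) by blast
  define R where "R = \<sigma> - {z}"
  have finR: "finite R" and cardR: "card R = m - 1" and sig: "\<sigma> = insert z R" "z \<notin> R"
    using fin z unfolding R_def m_def by auto
  obtain q where q: "bij_betw q R {..<m - 1}"
    using ex_bij_betw_finite_nat[OF finR] cardR by (auto simp: atLeast0LessThan)
  have qi: "q v < m - 1" if "v \<in> R" for v using q that by (auto simp: bij_betw_def)
  define p where "p = inv_into R q"
  have p: "p i \<in> R" "q (p i) = i" if "i < m - 1" for i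
    using q that unfolding p_def bij_betw_def by (auto intro: inv_into_into f_inv_into_f)
  have pq: "p (q v) = v" if "v \<in> R" for v using q that unfolding p_def bij_betw_def by simp
  let ?X = "realization \<Delta>"
  define V where "V = ?X \<inter> (\<Inter>v\<in>\<sigma>. {f. 0 < f v})"
  have "open (\<Inter>v\<in>\<sigma>. {f::'a \<Rightarrow> real. 0 < f v})"
    using fin by (intro open_INT ballI open_Collect_less continuous_on_const continuous_on_coordinate)
  then have V: "openin (top_of_set ?X) V" unfolding V_def by blast
  \<comment> \<open>The last coordinate is the weight outside \<open>\<sigma>\<close>. It sits on
    the single vertex of \<open>E\<close>, if there is one, so it is never negative and the map is
    injective.\<close>
  define g where "g f i = (if i < m - 1 then f (p i) else if i = d - 1 then 1 - sum f \<sigma> else 0)"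
    for f :: "'a \<Rightarrow> real" and i
  have outside: "\<exists>E. finite E \<and> E \<inter> \<sigma> = {} \<and> card E \<le> 1 \<and> (\<forall>f\<in>V. {v. f v \<noteq> 0} \<subseteq> \<sigma> \<union> E)"
  proof -
    define E where "E = {x. x \<notin> \<sigma> \<and> insert x \<sigma> \<in> \<Delta>}"
    have one: "x = y" if "x \<in> E" "y \<in> E" for x y using no that unfolding E_def by blast
    have "\<exists>x. E \<subseteq> {x}"
      using one by (metis insertI1 subsetI)
    then obtain x where x: "E \<subseteq> {x}" by blast
    then have "finite E" "card E \<le> 1" using finite_subset card_mono[OF _ x] by auto
    moreover have "{v. f v \<noteq> 0} \<subseteq> \<sigma> \<union> E" if f: "f \<in> V" for f
    proof
      fix v assume v: "v \<in> {v. f v \<noteq> 0}"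
      have "{v. f v \<noteq> 0} \<in> \<Delta>" "\<sigma> \<subseteq> {v. f v \<noteq> 0}"
        using f by (force simp: V_def realization_iff)+
      then have "insert v \<sigma> \<in> \<Delta>" using complex_subset[OF D(1)] v by blast
      then show "v \<in> \<sigma> \<union> E" unfolding E_def by blast
    qed
    moreover have "E \<inter> \<sigma> = {}" unfolding E_def by blast
    ultimately show ?thesis by blast
  qed
  then obtain E where E: "finite E" "E \<inter> \<sigma> = {}" "card E \<le> 1" "\<And>f. f \<in> V \<Longrightarrow> {v. f v \<noteq> 0} \<subseteq> \<sigma> \<union> E"
    by blast
  have sumE: "sum f E = 1 - sum f \<sigma>" if f: "f \<in> V" for f
  proof -
    have "f \<in> ?X" using f unfolding V_def by simp
    then have "sum f (\<sigma> \<union> E) = 1" using E fin f by (intro realization_sum) auto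
    moreover have "sum f (\<sigma> \<union> E) = sum f \<sigma> + sum f E"
      using E fin by (intro sum.union_disjoint) auto
    ultimately show ?thesis by simp
  qed
  have nn: "0 \<le> g f (d - 1)" if f: "f \<in> V" for f
  proof (cases "d - 1 < m - 1")
    case True
    then show ?thesis using m by linarith
  next
    case False
    have "0 \<le> sum f E" using f by (intro sum_nonneg) (auto simp: V_def realization_iff)
    then show ?thesis using False sumE[OF f] unfolding g_def by simp
  qed
  have contg: "continuous_on V g"
  proof (rule continuous_on_coordinatewise_then_product)
    fix i
    have "continuous_on V (\<lambda>f. f (p i))" "continuous_on V (\<lambda>f. 1 - sum f \<sigma>)"
      by (intro continuous_intros continuous_on_coordinate)+
    then show "continuous_on V (\<lambda>f. g f i)"
      unfolding g_def by (cases "i < m - 1"; cases "i = d - 1") simp_all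
  qed
  have inj: "inj_on g V"
  proof (rule inj_onI)
    fix f h assume fh: "f \<in> V" "h \<in> V" "g f = g h"
    have R: "f v = h v" if "v \<in> R" for v
      using fun_cong[OF fh(3), of "q v"] qi[OF that] pq[OF that] unfolding g_def by simp
    have "\<not> d - 1 < m - 1" using m by linarith
    then have sm: "sum f \<sigma> = sum h \<sigma>"
      using fun_cong[OF fh(3), of "d - 1"] unfolding g_def by simp
    moreover have "sum f R = sum h R" using R by (intro sum.cong) auto
    ultimately have z': "f z = h z" using sig finR by simp
    have e: "sum f E = sum h E" using sumE fh sm by simp
    have E': "f v = h v" if "v \<in> E" for v
    proof -
      have "E = {v}" using that E(1,3) by (metis card_1_singletonE card_0_eq empty_iff le_neq_implies_less less_one singletonD)
      then show ?thesis using e by simp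
    qed
    show "f = h"
    proof
      fix v
      show "f v = h v"
      proof (cases "v \<in> \<sigma> \<union> E")
        case True
        then show ?thesis using R z' E' sig by blast
      next
        case False
        then have "f v = 0" "h v = 0" using E(4)[OF fh(1)] E(4)[OF fh(2)] by blast+
        then show ?thesis by simp
      qed
    qed
  qed
  have op: "openin (top_of_set (eucl d)) (g ` V)"
  proof (rule invariance_of_domain_from_sphere[OF D(2) V contg _ inj])
    have "g f i = 0" if "d \<le> i" for f i
    proof -
      have "\<not> i < m - 1" "i \<noteq> d - 1" using m that by linarith+
      then show ?thesis unfolding g_def by simp
    qed
    then show "g \<in> V \<rightarrow> eucl d" unfolding eucl_def by blast
  qed
  have b: "bary \<sigma> \<in> V"
    unfolding V_def using bary_in_realization[OF D(1) s(1,2)] fin s(2) by (auto simp: bary_def card_gt_0_iff)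
  have b0: "g (bary \<sigma>) (d - 1) = 0"
  proof -
    have "sum (bary \<sigma>) \<sigma> = 1" using fin s(2) by (simp add: bary_def)
    moreover have "\<not> d - 1 < m - 1" using m by linarith
    ultimately show ?thesis unfolding g_def by simp
  qed
  obtain T where T: "open T" "g ` V = eucl d \<inter> T" using op unfolding openin_open by blast
  \<comment> \<open>A line from the image of the barycentre towards negative last coordinates; an
    open image would contain its beginning.\<close>
  define c where "c t = (g (bary \<sigma>))(d - 1 := - t)" for t :: real
  have contc: "continuous_on UNIV c"
  proof (rule continuous_on_coordinatewise_then_product)
    fix i show "continuous_on UNIV (\<lambda>t. c t i)"
      unfolding c_def by (cases "i = d - 1") (auto intro: continuous_intros)
  qed
  have "c 0 = g (bary \<sigma>)" unfolding c_def using b0 by (auto simp: fun_eq_iff)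
  then have "0 \<in> c -` T" using T(2) b by auto
  moreover have "open (c -` T)" using contc T(1) by (simp add: open_vimage)
  ultimately obtain e where e: "e > 0" "ball 0 e \<subseteq> c -` T" using open_contains_ball by blast
  have "e / 2 \<in> ball 0 e" using e by (simp add: dist_real_def)
  then have "c (e / 2) \<in> T" using e by blast
  moreover have "c (e / 2) \<in> eucl d" 
  proof -
    have "c (e / 2) i = 0" if "d \<le> i" for i
    proof -
      have "\<not> i < m - 1" "i \<noteq> d - 1" using m that by linarith+
      then show ?thesis unfolding c_def g_def by simp
    qed
    then show ?thesis unfolding eucl_def by blast
  qed
  ultimately obtain f where "f \<in> V" "g f = c (e / 2)" using T(2) by (metis IntI imageE)
  then have "0 \<le> c (e / 2) (d - 1)" using nn by metis
  then show False using e(1) unfolding c_def by simp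
qed

text \<open>The realization has just two points, and a single edge would already give three.\<close>

lemma zero_sphere_two_points:
  assumes D: "abstract_complex \<Delta>" "realization \<Delta> homeomorphic sph 0"
  shows "\<exists>a b. a \<noteq> b \<and> vertices \<Delta> = {a, b} \<and> {a, b} \<notin> \<Delta>"
proof -
  have "sph 0 = {(\<lambda>i. if i = 0 then 1 else 0), (\<lambda>i. if i = 0 then -1 else 0)}"
    unfolding sph_def by (auto simp: power2_eq_1_iff fun_eq_iff)
  then have c2: "card (sph 0) = 2" by (simp add: fun_eq_iff card_insert_if) 
  obtain h k where hk: "homeomorphism (realization \<Delta>) (sph 0) h k" using D(2) homeomorphic_def by blast
  have "bij_betw h (realization \<Delta>) (sph 0)"
    using hk unfolding homeomorphism_def by (intro bij_betwI[where g = k]) auto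
  then have X2: "card (realization \<Delta>) = 2" using c2 bij_betw_same_card by fastforce
  then have finX: "finite (realization \<Delta>)" using card.infinite by fastforce
  have no_edge: "F = {} \<or> (\<exists>v. F = {v})" if F: "F \<in> \<Delta>" for F
  proof (rule ccontr)
    assume "\<not> ?thesis"
    then obtain a b where ab: "a \<in> F" "b \<in> F" "a \<noteq> b" by blast
    have "{a} \<in> \<Delta>" "{b} \<in> \<Delta>" "{a, b} \<in> \<Delta>"
      using ab complex_subset[OF D(1) F] by auto
    then have "{bary {a}, bary {b}, bary {a, b}} \<subseteq> realization \<Delta>"
      using bary_in_realization[OF D(1)] by simp
    moreover have "card {bary {a}, bary {b}, bary {a, b}} = 3"
    proof -
      have "bary {a} b \<noteq> bary {b} b" "bary {a} b \<noteq> bary {a, b} b" "bary {b} a \<noteq> bary {a, b} a"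
        using ab by (auto simp: bary_def)
      then have "bary {a} \<noteq> bary {b}" "bary {a} \<noteq> bary {a, b}" "bary {b} \<noteq> bary {a, b}" by metis+
      then show ?thesis by simp
    qed
    ultimately have "3 \<le> card (realization \<Delta>)" using finX by (metis card_mono)
    then show False using X2 by simp
  qed
  have sing: "{v} \<in> \<Delta>" if "v \<in> vertices \<Delta>" for v
    using that complex_subset[OF D(1)] unfolding vertices_def by auto
  have "bij_betw (\<lambda>v. bary {v}) (vertices \<Delta>) (realization \<Delta>)"
  proof (rule bij_betwI')
    show "bary {x} = bary {y} \<longleftrightarrow> x = y" for x y :: 'a
      by (metis finite.emptyI finite.insertI singleton_insert_inj_eq supp_bary)
    show "bary {v} \<in> realization \<Delta>" if "v \<in> vertices \<Delta>" for v
      using bary_in_realization[OF D(1) sing[OF that]] by simp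
    show "\<exists>v\<in>vertices \<Delta>. f = bary {v}" if f: "f \<in> realization \<Delta>" for f
    proof -
      have F: "{v. f v \<noteq> 0} \<in> \<Delta>" "(\<Sum>v | f v \<noteq> 0. f v) = 1" using f unfolding realization_iff by auto
      then obtain v where v: "{v. f v \<noteq> 0} = {v}" using no_edge[OF F(1)] by fastforce
      then have "f v = 1" using F(2) by simp
      then have "f = bary {v}" using v by (auto simp: bary_def fun_eq_iff)
      moreover have "v \<in> vertices \<Delta>" using F(1) v unfolding vertices_def by auto
      ultimately show ?thesis by blast
    qed
  qed
  then have "card (vertices \<Delta>) = 2" using X2 bij_betw_same_card by fastforce
  then obtain a b where ab: "vertices \<Delta> = {a, b}" "a \<noteq> b" by (meson card_2_iff)
  then have "{a, b} \<notin> \<Delta>" using no_edge[of "{a, b}"] by auto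
  then show ?thesis using ab by blast
qed

section \<open>Flag complexes and their graphs\<close>

definition edge :: "'a set set \<Rightarrow> 'a \<Rightarrow> 'a \<Rightarrow> bool" where
  "edge \<Delta> u v \<longleftrightarrow> u \<noteq> v \<and> {u, v} \<in> \<Delta>"

lemma graph_edge: "graph (edge \<Delta>)"
proof
  show "edge \<Delta> y x" if "edge \<Delta> x y" for x y
    using that unfolding edge_def by (metis insert_commute)
  show "\<not> edge \<Delta> x x" for x unfolding edge_def by simp
qed

lemma vertex_face: "abstract_complex \<Delta> \<Longrightarrow> v \<in> vertices \<Delta> \<Longrightarrow> {v} \<in> \<Delta>"
  unfolding vertices_def by (auto intro: complex_subset)

text \<open>A minimal non-face inside \<open>F\<close> would be a pair.\<close>

lemma flag_clique:
  assumes D: "abstract_complex \<Delta>" "flag \<Delta>"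
    and F: "F \<subseteq> vertices \<Delta>" "\<And>u v. u \<in> F \<Longrightarrow> v \<in> F \<Longrightarrow> u \<noteq> v \<Longrightarrow> {u, v} \<in> \<Delta>"
  shows "F \<in> \<Delta>"
proof (rule ccontr)
  assume "F \<notin> \<Delta>"
  have "finite F" using F(1) D(1) finite_subset unfolding abstract_complex_def by blast
  then have "finite {N. N \<subseteq> F \<and> N \<notin> \<Delta>}" by simp
  moreover have "{N. N \<subseteq> F \<and> N \<notin> \<Delta>} \<noteq> {}" using \<open>F \<notin> \<Delta>\<close> by blast
  ultimately obtain N where N: "N \<subseteq> F" "N \<notin> \<Delta>" "\<forall>M\<in>{N. N \<subseteq> F \<and> N \<notin> \<Delta>}. M \<le> N \<longrightarrow> N = M"
    using finite_has_minimal[of "{N. N \<subseteq> F \<and> N \<notin> \<Delta>}"] by blast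
  then have "\<forall>M. M \<subset> N \<longrightarrow> M \<in> \<Delta>" by blast
  then have "card N = 2" using D(2) N F(1) unfolding flag_def by blast
  then obtain u v where "N = {u, v}" "u \<noteq> v" by (meson card_2_iff)
  then show False using N F(2) by blast
qed

text \<open>By flagness the common neighbours of a face are the vertices of its link. So the
  recursion of \<open>pm\<close> is built up by downward induction on the size of the face, from the
  ridges, whose links are two points, to the empty face.\<close>

theorem flag_sphere_pm:
  assumes S: "simplicial_sphere d \<Delta>" "flag \<Delta>"
  shows "pm (edge \<Delta>) d (vertices \<Delta>)"
proof (cases "d = 0")
  case True
  then show ?thesis
    using S zero_sphere_two_points[of \<Delta>] unfolding simplicial_sphere_iff by (auto simp: edge_def)
next
  case False
  have D: "abstract_complex \<Delta>" "realization \<Delta> homeomorphic sph d"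
    using S unfolding simplicial_sphere_iff by auto
  have d: "1 \<le> d" using False by simp
  let ?V = "vertices \<Delta>"
  have finV: "finite ?V" using D(1) unfolding abstract_complex_def by blast
  define CN where "CN K = {w \<in> ?V. \<forall>v\<in>K. edge \<Delta> v w}" for K
  have ext: "insert w K \<in> \<Delta> \<and> w \<notin> K" if K: "K \<in> \<Delta>" and w: "w \<in> CN K" for K w
  proof
    show "insert w K \<in> \<Delta>"
    proof (rule flag_clique[OF D(1) S(2)])
      show "insert w K \<subseteq> ?V" using K w unfolding CN_def vertices_def by blast
      show "{u, v} \<in> \<Delta>" if "u \<in> insert w K" "v \<in> insert w K" "u \<noteq> v" for u v
        using that w complex_subset[OF D(1) K, of "{u, v}"]
        unfolding CN_def edge_def by (auto simp: insert_commute)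
    qed
    show "w \<notin> K" using w unfolding CN_def edge_def by auto
  qed
  have CN_I: "w \<in> CN K" if "insert w K \<in> \<Delta>" "w \<notin> K" for K w
    using that complex_subset[OF D(1) that(1)] unfolding CN_def edge_def vertices_def by auto
  have "pm (edge \<Delta>) (d - card K) (CN K)" if "K \<in> \<Delta>" "card K \<le> d" for K
    using that
  proof (induction "d - card K" arbitrary: K)
    case 0
    then have K: "card K = d" "K \<noteq> {}" using d by auto
    obtain x y where xy: "x \<noteq> y" "x \<notin> K" "y \<notin> K" "insert x K \<in> \<Delta>" "insert y K \<in> \<Delta>"
      using face_extends_twice[OF D 0(2) K(2)] K(1) by blast
    have two: "F \<subseteq> insert x K \<or> F \<subseteq> insert y K" if "F \<in> \<Delta>" "K \<subseteq> F" for F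
      using ridge_in_two_facets[OF D d K(1) xy(2,3,1,4,5) that] .
    have "CN K = {x, y}"
    proof
      show "CN K \<subseteq> {x, y}" using two ext[OF 0(2)] by blast
      show "{x, y} \<subseteq> CN K" using CN_I xy by blast
    qed
    \<comment> \<open>Adjacent \<open>x\<close> and \<open>y\<close> would give a face through the
      ridge that lies in neither of the two facets.\<close>
    moreover have "\<not> edge \<Delta> x y"
    proof
      assume e: "edge \<Delta> x y"
      have "y \<in> CN (insert x K)"
        using CN_I[OF xy(5,3)] e unfolding CN_def by blast
      then have "insert y (insert x K) \<in> \<Delta>" using ext[OF xy(4)] by blast
      then show False using two[of "insert y (insert x K)"] xy by blast
    qed
    ultimately show ?case using K(1) xy(1) by auto
  next
    case (Suc n)
    have ne: "CN K \<noteq> {}"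
    proof (cases "K = {}")
      case True
      have "sph d \<noteq> {}" using in_topspace_nsphere[of d] unfolding nsphere_eq by auto
      then have "realization \<Delta> \<noteq> {}" using D(2) homeomorphic_empty by metis
      then obtain f where "f \<in> realization \<Delta>" by blast
      then have f: "{v. f v \<noteq> 0} \<in> \<Delta>" "(\<Sum>v | f v \<noteq> 0. f v) = 1"
        unfolding realization_iff by blast+
      have "{v. f v \<noteq> 0} \<noteq> {}"
        using f(2) by (metis sum.empty zero_neq_one)
      then show ?thesis using f(1) True unfolding CN_def vertices_def by blast
    next
      case False
      then show ?thesis using face_extends_twice[OF D Suc(3) False Suc(4)] CN_I by blast
    qed
    have "pm (edge \<Delta>) n {w \<in> CN K. edge \<Delta> v w}" if v: "v \<in> CN K" for v
    proof -
      have fK: "finite K" using complex_face_finite[OF D(1) Suc(3)] .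
      have e: "insert v K \<in> \<Delta>" "v \<notin> K" using ext[OF Suc(3) v] by auto
      have c: "card (insert v K) = Suc (card K)" using fK e by simp
      have n: "n = d - card (insert v K)" "card (insert v K) \<le> d"
        using Suc(2) unfolding c by linarith+
      have "{w \<in> CN K. edge \<Delta> v w} = CN (insert v K)" unfolding CN_def by auto
      then show ?thesis using Suc(1)[OF n(1) e(1) n(2)] n(1) by simp
    qed
    then have "pm (edge \<Delta>) (Suc n) (CN K)" using ne finV by (simp add: CN_def)
    then show ?case using Suc(2) by simp
  qed
  from this[of "{}"] have "pm (edge \<Delta>) d (CN {})"
    using D(1) unfolding abstract_complex_def by simp
  then show ?thesis unfolding CN_def by simp
qed

subsection \<open>Bistellar flips\<close>

text \<open>A generalised bistellar flip replaces \<open>A * \<partial>B * L\<close> by \<open>\<partial>A * B * L\<close>. On the realizations it moves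
  the weight common to all vertices of \<open>A\<close> evenly to the vertices of \<open>B\<close>.\<close>

definition flip_facets :: "'a set set \<Rightarrow> 'a set \<Rightarrow> 'a set \<Rightarrow> 'a set set \<Rightarrow> 'a set set" where
  "flip_facets R A B L = R \<union> {A \<union> (B - {b}) \<union> l | b l. b \<in> B \<and> l \<in> L}"

definition flip_map :: "'a set \<Rightarrow> 'a set \<Rightarrow> ('a \<Rightarrow> real) \<Rightarrow> 'a \<Rightarrow> real" where
  "flip_map A B f v = (if v \<in> A then f v - Min (f ` A)
     else if v \<in> B then f v + Min (f ` A) * (card A / card B) else f v)"

lemma continuous_on_Min:
  fixes A :: "'a set"
  assumes "finite A" "A \<noteq> {}"
  shows "continuous_on S (\<lambda>f::'a \<Rightarrow> real. Min (f ` A))"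
  using assms
proof (induction rule: finite_ne_induct)
  case (singleton x)
  then show ?case by (simp add: continuous_on_coordinate)
next
  case (insert x F)
  then have "(\<lambda>f::'a \<Rightarrow> real. Min (f ` insert x F)) = (\<lambda>f. min (f x) (Min (f ` F)))"
    by auto
  then show ?case using insert by (simp only:) (intro continuous_on_min continuous_on_coordinate)
qed

lemma continuous_on_flip_map:
  assumes "finite A" "A \<noteq> {}"
  shows "continuous_on S (flip_map A B)"
proof (rule continuous_on_coordinatewise_then_product)
  fix v
  note cont = continuous_on_coordinate continuous_on_Min[OF assms]
  have "continuous_on S (\<lambda>f. f v - Min (f ` A))"
    "continuous_on S (\<lambda>f. f v + Min (f ` A) * (card A / card B))"
    by (intro continuous_on_diff continuous_on_add continuous_on_mult continuous_on_const cont)+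
  then show "continuous_on S (\<lambda>f. flip_map A B f v)"
    unfolding flip_map_def
    by (cases "v \<in> A"; cases "v \<in> B") (simp_all only: if_True if_False simp_thms continuous_on_coordinate)
qed

lemma generated_byI: "F \<in> \<F> \<Longrightarrow> G \<subseteq> F \<Longrightarrow> G \<in> generated_by \<F>"
  unfolding generated_by_def by blast

lemma generated_byE:
  assumes "G \<in> generated_by \<F>"
  obtains F where "F \<in> \<F>" "G \<subseteq> F"
  using assms unfolding generated_by_def by blast

text \<open>No face of the old complex contains all of \<open>B\<close>, so some vertex of
  \<open>B\<close> has weight 0. After the move the least weight on \<open>B\<close> is therefore
  exactly the amount added, and the reverse move takes this amount back. On the facets in
  \<open>R\<close>, which do not contain \<open>A\<close>, nothing moves.\<close>

lemma flip_map_properties: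
  assumes A: "finite A" "A \<noteq> {}" and B: "finite B" "B \<noteq> {}" and AB: "A \<inter> B = {}"
    and L: "\<And>l. l \<in> L \<Longrightarrow> finite l \<and> l \<inter> (A \<union> B) = {}"
    and R: "\<And>r. r \<in> R \<Longrightarrow> finite r \<and> \<not> A \<subseteq> r \<and> \<not> B \<subseteq> r"
    and f: "f \<in> realization (generated_by (flip_facets R A B L))"
  shows "flip_map A B f \<in> realization (generated_by (flip_facets R B A L))"
    and "flip_map B A (flip_map A B f) = f"
proof -
  let ?g = "flip_map A B f"
  define m where "m = Min (f ` A)"
  define c where "c = m * (card A / card B)"
  have g: "?g v = (if v \<in> A then f v - m else if v \<in> B then f v + c else f v)" for v
    unfolding flip_map_def m_def c_def by simp
  have cards: "card A > 0" "card B > 0" using A B by (auto simp: card_gt_0_iff)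
  have nn: "0 \<le> f v" for v using f unfolding realization_iff by blast
  have m_le: "m \<le> f v" if "v \<in> A" for v using that A unfolding m_def by simp
  have "m \<in> f ` A" unfolding m_def using A by (intro Min_in) auto
  then obtain a where a: "a \<in> A" "f a = m" by auto
  have m0: "0 \<le> m" using a nn by metis
  then have c0: "0 \<le> c" unfolding c_def by simp
  have "{v. f v \<noteq> 0} \<in> generated_by (flip_facets R A B L)"
    using f unfolding realization_iff by blast
  then obtain \<sigma> where \<sigma>: "\<sigma> \<in> flip_facets R A B L" "{v. f v \<noteq> 0} \<subseteq> \<sigma>" by (rule generated_byE)
  have fin: "finite \<sigma>" using \<sigma>(1) A B L R unfolding flip_facets_def by auto
  have B0: "\<exists>b\<in>B. f b = 0"
  proof (cases "\<sigma> \<in> R")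
    case True
    then show ?thesis using R[OF True] \<sigma>(2) by blast
  next
    case False
    then obtain b l where bl: "\<sigma> = A \<union> (B - {b}) \<union> l" "b \<in> B" "l \<in> L"
      using \<sigma>(1) unfolding flip_facets_def by blast
    then have "b \<notin> \<sigma>" using AB L by blast
    then show ?thesis using \<sigma>(2) bl(2) by blast
  qed
  have supp: "{v. ?g v \<noteq> 0} \<in> generated_by (flip_facets R B A L)"
  proof (cases "\<sigma> \<in> R")
    case True
    then obtain a' where "a' \<in> A" "f a' = 0" using R[OF True] \<sigma>(2) by blast
    then have "m = 0" using m_le[of a'] m0 by simp
    then have "?g = f" unfolding fun_eq_iff g c_def by simp
    then show ?thesis using True \<sigma>(2) unfolding flip_facets_def by (auto intro: generated_byI)
  next
    case False
    then obtain b l where bl: "\<sigma> = A \<union> (B - {b}) \<union> l" "b \<in> B" "l \<in> L"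
      using \<sigma>(1) unfolding flip_facets_def by blast
    have "{v. ?g v \<noteq> 0} \<subseteq> B \<union> (A - {a}) \<union> l"
    proof
      fix v assume v: "v \<in> {v. ?g v \<noteq> 0}"
      show "v \<in> B \<union> (A - {a}) \<union> l"
      proof (cases "v \<in> A \<union> B")
        case True
        then show ?thesis using v a unfolding g by auto
      next
        case False
        then have "f v \<noteq> 0" using v unfolding g by simp
        then show ?thesis using \<sigma>(2) False bl(1) by blast
      qed
    qed
    then show ?thesis
      using bl(3) a(1) unfolding flip_facets_def by (intro generated_byI) auto
  qed
  have sum: "sum ?g (A \<union> B \<union> \<sigma>) = 1"
  proof -
    have 1: "?g v = f v + ((if v \<in> A then - m else 0) + (if v \<in> B then c else 0))" for v
      using AB unfolding g by auto
    have "sum f (A \<union> B \<union> \<sigma>) = 1"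
      using f \<sigma>(2) A B fin by (intro realization_sum) auto
    moreover have "(\<Sum>v\<in>A \<union> B \<union> \<sigma>. if v \<in> A then - m else 0) = - (m * card A)"
      using A B fin by (simp add: sum.If_cases Int_absorb1 Int_Un_distrib2 flip: sum.inter_filter)
    moreover have "(\<Sum>v\<in>A \<union> B \<union> \<sigma>. if v \<in> B then c else 0) = c * card B"
      using A B fin by (simp add: sum.If_cases Int_absorb1 Int_Un_distrib2 flip: sum.inter_filter)
    moreover have "c * card B = m * card A" using cards unfolding c_def by simp
    ultimately show ?thesis unfolding 1 sum.distrib by simp
  qed
  have "{v. ?g v \<noteq> 0} \<subseteq> A \<union> B \<union> \<sigma>" using \<sigma>(2) unfolding g by auto
  moreover have "0 \<le> ?g v" for v using nn[of v] m_le[of v] c0 unfolding g by auto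
  ultimately show "?g \<in> realization (generated_by (flip_facets R B A L))"
    using A B fin sum supp by (intro realizationI[of "A \<union> B \<union> \<sigma>"]) auto
  obtain b where b: "b \<in> B" "f b = 0" using B0 by blast
  have "Min (?g ` B) = c"
  proof (rule Min_eqI)
    have "?g b = c" using b AB unfolding g by auto
    then show "c \<in> ?g ` B" using b(1) by (metis imageI)
    show "c \<le> y" if "y \<in> ?g ` B" for y using that nn AB unfolding g by auto
  qed (use B in auto)
  moreover have "c * (card B / card A) = m" using cards unfolding c_def by simp
  ultimately show "flip_map B A ?g = f"
    using AB unfolding fun_eq_iff flip_map_def[of B A] by (auto simp: g)
qed

theorem realization_flip:
  assumes A: "finite A" "A \<noteq> {}" and B: "finite B" "B \<noteq> {}" and AB: "A \<inter> B = {}"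
    and L: "\<And>l. l \<in> L \<Longrightarrow> finite l \<and> l \<inter> (A \<union> B) = {}"
    and R: "\<And>r. r \<in> R \<Longrightarrow> finite r \<and> \<not> A \<subseteq> r \<and> \<not> B \<subseteq> r"
  shows "realization (generated_by (flip_facets R A B L)) homeomorphic
         realization (generated_by (flip_facets R B A L))"
proof -
  have BA: "B \<inter> A = {}" using AB by blast
  have L': "\<And>l. l \<in> L \<Longrightarrow> finite l \<and> l \<inter> (B \<union> A) = {}" using L by (simp add: Un_commute)
  have R': "\<And>r. r \<in> R \<Longrightarrow> finite r \<and> \<not> B \<subseteq> r \<and> \<not> A \<subseteq> r" using R by blast
  note p = flip_map_properties[OF A B AB L R] and p' = flip_map_properties[OF B A BA L' R']
  show ?thesis
    unfolding homeomorphic_def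
  proof (intro exI homeomorphismI)
    show "continuous_on (realization (generated_by (flip_facets R A B L))) (flip_map A B)"
      by (rule continuous_on_flip_map[OF A])
    show "continuous_on (realization (generated_by (flip_facets R B A L))) (flip_map B A)"
      by (rule continuous_on_flip_map[OF B])
  qed (use p p' in auto)
qed

text \<open>Both spaces represent the nonzero classes of real (d+2)-space modulo the diagonal line,
  up to positive scaling. \<open>D\<close> makes the last coordinate 0 and \<open>\<psi>\<close>
  makes the least one 0; the scale is fixed by norm 1 on the sphere and by sum 1 on the
  simplex.\<close>

theorem realization_simplex_boundary:
  assumes p: "inj_on p {..Suc d}"
  shows "realization (generated_by ((\<lambda>i. p ` {..Suc d} - {p i}) ` {..Suc d})) homeomorphic sph d"
proof -
  define T where "T = p ` {..Suc d}"
  define q where "q = inv_into {..Suc d} p"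
  define X where "X = realization (generated_by ((\<lambda>i. T - {p i}) ` {..Suc d}))"
  have qp: "q (p i) = i" if "i \<le> Suc d" for i using p that unfolding q_def by simp
  have pq: "q v \<le> Suc d" "p (q v) = v" if "v \<in> T" for v
    using that qp unfolding T_def by auto
  have finT: "finite T" unfolding T_def by simp
  have sumT: "sum f T = (\<Sum>i\<le>Suc d. f (p i))" for f :: "'a \<Rightarrow> real"
    unfolding T_def using sum.reindex[OF p] by simp
  have X_iff: "f \<in> X \<longleftrightarrow> (\<forall>v. 0 \<le> f v) \<and> (\<forall>v. v \<notin> T \<longrightarrow> f v = 0) \<and> (\<exists>i\<le>Suc d. f (p i) = 0) \<and> (\<Sum>i\<le>Suc d. f (p i)) = 1"
    for f
  proof
    assume f: "f \<in> X"
    then obtain i where i: "i \<le> Suc d" "{v. f v \<noteq> 0} \<subseteq> T - {p i}"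
      unfolding X_def realization_iff generated_by_def by blast
    then have "sum f T = 1" using f finT unfolding X_def by (intro realization_sum) auto
    moreover have "\<forall>v. 0 \<le> f v" using f unfolding X_def realization_iff by blast
    ultimately show "(\<forall>v. 0 \<le> f v) \<and> (\<forall>v. v \<notin> T \<longrightarrow> f v = 0) \<and> (\<exists>i\<le>Suc d. f (p i) = 0) \<and> (\<Sum>i\<le>Suc d. f (p i)) = 1"
      using i sumT[of f] by auto
  next
    assume f: "(\<forall>v. 0 \<le> f v) \<and> (\<forall>v. v \<notin> T \<longrightarrow> f v = 0) \<and> (\<exists>i\<le>Suc d. f (p i) = 0) \<and> (\<Sum>i\<le>Suc d. f (p i)) = 1"
    then obtain i where i: "i \<le> Suc d" "f (p i) = 0" by blast
    have "{v. f v \<noteq> 0} \<subseteq> T - {p i}" using f i by auto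
    then have "{v. f v \<noteq> 0} \<in> generated_by ((\<lambda>i. T - {p i}) ` {..Suc d})"
      using i(1) by (intro generated_byI[of "T - {p i}"]) auto
    then show "f \<in> X" unfolding X_def
      using f finT sumT[of f] by (intro realizationI[of T]) auto
  qed
  define D where "D f i = (if i \<le> d then f (p i) - f (p (Suc d)) else 0)" for f :: "'a \<Rightarrow> real" and i
  define \<phi> where "\<phi> f i = inverse (nrm d (D f)) * D f i" for f i
  define m where "m x = Min (x ` {..Suc d})" for x :: "nat \<Rightarrow> real"
  define S where "S x = (\<Sum>i\<le>Suc d. x i - m x)" for x
  define \<psi> where "\<psi> x v = (if v \<in> T then (x (q v) - m x) / S x else 0)" for x v
  have m_le: "m x \<le> x i" if "i \<le> Suc d" for x i using that unfolding m_def by simp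
  have m_ex: "\<exists>i\<le>Suc d. x i = m x" for x
  proof -
    have "m x \<in> x ` {..Suc d}" unfolding m_def by (intro Min_in) auto
    then show ?thesis by auto
  qed
  have D_eucl: "D f \<in> eucl (Suc d)" for f unfolding D_def eucl_def by simp
  have D_pos: "0 < nrm d (D f)" if f: "f \<in> X" for f
  proof (rule ccontr)
    assume "\<not> ?thesis"
    then have "nrm d (D f) = 0" using nrm_nonneg[of d "D f"] by simp
    then have "(\<Sum>i\<le>d. (D f i)\<^sup>2) = 0" unfolding nrm_def by simp
    then have "\<forall>i\<le>d. D f i = 0" by (subst (asm) sum_nonneg_eq_0_iff) auto
    then have eq: "f (p i) = f (p (Suc d))" if "i \<le> Suc d" for i
      using that unfolding D_def by (metis eq_iff_diff_eq_0 le_SucE)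
    obtain j where j: "j \<le> Suc d" "f (p j) = 0" using f X_iff by blast
    have "f (p i) = 0" if "i \<le> Suc d" for i using eq[OF that] eq[OF j(1)] j(2) by metis
    then have "(\<Sum>i\<le>Suc d. f (p i)) = 0" by (intro sum.neutral) simp
    then show False using f X_iff by simp
  qed
  have xSuc: "x (Suc d) = 0" if "x \<in> sph d" for x using that unfolding sph_def by simp
  have S_pos: "0 < S x" if x: "x \<in> sph d" for x
  proof (rule ccontr)
    assume "\<not> ?thesis"
    moreover have "0 \<le> S x" unfolding S_def using m_le by (intro sum_nonneg) auto
    ultimately have "(\<Sum>i\<le>Suc d. x i - m x) = 0" unfolding S_def by simp
    then have "\<forall>i\<le>Suc d. x i - m x = 0" using m_le by (subst (asm) sum_nonneg_eq_0_iff) auto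
    then have "x i = 0" if "i \<le> d" for i using xSuc[OF x] that by (metis eq_iff_diff_eq_0 le_Suc_eq order_refl)
    then have "(\<Sum>i\<le>d. (x i)\<^sup>2) = 0" by simp
    then show False using x unfolding sph_def by simp
  qed
  have "homeomorphism X (sph d) \<phi> \<psi>"
  proof (rule homeomorphismI)
    have contD: "continuous_on X D"
    proof (rule continuous_on_coordinatewise_then_product)
      fix i show "continuous_on X (\<lambda>f. D f i)"
        unfolding D_def by (cases "i \<le> d") (auto intro!: continuous_intros continuous_on_coordinate)
    qed
    have "continuous_on X (\<lambda>f. nrm d (D f))"
      by (rule continuous_on_compose2[OF continuous_on_nrm contD]) auto
    then show "continuous_on X \<phi>"
      unfolding \<phi>_def using less_imp_neq[OF D_pos]
      by (intro continuous_on_coordinatewise_then_product continuous_intros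
          continuous_on_product_then_coordinatewise[OF contD]) fastforce+
    have contm: "continuous_on (sph d) m"
      unfolding m_def by (rule continuous_on_Min) auto
    have contS: "continuous_on (sph d) S"
      unfolding S_def by (intro continuous_intros continuous_on_coordinate contm)
    show "continuous_on (sph d) \<psi>"
    proof (rule continuous_on_coordinatewise_then_product)
      fix v show "continuous_on (sph d) (\<lambda>x. \<psi> x v)"
        unfolding \<psi>_def using less_imp_neq[OF S_pos]
        by (cases "v \<in> T") (auto intro!: continuous_intros continuous_on_coordinate contm contS)
    qed
    show "\<phi> ` X \<subseteq> sph d"
      unfolding \<phi>_def using normalize_in_sph[OF D_eucl D_pos] by blast
    have \<psi>p: "\<psi> x (p i) = (x i - m x) / S x" if "i \<le> Suc d" for x i
      using that qp unfolding \<psi>_def T_def by auto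
    show "\<psi> ` sph d \<subseteq> X"
    proof clarify
      fix x assume x: "x \<in> sph d"
      obtain j where j: "j \<le> Suc d" "x j = m x" using m_ex by blast
      have "(\<Sum>i\<le>Suc d. \<psi> x (p i)) = (\<Sum>i\<le>Suc d. (x i - m x) / S x)"
        using \<psi>p by (intro sum.cong) auto
      also have "\<dots> = 1" using S_pos[OF x] unfolding S_def by (simp flip: sum_divide_distrib)
      finally have "(\<Sum>i\<le>Suc d. \<psi> x (p i)) = 1" .
      moreover have "\<psi> x (p j) = 0" using \<psi>p j by simp
      moreover have "0 \<le> \<psi> x v" for v
        using m_le[of "q v" x] pq(1)[of v] S_pos[OF x] unfolding \<psi>_def by simp
      moreover have "\<psi> x v = 0" if "v \<notin> T" for v using that unfolding \<psi>_def by simp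
      ultimately show "\<psi> x \<in> X" unfolding X_iff using j(1) by blast
    qed
    show "\<psi> (\<phi> f) = f" if f: "f \<in> X" for f
    proof -
      define c where "c = inverse (nrm d (D f))"
      have c: "c > 0" using D_pos[OF f] unfolding c_def by simp
      have \<phi>i: "\<phi> f i = c * (f (p i) - f (p (Suc d)))" if "i \<le> Suc d" for i
        using that unfolding \<phi>_def c_def D_def by (cases "i = Suc d") auto
      obtain j where j: "j \<le> Suc d" "f (p j) = 0" using f X_iff by blast
      have nn: "0 \<le> f v" for v using f X_iff by blast
      have mf: "m (\<phi> f) = c * (0 - f (p (Suc d)))"
        unfolding m_def
      proof (rule Min_eqI)
        show "c * (0 - f (p (Suc d))) \<in> \<phi> f ` {..Suc d}"
          using \<phi>i[OF j(1)] j by (metis atMost_iff imageI)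
        show "c * (0 - f (p (Suc d))) \<le> y" if "y \<in> \<phi> f ` {..Suc d}" for y
        proof -
          obtain i where "i \<le> Suc d" "y = \<phi> f i" using \<open>y \<in> \<phi> f ` {..Suc d}\<close> by auto
          then show ?thesis using \<phi>i nn[of "p i"] c by (simp only:) (intro mult_left_mono; simp)
        qed
      qed simp
      have diff: "\<phi> f i - m (\<phi> f) = c * f (p i)" if "i \<le> Suc d" for i
        using \<phi>i[OF that] mf by (simp add: algebra_simps)
      have "S (\<phi> f) = (\<Sum>i\<le>Suc d. c * f (p i))"
        unfolding S_def using diff by (intro sum.cong) auto
      also have "\<dots> = c" using f X_iff by (simp only: mult_1_right flip: sum_distrib_left)
      finally have "S (\<phi> f) = c" .
      then show ?thesis
        using diff pq c f X_iff unfolding \<psi>_def fun_eq_iff by auto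
    qed
    show "\<phi> (\<psi> x) = x" if x: "x \<in> sph d" for x
    proof -
      have D: "D (\<psi> x) i = inverse (S x) * x i" for i
      proof (cases "i \<le> d")
        case True
        then show ?thesis
          using \<psi>p[of i x] \<psi>p[of "Suc d" x] xSuc[OF x] unfolding D_def
          by (simp add: divide_inverse algebra_simps)
      next
        case False
        then show ?thesis using x unfolding D_def sph_def by simp
      qed
      have "nrm d (D (\<psi> x)) = inverse (S x)"
        using nrm_scale[of d "inverse (S x)" x] S_pos[OF x] x D unfolding sph_iff_nrm
        by (metis abs_of_nonneg less_imp_le mult_1_right positive_imp_inverse_positive ext)
      then show ?thesis using S_pos[OF x] unfolding \<phi>_def fun_eq_iff D by simp
    qed
  qed
  then show ?thesis unfolding X_def T_def homeomorphic_def by blast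
qed

section \<open>Flips computed on lists of facets\<close>

text \<open>Lists make the hypotheses of \<open>realization_flip\<close> decidable by evaluation;
  order and repetition do not affect the complex.\<close>

definition facet_complex :: "'a list list \<Rightarrow> 'a set set" where
  "facet_complex fs = generated_by (set ` set fs)"

definition flip_list :: "'a list \<Rightarrow> 'a list \<Rightarrow> 'a list list \<Rightarrow> 'a list list \<Rightarrow> 'a list list" where
  "flip_list A B Ls fs =
     filter (\<lambda>f. \<not> set A \<subseteq> set f) fs @ [B @ removeAll a A @ l. a \<leftarrow> A, l \<leftarrow> Ls]"

text \<open>Ensures that the facets dropped by \<open>flip_list\<close>, those containing
  \<open>A\<close>, are precisely the facets of \<open>A * \<partial>B * L\<close>, and that
  \<open>B\<close> is not yet a face.\<close>

definition flip_ok :: "'a list \<Rightarrow> 'a list \<Rightarrow> 'a list list \<Rightarrow> 'a list list \<Rightarrow> bool" where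
  "flip_ok A B Ls fs \<longleftrightarrow> A \<noteq> [] \<and> B \<noteq> [] \<and> (\<forall>a\<in>set A. a \<notin> set B) \<and>
     (\<forall>l\<in>set Ls. \<forall>x\<in>set l. x \<notin> set A \<and> x \<notin> set B) \<and>
     (\<forall>f\<in>set fs. if set A \<subseteq> set f
        then \<exists>b\<in>set B. \<exists>l\<in>set Ls. set f = set (A @ removeAll b B @ l)
        else \<not> set B \<subseteq> set f) \<and>
     (\<forall>b\<in>set B. \<forall>l\<in>set Ls. \<exists>f\<in>set fs. set f = set (A @ removeAll b B @ l))"

lemma indexed_family: "{f b l | b l. b \<in> B \<and> l \<in> L} = (\<Union>b\<in>B. f b ` L)"
  by blast

lemma facet_complex_flip:
  assumes "flip_ok A B Ls fs"
  shows "realization (facet_complex fs) homeomorphic realization (facet_complex (flip_list A B Ls fs))"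
proof -
  let ?R = "set ` {f \<in> set fs. \<not> set A \<subseteq> set f}" and ?L = "set ` set Ls"
  have ok: "A \<noteq> []" "B \<noteq> []" "set A \<inter> set B = {}"
    "\<And>l. l \<in> set Ls \<Longrightarrow> set l \<inter> (set A \<union> set B) = {}"
    "\<And>f. f \<in> set fs \<Longrightarrow> set A \<subseteq> set f \<Longrightarrow>
      \<exists>b\<in>set B. \<exists>l\<in>set Ls. set f = set A \<union> (set B - {b}) \<union> set l"
    "\<And>f. f \<in> set fs \<Longrightarrow> \<not> set A \<subseteq> set f \<Longrightarrow> \<not> set B \<subseteq> set f"
    "\<And>b l. b \<in> set B \<Longrightarrow> l \<in> set Ls \<Longrightarrow> \<exists>f\<in>set fs. set f = set A \<union> (set B - {b}) \<union> set l"
    using assms unfolding flip_ok_def by (auto simp: Un_assoc)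
  have "set ` set fs = flip_facets ?R (set A) (set B) ?L"
  proof
    show "set ` set fs \<subseteq> flip_facets ?R (set A) (set B) ?L"
    proof clarify
      fix f assume f: "f \<in> set fs"
      show "set f \<in> flip_facets ?R (set A) (set B) ?L"
      proof (cases "set A \<subseteq> set f")
        case True
        then show ?thesis using ok(5)[OF f] unfolding flip_facets_def by blast
      next
        case False
        then show ?thesis using f unfolding flip_facets_def by blast
      qed
    qed
    show "flip_facets ?R (set A) (set B) ?L \<subseteq> set ` set fs"
    proof
      fix s assume "s \<in> flip_facets ?R (set A) (set B) ?L"
      then consider "s \<in> set ` set fs"
        | b l where "s = set A \<union> (set B - {b}) \<union> set l" "b \<in> set B" "l \<in> set Ls"
        unfolding flip_facets_def by blast
      then show "s \<in> set ` set fs"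
      proof cases
        case 2
        then obtain f where "f \<in> set fs" "s = set f" using ok(7)[OF 2(2,3)] by auto
        then show ?thesis by blast
      qed
    qed
  qed
  moreover have "set ` set (flip_list A B Ls fs) = flip_facets ?R (set B) (set A) ?L"
  proof -
    have "set ` set [B @ removeAll a A @ l. a \<leftarrow> A, l \<leftarrow> Ls]
        = {set B \<union> (set A - {b}) \<union> l | b l. b \<in> set A \<and> l \<in> ?L}"
    proof -
      have "set ` set [B @ removeAll a A @ l. a \<leftarrow> A, l \<leftarrow> Ls]
          = (\<Union>a\<in>set A. (\<lambda>l. set B \<union> (set A - {a}) \<union> set l) ` set Ls)"
        by (simp add: image_UN image_image Un_assoc)
      also have "\<dots> = (\<Union>a\<in>set A. (\<lambda>l. set B \<union> (set A - {a}) \<union> l) ` ?L)"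
        by (simp add: image_image)
      finally show ?thesis
        unfolding indexed_family[of "\<lambda>a l. set B \<union> (set A - {a}) \<union> l"] .
    qed
    then show ?thesis unfolding flip_list_def flip_facets_def by (simp only: set_append image_Un set_filter)
  qed
  moreover have "realization (generated_by (flip_facets ?R (set A) (set B) ?L)) homeomorphic
      realization (generated_by (flip_facets ?R (set B) (set A) ?L))"
  proof (rule realization_flip)
    show "finite l \<and> l \<inter> (set A \<union> set B) = {}" if "l \<in> ?L" for l using ok(4) that by blast
    show "finite r \<and> \<not> set A \<subseteq> r \<and> \<not> set B \<subseteq> r" if "r \<in> ?R" for r using ok(6) that by blast
  qed (use ok(1-3) in auto)
  ultimately show ?thesis unfolding facet_complex_def by simp
qed

fun flips_ok :: "('a list \<times> 'a list \<times> 'a list list) list \<Rightarrow> 'a list list \<Rightarrow> bool" where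
  "flips_ok [] fs = True"
| "flips_ok ((A, B, Ls) # ms) fs = (flip_ok A B Ls fs \<and> flips_ok ms (flip_list A B Ls fs))"

fun flips :: "('a list \<times> 'a list \<times> 'a list list) list \<Rightarrow> 'a list list \<Rightarrow> 'a list list" where
  "flips [] fs = fs"
| "flips ((A, B, Ls) # ms) fs = flips ms (flip_list A B Ls fs)"

lemma facet_complex_flips:
  "flips_ok ms fs \<Longrightarrow> realization (facet_complex fs) homeomorphic realization (facet_complex (flips ms fs))"
proof (induction ms fs rule: flips_ok.induct)
  case (1 fs)
  then show ?case by (simp add: homeomorphic_refl)
next
  case (2 A B Ls ms fs)
  then have "flip_ok A B Ls fs" "flips_ok ms (flip_list A B Ls fs)" by simp_all
  from facet_complex_flip[OF this(1)] 2(1)[OF this(2)] show ?case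
    by (simp only: flips.simps) (rule homeomorphic_trans)
qed

lemma facet_complex_mono:
  assumes "\<forall>f\<in>set fs. \<exists>g\<in>set gs. set f \<subseteq> set g"
  shows "facet_complex fs \<subseteq> facet_complex gs"
proof
  fix G assume "G \<in> facet_complex fs"
  then obtain f where f: "f \<in> set fs" "G \<subseteq> set f" unfolding facet_complex_def generated_by_def by blast
  then obtain g where "g \<in> set gs" "G \<subseteq> set g" using assms by blast
  then show "G \<in> facet_complex gs" unfolding facet_complex_def by (blast intro: generated_byI)
qed

lemma simplex_boundary_list:
  assumes "distinct vs" "length vs = d + 2"
  shows "realization (facet_complex (map (\<lambda>v. removeAll v vs) vs)) homeomorphic sph d"
proof -
  have len: "{..Suc d} = {..<length vs}" using assms(2) by auto
  have inj: "inj_on ((!) vs) {..Suc d}"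
    using assms(1) unfolding len by (simp add: inj_on_nth)
  have img: "(!) vs ` {..Suc d} = set vs" unfolding len by (auto simp: set_conv_nth)
  have "(\<lambda>i. (!) vs ` {..Suc d} - {vs ! i}) ` {..Suc d} = (\<lambda>v. set vs - {v}) ` ((!) vs ` {..Suc d})"
    by (simp only: image_image) (simp only: img)
  also have "\<dots> = set ` set (map (\<lambda>v. removeAll v vs) vs)"
    unfolding img by (simp add: image_image)
  finally show ?thesis
    using realization_simplex_boundary[OF inj] unfolding facet_complex_def by simp
qed

text \<open>Flipping \<open>a\<close> away replaces its two edges by the edge from \<open>b\<close>
  to \<open>d\<close>, which leaves the boundary of a triangle.\<close>

lemma four_cycle_circle:
  assumes "distinct [a, b, c, d]"
  shows "realization (generated_by {{a, b}, {b, c}, {c, d}, {d, a}}) homeomorphic sph 1"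
proof -
  let ?fs = "[[a, b], [b, c], [c, d], [d, a]]"
  have ok: "flip_ok [a] [b, d] [[]] ?fs"
    using assms unfolding flip_ok_def by auto
  have "facet_complex (flip_list [a] [b, d] [[]] ?fs) = facet_complex (map (\<lambda>v. removeAll v [b, c, d]) [b, c, d])"
    using assms unfolding facet_complex_def flip_list_def by (auto simp: insert_commute)
  moreover have "realization (facet_complex (map (\<lambda>v. removeAll v [b, c, d]) [b, c, d])) homeomorphic sph 1"
    using assms by (intro simplex_boundary_list) auto
  moreover have "facet_complex ?fs = generated_by {{a, b}, {b, c}, {c, d}, {d, a}}"
    unfolding facet_complex_def by simp
  ultimately show ?thesis using homeomorphic_trans[OF facet_complex_flip[OF ok]] by simp
qed

subsection \<open>The complex on twelve vertices is a sphere\<close>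

definition join_list :: "'a list list \<Rightarrow> 'a list list \<Rightarrow> 'a list list" where
  "join_list fs gs = [f @ g. f \<leftarrow> fs, g \<leftarrow> gs]"

lemma join_facet_complex:
  "Defs.join (facet_complex fs) (facet_complex gs) = facet_complex (join_list fs gs)"
proof
  show "Defs.join (facet_complex fs) (facet_complex gs) \<subseteq> facet_complex (join_list fs gs)"
  proof
    fix H assume "H \<in> Defs.join (facet_complex fs) (facet_complex gs)"
    then obtain F G where "H = F \<union> G" "F \<in> facet_complex fs" "G \<in> facet_complex gs"
      unfolding Defs.join_def by blast
    then obtain f g where fg: "f \<in> set fs" "F \<subseteq> set f" "g \<in> set gs" "G \<subseteq> set g"
      unfolding facet_complex_def generated_by_def by blast
    have "H \<subseteq> set (f @ g)" using fg \<open>H = F \<union> G\<close> by auto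
    moreover have "f @ g \<in> set (join_list fs gs)" using fg unfolding join_list_def by auto
    ultimately show "H \<in> facet_complex (join_list fs gs)"
      unfolding facet_complex_def by (blast intro: generated_byI)
  qed
  show "facet_complex (join_list fs gs) \<subseteq> Defs.join (facet_complex fs) (facet_complex gs)"
  proof
    fix H assume "H \<in> facet_complex (join_list fs gs)"
    then obtain f g where fg: "f \<in> set fs" "g \<in> set gs" "H \<subseteq> set f \<union> set g"
      unfolding facet_complex_def generated_by_def join_list_def by auto
    then have "H = (H \<inter> set f) \<union> (H \<inter> set g)" by blast
    then show "H \<in> Defs.join (facet_complex fs) (facet_complex gs)"
      using fg unfolding Defs.join_def facet_complex_def generated_by_def by blast
  qed
qed

definition diamond_list :: "'a \<times> 'a \<times> 'a \<Rightarrow> 'a \<times> 'a \<times> 'a \<Rightarrow> 'a list list" where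
  "diamond_list = (\<lambda>(p1, p2, p3) (q1, q2, q3).
     join_list (join_list [[p1], [q1]] [[p2], [q2]]) [[p3], [q3]])"

lemma pair_facet_complex: "generated_by {{p}, {q}} = facet_complex [[p], [q]]"
  unfolding facet_complex_def by simp

lemma diamond_facet_complex: "diamond p q = facet_complex (diamond_list p q)"
  by (cases p; cases q) (simp add: diamond_list_def pair_facet_complex join_facet_complex)

lemma cone_facet_complex: "Defs.cone v (facet_complex fs) = facet_complex (join_list fs [[v]])"
proof -
  have "generated_by {{v}} = facet_complex [[v]]" unfolding facet_complex_def by simp
  then show ?thesis unfolding cone_def by (simp add: join_facet_complex)
qed

lemma Un_facet_complex: "facet_complex fs \<union> facet_complex gs = facet_complex (fs @ gs)"
  unfolding facet_complex_def generated_by_def by auto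

definition delta_facets :: "vertex12 list list" where
  "delta_facets =
     join_list (diamond_list (X1, X2, X3) (Y1, Y2, Y3)) [[V1]] @
     join_list (diamond_list (Y1, Y2, Y3) (Z1, Z2, Z3)) [[V2]] @
     join_list (diamond_list (X1, X2, X3) (Z3, Z1, Z2)) [[V3]] @
     [[X1, X2, Y3, Z2], [X2, Y1, Y3, Z2], [X2, Y1, Z2, Z3],
      [X2, X3, Y1, Z3], [X3, Y1, Y2, Z3], [X3, Y2, Z1, Z3],
      [X1, X3, Y2, Z1], [X1, Y2, Y3, Z1], [X1, Y3, Z1, Z2]]"

lemma Delta_facets: "Delta_12_33 = facet_complex delta_facets"
proof -
  have "Gamma2 = facet_complex
    [[X1, X2, Y3, Z2], [X2, Y1, Y3, Z2], [X2, Y1, Z2, Z3],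
     [X2, X3, Y1, Z3], [X3, Y1, Y2, Z3], [X3, Y2, Z1, Z3],
     [X1, X3, Y2, Z1], [X1, Y2, Y3, Z1], [X1, Y3, Z1, Z2]]"
    unfolding Gamma2_def facet_complex_def by simp
  note Gamma2 = this
  show ?thesis
    unfolding Delta_12_33_def Gamma1_def delta_facets_def Gamma2
    by (simp only: diamond_facet_complex cone_facet_complex Un_facet_complex append_assoc)
qed

text \<open>The first three flips replace the cones with apexes \<open>v\<^sub>2\<close>, \<open>v\<^sub>3\<close>, \<open>v\<^sub>1\<close> by the four tetrahedra around
  a diagonal of the octahedron; the sequence was found by a random search.\<close>

definition delta_flips :: "(vertex12 list \<times> vertex12 list \<times> vertex12 list list) list" where
  "delta_flips =
    [([V2], [Y3, Z3], [[Y2, Z1], [Z1, Z2], [Y1, Y2], [Y1, Z2]]),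
     ([V3], [X1, Z3], [[X2, Z2], [Z1, Z2], [X2, X3], [X3, Z1]]),
     ([V1], [X1, Y1], [[Y2, Y3], [X3, Y2], [X2, X3], [X2, Y3]]),
     ([Y2], [Y1, Z1], [[X3, Z3], [Y3, Z3], [X1, Y3], [X1, X3]]),
     ([X1], [X2, Z1], [[Y3, Z2], [X3, Z3], [Y1, Y3], [X3, Y1], [Z2, Z3]]),
     ([Z2], [X2, Y3, Z3], [[Y1], [Z1]]),
     ([Y3], [X2, Y1, Z1, Z3], [[]])]"

definition same_facets :: "'a list list \<Rightarrow> 'a list list \<Rightarrow> bool" where
  "same_facets fs gs \<longleftrightarrow> (\<forall>f\<in>set fs. \<exists>g\<in>set gs. set f \<subseteq> set g) \<and> (\<forall>f\<in>set gs. \<exists>g\<in>set fs. set f \<subseteq> set g)"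

lemma delta_flips_ok: "flips_ok delta_flips delta_facets"
  by code_simp

text \<open>In every move of \<open>delta_flips\<close> the part \<open>A\<close> is a single
  vertex, so the move deletes this vertex. Seven deletions take twelve vertices down to
  five.\<close>

lemma delta_flips_result:
  "same_facets (flips delta_flips delta_facets)
     (map (\<lambda>v. removeAll v [X2, X3, Y1, Z1, Z3]) [X2, X3, Y1, Z1, Z3])"
  by code_simp

lemma Delta_sphere: "simplicial_sphere 3 Delta_12_33"
proof -
  let ?vs = "[X2, X3, Y1, Z1, Z3]"
  have "facet_complex (flips delta_flips delta_facets) = facet_complex (map (\<lambda>v. removeAll v ?vs) ?vs)"
    using delta_flips_result facet_complex_mono unfolding same_facets_def by (metis subset_antisym)
  moreover have "realization (facet_complex (map (\<lambda>v. removeAll v ?vs) ?vs)) homeomorphic sph 3"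
    by (rule simplex_boundary_list) auto
  ultimately have "realization Delta_12_33 homeomorphic sph 3"
    using homeomorphic_trans[OF facet_complex_flips[OF delta_flips_ok]] unfolding Delta_facets by simp
  moreover have "abstract_complex Delta_12_33"
  proof -
    have "finite (vertices Delta_12_33)"
      unfolding Delta_facets facet_complex_def generated_by_def vertices_def
      by (rule finite_subset[of _ "\<Union>(set ` set delta_facets)"]) auto
    moreover have "{} \<in> facet_complex delta_facets"
      unfolding facet_complex_def by (rule generated_byI[of "set (last delta_facets)"]) (auto simp: delta_facets_def)
    ultimately show ?thesis
      unfolding abstract_complex_def Delta_facets facet_complex_def generated_by_def by blast
  qed
  ultimately show ?thesis unfolding simplicial_sphere_iff by blast
qed

subsection \<open>Connectivity and separation\<close>

text \<open>The points with positive weight somewhere in a given vertex set form an open set. If the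
  vertices off \<open>W\<close> split without an edge across, two such sets cover the complement and
  do not meet in it, because no face has vertices in both parts.\<close>

lemma complement_disconnected:
  assumes D: "abstract_complex \<Delta>"
    and conn: "connected (realization \<Delta> - {f. {v. f v \<noteq> 0} \<subseteq> W})"
  shows "connected_on (edge \<Delta>) (vertices \<Delta> - W)"
proof (rule ccontr)
  assume "\<not> ?thesis"
  then obtain P Q where PQ: "P \<union> Q = vertices \<Delta> - W" "P \<inter> Q = {}" "P \<noteq> {}" "Q \<noteq> {}"
    and no: "\<And>p q. p \<in> P \<Longrightarrow> q \<in> Q \<Longrightarrow> \<not> edge \<Delta> p q"
    by (rule not_connected_onE) (rule that)
  let ?S = "realization \<Delta> - {f. {v. f v \<noteq> 0} \<subseteq> W}"
  define A where "A R = (\<Union>v\<in>R. {f::'a \<Rightarrow> real. 0 < f v})" for R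
  have openA: "open (A R)" for R
    unfolding A_def by (intro open_UN ballI open_Collect_less continuous_on_const continuous_on_coordinate)
  have nn: "0 \<le> f v" and face: "{v. f v \<noteq> 0} \<in> \<Delta>" if "f \<in> ?S" for f v
    using that by (auto simp: realization_iff)
  have cover: "?S \<subseteq> A P \<union> A Q"
  proof
    fix f assume f: "f \<in> ?S"
    then obtain v where v: "f v \<noteq> 0" "v \<notin> W" by blast
    then have "v \<in> P \<union> Q" using face[OF f] PQ(1) unfolding vertices_def by blast
    moreover have "0 < f v" using nn[OF f, of v] v(1) by simp
    ultimately show "f \<in> A P \<union> A Q" unfolding A_def by blast
  qed
  have disj: "A P \<inter> A Q \<inter> ?S = {}"
  proof (rule ccontr)
    assume "A P \<inter> A Q \<inter> ?S \<noteq> {}"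
    then obtain f p q where f: "f \<in> ?S" "p \<in> P" "0 < f p" "q \<in> Q" "0 < f q"
      unfolding A_def by blast
    then have "{p, q} \<subseteq> {v. f v \<noteq> 0}" by auto
    then have "{p, q} \<in> \<Delta>" using complex_subset[OF D face[OF f(1)]] by blast
    then show False using no[OF f(2,4)] PQ(2) f(2,4) unfolding edge_def by blast
  qed
  have meets: "A R \<inter> ?S \<noteq> {}" if R: "R \<noteq> {}" "R \<subseteq> vertices \<Delta> - W" for R
  proof -
    obtain v where v: "v \<in> R" using R(1) by blast
    then have "bary {v} \<in> realization \<Delta>"
      using R(2) vertex_face[OF D] bary_in_realization[OF D] by blast
    moreover have "{x. bary {v} x \<noteq> 0} = {v}" by (rule supp_bary) simp
    ultimately have "bary {v} \<in> ?S" using R(2) v by auto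
    moreover have "bary {v} \<in> A R" using v unfolding A_def bary_def by auto
    ultimately show ?thesis by blast
  qed
  show False
    using connectedD[OF conn openA openA disj cover] meets[of P] meets[of Q] PQ by blast
qed

text \<open>A separation of the complement colours the vertices off \<open>W\<close>. Segments
  within a face between points of the complement stay in it, so colours agree along edges; and every
  point shares its colour with a vertex of its support, so both colours occur.\<close>

lemma complement_connected:
  assumes D: "abstract_complex \<Delta>"
    and conn: "connected_on (edge \<Delta>) (vertices \<Delta> - W)"
  shows "connected (realization \<Delta> - {f. {v. f v \<noteq> 0} \<subseteq> W})"
proof (rule ccontr)
  let ?S = "realization \<Delta> - {f. {v. f v \<noteq> 0} \<subseteq> W}"
  assume "\<not> connected ?S"
  then obtain A B where AB: "open A" "open B" "?S \<subseteq> A \<union> B" "A \<inter> B \<inter> ?S = {}"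
    "A \<inter> ?S \<noteq> {}" "B \<inter> ?S \<noteq> {}"
    unfolding connected_def by blast
  have seg_S: "seg f g ` {0..1} \<subseteq> ?S"
    if "f \<in> ?S" "g \<in> ?S" "{v. f v \<noteq> 0} \<union> {v. g v \<noteq> 0} \<in> \<Delta>" for f g
  proof clarify
    fix t :: real assume t: "t \<in> {0..1}"
    have "seg f g t \<in> realization \<Delta>"
      using that t by (intro seg_in_realization[OF D]) auto
    moreover have "\<not> {v. seg f g t v \<noteq> 0} \<subseteq> W"
    proof (cases "t = 0 \<or> t = 1")
      case True
      then show ?thesis using that by auto
    next
      case False
      then have "{v. seg f g t v \<noteq> 0} = {v. f v \<noteq> 0} \<union> {v. g v \<noteq> 0}"
        using t that by (intro supp_seg) (auto simp: realization_iff)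
      then show ?thesis using that by auto
    qed
    ultimately show "seg f g t \<in> ?S" by simp
  qed
  have same: False
    if fg: "f \<in> ?S" "g \<in> ?S" "{v. f v \<noteq> 0} \<union> {v. g v \<noteq> 0} \<in> \<Delta>" and "f \<in> A" "g \<in> B" for f g
  proof -
    have "connected (seg f g ` {0..1})"
      by (intro connected_continuous_image continuous_on_seg connected_Icc)
    moreover have "f \<in> seg f g ` {0..1}" "g \<in> seg f g ` {0..1}"
      using seg_0[of f g] seg_1[of f g] by (metis atLeastAtMost_iff imageI order_refl zero_le_one)+
    ultimately show False
      using connectedD[OF _ AB(1,2), of "seg f g ` {0..1}"] seg_S[OF fg] AB(3,4) \<open>f \<in> A\<close> \<open>g \<in> B\<close>
      by blast
  qed
  have bS: "bary {v} \<in> ?S" if "v \<in> vertices \<Delta> - W" for v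
  proof -
    have "bary {v} \<in> realization \<Delta>"
      using that vertex_face[OF D] bary_in_realization[OF D] by blast
    moreover have "{x. bary {v} x \<noteq> 0} = {v}" by (rule supp_bary) simp
    ultimately show ?thesis using that by auto
  qed
  have supp_b: "{x. bary {v} x \<noteq> 0} = {v}" for v :: 'a by (rule supp_bary) simp
  define P where "P = {v \<in> vertices \<Delta> - W. bary {v} \<in> A}"
  define Q where "Q = {v \<in> vertices \<Delta> - W. bary {v} \<in> B}"
  have near: "\<exists>v \<in> vertices \<Delta> - W. {x. f x \<noteq> 0} \<union> {x. bary {v} x \<noteq> 0} \<in> \<Delta>" if f: "f \<in> ?S" for f
  proof -
    obtain v where v: "f v \<noteq> 0" "v \<notin> W" using f by blast
    have "f \<in> realization \<Delta>" using f by blast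
    then have "{x. f x \<noteq> 0} \<in> \<Delta>" unfolding realization_iff by blast
    moreover have "{x. f x \<noteq> 0} \<union> {v} = {x. f x \<noteq> 0}" using v by auto
    moreover have "v \<in> vertices \<Delta>"
      using calculation(1) v(1) unfolding vertices_def by blast
    ultimately show ?thesis using v(2) unfolding supp_b by (metis DiffI)
  qed
  have "P \<noteq> {}"
  proof -
    obtain f where f: "f \<in> A" "f \<in> ?S" using AB(5) by blast
    obtain v where v: "v \<in> vertices \<Delta> - W" "{x. f x \<noteq> 0} \<union> {x. bary {v} x \<noteq> 0} \<in> \<Delta>"
      using near[OF f(2)] by blast
    then have "bary {v} \<notin> B" using same[OF f(2) bS _ f(1)] by blast
    then show ?thesis using AB(3) bS[OF v(1)] v(1) unfolding P_def by blast
  qed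
  moreover have "Q \<noteq> {}"
  proof -
    obtain f where f: "f \<in> B" "f \<in> ?S" using AB(6) by blast
    obtain v where v: "v \<in> vertices \<Delta> - W" "{x. f x \<noteq> 0} \<union> {x. bary {v} x \<noteq> 0} \<in> \<Delta>"
      using near[OF f(2)] by blast
    then have "bary {v} \<notin> A" using same[OF bS f(2) _ _ f(1)] by (metis Un_commute)
    then show ?thesis using AB(3) bS[OF v(1)] v(1) unfolding Q_def by blast
  qed
  moreover have "P \<union> Q = vertices \<Delta> - W" using AB(3) bS unfolding P_def Q_def by blast
  moreover have "P \<inter> Q = {}" using AB(4) bS unfolding P_def Q_def by blast
  ultimately obtain p q where pq: "p \<in> P" "q \<in> Q" "edge \<Delta> p q"
    using conn unfolding connected_on_def by blast
  have "{x. bary {p} x \<noteq> 0} \<union> {x. bary {q} x \<noteq> 0} \<in> \<Delta>"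
    using pq(3) unfolding supp_b edge_def by (simp add: insert_commute)
  then show False using same[OF bS bS] pq unfolding P_def Q_def by blast
qed

section \<open>Circles and 2-spheres\<close>

text \<open>Passage to the unit sphere of a Euclidean space type, in which connectedness, punctured
  spheres and Jordan separation are treated.\<close>

lemma sph_homeomorphic_sphere:
  assumes "DIM('n::euclidean_space) = Suc d"
  shows "sph d homeomorphic (sphere 0 1 :: 'n set)"
proof -
  obtain f :: "(nat \<Rightarrow> real) \<Rightarrow> 'n" and g
    where "homeomorphic_maps (nsphere (Suc d - 1)) (top_of_set (sphere 0 1 \<inter> span Basis)) f g"
    using homeomorphic_maps_nsphere_euclidean_sphere[of "Basis :: 'n set" "Suc d"]
      independent_Basis orthogonal_Basis assms norm_Basis by (metis nat.simps(3))
  then show ?thesis unfolding nsphere_eq homeomorphic_def by auto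
qed

lemma circle_connected:
  assumes "simplicial_sphere 1 \<Delta>"
  shows "connected_on (edge \<Delta>) (vertices \<Delta>)"
proof -
  have D: "abstract_complex \<Delta>" "realization \<Delta> homeomorphic sph 1"
    using assms unfolding simplicial_sphere_iff by auto
  have "sph 1 homeomorphic (sphere 0 1 :: complex set)" by (rule sph_homeomorphic_sphere) simp
  from homeomorphic_trans[OF D(2) this]
  have "realization \<Delta> homeomorphic (sphere 0 1 :: complex set)" .
  moreover have "connected (sphere 0 1 :: complex set)" by (rule connected_sphere) simp
  ultimately have "connected (realization \<Delta>)" using homeomorphic_connectedness by blast
  moreover have "realization \<Delta> \<inter> {f. {v. f v \<noteq> 0} \<subseteq> {}} = {}"
    unfolding realization_def by auto
  ultimately have "connected (realization \<Delta> - {f. {v. f v \<noteq> 0} \<subseteq> {}})"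
    by (metis Diff_triv)
  then show ?thesis using complement_disconnected[OF D(1)] by (metis Diff_empty)
qed

text \<open>Stereographic projection onto a plane in three-space, which is then identified with the
  complex numbers.\<close>

lemma two_sphere_minus_point:
  fixes X :: "('a \<Rightarrow> real) set"
  assumes X: "X homeomorphic sph 2" and b: "b \<in> X"
  shows "(X - {b}) homeomorphic (UNIV :: complex set)"
proof -
  have "sph 2 homeomorphic (sphere 0 1 :: (real^3) set)" by (rule sph_homeomorphic_sphere) simp
  from homeomorphic_trans[OF X this]
  have "X homeomorphic (sphere 0 1 :: (real^3) set)" .
  then obtain h k where hk: "homeomorphism X (sphere 0 1 :: (real^3) set) h k"
    using homeomorphic_def by blast
  have hb: "h b \<in> sphere 0 1" using hk b homeomorphism_image1 by blast
  have "h ` (X - {b}) = sphere 0 1 - {h b}"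
  proof -
    have "inj_on h X" using hk by (metis homeomorphism_apply1 inj_on_inverseI)
    then have "h ` (X - {b}) = h ` X - h ` {b}" using b by (intro inj_on_image_set_diff[of h X]) auto
    then show ?thesis using hk homeomorphism_image1 by force
  qed
  then have "homeomorphism (X - {b}) (sphere 0 1 - {h b}) h k"
    using homeomorphism_of_subsets[OF hk, of "X - {b}" "sphere 0 1 - {h b}"] by auto
  then have 1: "(X - {b}) homeomorphic (sphere 0 1 - {h b})" unfolding homeomorphic_def by blast
  have 2: "(sphere 0 1 - {h b}) homeomorphic {x :: real^3. axis 1 1 \<bullet> x = 0}"
    by (rule homeomorphic_punctured_sphere_hyperplane) (use hb in \<open>auto simp: axis_eq_0_iff\<close>)
  have 3: "{x :: real^3. axis 1 1 \<bullet> x = 0} homeomorphic (UNIV :: complex set)"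
    by (rule homeomorphic_affine_sets) (auto simp: affine_hyperplane aff_dim_hyperplane axis_eq_0_iff)
  show ?thesis by (rule homeomorphic_trans[OF homeomorphic_trans[OF 1 2] 3])
qed

lemma sphere_minus_vertex_connected:
  assumes S: "simplicial_sphere 2 \<Delta>" and v: "v \<in> vertices \<Delta>"
  shows "connected_on (edge \<Delta>) (vertices \<Delta> - {v})"
proof (rule complement_disconnected)
  have D: "abstract_complex \<Delta>" "realization \<Delta> homeomorphic sph 2"
    using S unfolding simplicial_sphere_iff by auto
  then show "abstract_complex \<Delta>" by simp
  have b: "bary {v} \<in> realization \<Delta>"
    using bary_in_realization[OF D(1) vertex_face[OF D(1) v]] by simp
  have "realization \<Delta> - {bary {v}} = realization \<Delta> - {f. {w. f w \<noteq> 0} \<subseteq> {v}}"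
  proof -
    have "f = bary {v}" if f: "f \<in> realization \<Delta>" "{w. f w \<noteq> 0} \<subseteq> {v}" for f
    proof -
      have "sum f {v} = 1" using realization_sum[OF f(1) _ f(2)] by simp
      then show ?thesis using f(2) by (auto simp: bary_def fun_eq_iff)
    qed
    moreover have "{w. bary {v} w \<noteq> 0} \<subseteq> {v}" by (simp add: supp_bary)
    ultimately show ?thesis by blast
  qed
  moreover have "connected (realization \<Delta> - {bary {v}})"
    using homeomorphic_connectedness[OF two_sphere_minus_point[OF D(2) b]] connected_UNIV by blast
  ultimately show "connected (realization \<Delta> - {f. {w. f w \<noteq> 0} \<subseteq> {v}})" by simp
qed

text \<open>Projection from \<open>b\<close>, a point off the circle, carries \<open>K\<close> to a
  Jordan curve in the plane. The inside of this curve is open, and it is closed in the complement of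
  \<open>K\<close>, since its closure is compact and so stays closed when carried back to the
  sphere. It is not empty, and it misses \<open>b\<close>, the point at infinity.\<close>

lemma circle_separates_two_sphere:
  fixes X :: "('a \<Rightarrow> real) set"
  assumes X: "X homeomorphic sph 2" and K: "K \<subseteq> X" "K homeomorphic sph 1"
    and b: "b \<in> X" "b \<notin> K"
  shows "\<not> connected (X - K)"
proof
  assume conn: "connected (X - K)"
  obtain h k where hk: "homeomorphism (X - {b}) (UNIV :: complex set) h k"
    using two_sphere_minus_point[OF X b(1)] homeomorphic_def by blast
  have KX: "K \<subseteq> X - {b}" using K(1) b(2) by blast
  have "homeomorphism K (h ` K) h k"
    by (rule homeomorphism_of_subsets[OF hk KX]) auto
  then have "K homeomorphic h ` K" unfolding homeomorphic_def by blast
  then have 1: "h ` K homeomorphic K" by (rule homeomorphic_sym[THEN iffD1])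
  have 2: "sph 1 homeomorphic (sphere 0 1 :: complex set)" by (rule sph_homeomorphic_sphere) simp
  have hK: "h ` K homeomorphic (sphere 0 1 :: complex set)"
    by (rule homeomorphic_trans[OF homeomorphic_trans[OF 1 K(2)] 2])
  have compK: "compact (h ` K)" using homeomorphic_compactness[OF hK] compact_sphere by simp
  \<comment> \<open>Jordan-Brouwer separation is used in the form that the complement is
    disconnected; as the outside is connected, there must be an inside.\<close>
  have "\<not> connected (- (h ` K))" using Jordan_Brouwer_separation[OF hK] by simp
  moreover have "connected (outside (h ` K))"
    using compK compact_imp_bounded by (intro connected_outside) auto
  ultimately have "inside (h ` K) \<noteq> {}"
    by (metis inside_Un_outside sup_bot_left)
  let ?I = "inside (h ` K)"
  have kX: "k z \<in> X - {b}" "h (k z) = z" for z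
    using homeomorphism_image2[OF hk] homeomorphism_apply2[OF hk] by blast+
  have contk: "continuous_on UNIV k" using hk homeomorphism_cont2 by blast
  have openI: "open ?I" using compK compact_imp_closed open_inside by blast
  have clI: "closure ?I \<subseteq> h ` K \<union> ?I"
    using closure_inside_subset compK compact_imp_closed by blast
  have "bounded ?I" using bounded_inside compK compact_imp_bounded by blast
  then have "compact (closure ?I)" by simp
  then have "compact (k ` closure ?I)"
    using contk compact_continuous_image continuous_on_subset by blast
  have closedin_kI: "closedin (top_of_set X) (k ` closure ?I)"
  proof -
    have kX': "k ` closure ?I \<subseteq> X" using kX(1) by blast
    have "sph 2 homeomorphic (sphere 0 1 :: (real^3) set)" by (rule sph_homeomorphic_sphere) simp
    then obtain H H' where H: "homeomorphism X (sphere 0 1 :: (real^3) set) H H'"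
      using homeomorphic_trans[OF X] homeomorphic_def by metis
    have "compact (H ` k ` closure ?I)"
      by (rule compact_continuous_image[OF continuous_on_subset[OF homeomorphism_cont1[OF H] kX']])
        (rule \<open>compact (k ` closure ?I)\<close>)
    then have "closedin (top_of_set X) (X \<inter> H -` (H ` k ` closure ?I))"
      by (intro continuous_closedin_preimage homeomorphism_cont1[OF H] compact_imp_closed)
    moreover have "X \<inter> H -` (H ` k ` closure ?I) = k ` closure ?I"
    proof
      show "X \<inter> H -` (H ` k ` closure ?I) \<subseteq> k ` closure ?I"
      proof clarify
        fix x z assume "x \<in> X" "z \<in> closure ?I" "H x = H (k z)"
        moreover have "k z \<in> X" using kX(1) by blast
        ultimately have "x = k z" using homeomorphism_apply1[OF H] by metis
        then show "x \<in> k ` closure ?I" using \<open>z \<in> closure ?I\<close> by blast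
      qed
    qed (use kX' in auto)
    ultimately show ?thesis by simp
  qed
  have kI: "k ` ?I \<subseteq> X - K"
  proof clarify
    fix z assume z: "z \<in> ?I"
    have "k z \<notin> K"
    proof
      assume "k z \<in> K"
      then have "z \<in> h ` K" using kX(2) by (metis imageI)
      then show False using z inside_no_overlap by blast
    qed
    then show "k z \<in> X - K" using kX(1)[of z] by blast
  qed
  have "openin (top_of_set (X - K)) (k ` ?I)"
  proof -
    have "openin (top_of_set (X - {b})) ((X - {b}) \<inter> h -` ?I)"
      using hk openI by (intro continuous_openin_preimage_gen homeomorphism_cont1)
    moreover have "(X - {b}) \<inter> h -` ?I = k ` ?I"
    proof
      show "k ` ?I \<subseteq> (X - {b}) \<inter> h -` ?I" using kX by auto
      show "(X - {b}) \<inter> h -` ?I \<subseteq> k ` ?I"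
      proof
        fix x assume x: "x \<in> (X - {b}) \<inter> h -` ?I"
        then have "k (h x) = x" using homeomorphism_apply1[OF hk] by blast
        then show "x \<in> k ` ?I" using x by (metis IntE imageI vimageD)
      qed
    qed
    ultimately obtain T where T: "open T" "k ` ?I = (X - {b}) \<inter> T" unfolding openin_open by auto
    then have "k ` ?I = (X - K) \<inter> (T - {b})" using kI by blast
    moreover have "open (T - {b})"
    proof -
      have "closed (\<Inter>v. {f. f v = b v})"
        by (intro closed_INT ballI closed_Collect_eq continuous_on_coordinate continuous_on_const)
      moreover have "(\<Inter>v. {f. f v = b v}) = {b}" by auto
      ultimately show ?thesis using T(1) open_Diff by metis
    qed
    ultimately show ?thesis unfolding openin_open by blast
  qed
  moreover have "closedin (top_of_set (X - K)) (k ` ?I)"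
  proof -
    have "k ` ?I = (X - K) \<inter> k ` closure ?I"
    proof
      show "k ` ?I \<subseteq> (X - K) \<inter> k ` closure ?I" using kI closure_subset by blast
      show "(X - K) \<inter> k ` closure ?I \<subseteq> k ` ?I"
      proof clarify
        fix z assume z: "z \<in> closure ?I" "k z \<notin> K"
        have "z \<notin> h ` K"
        proof
          assume "z \<in> h ` K"
          then obtain y where "y \<in> K" "z = h y" by blast
          then have "k z = y" using homeomorphism_apply1[OF hk, of y] KX by auto
          then show False using z(2) \<open>y \<in> K\<close> by simp
        qed
        then show "k z \<in> k ` ?I" using clI z(1) by blast
      qed
    qed
    moreover obtain T where T: "closed T" "k ` closure ?I = X \<inter> T"
      using closedin_kI unfolding closedin_closed by blast
    ultimately have "k ` ?I = (X - K) \<inter> T" by blast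
    then show ?thesis using closedin_closed_Int[OF T(1)] by simp
  qed
  ultimately have "k ` ?I = {} \<or> k ` ?I = X - K" using conn connected_clopen by blast
  moreover have "b \<notin> k ` ?I" using kX(1) by blast
  ultimately show False using \<open>?I \<noteq> {}\<close> b by blast
qed

lemma induced_C4_complex:
  assumes D: "abstract_complex \<Delta>" and C: "induced_C4 (edge \<Delta>) a b c d"
    and "{a, b, c, d} \<subseteq> vertices \<Delta>"
  shows "induced \<Delta> {a, b, c, d} = generated_by {{a, b}, {b, c}, {c, d}, {d, a}}"
proof
  have e: "{a, b} \<in> \<Delta>" "{b, c} \<in> \<Delta>" "{c, d} \<in> \<Delta>" "{d, a} \<in> \<Delta>"
    "{a, c} \<notin> \<Delta>" "{b, d} \<notin> \<Delta>"
    using C unfolding induced_C4_def edge_def by auto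
  show "generated_by {{a, b}, {b, c}, {c, d}, {d, a}} \<subseteq> induced \<Delta> {a, b, c, d}"
    unfolding generated_by_def induced_def using e complex_subset[OF D] by blast
  show "induced \<Delta> {a, b, c, d} \<subseteq> generated_by {{a, b}, {b, c}, {c, d}, {d, a}}"
  proof
    fix F assume "F \<in> induced \<Delta> {a, b, c, d}"
    then have F: "F \<in> \<Delta>" "F \<subseteq> {a, b, c, d}" unfolding induced_def by auto
    have "\<not> {a, c} \<subseteq> F" "\<not> {b, d} \<subseteq> F" using e complex_subset[OF D F(1)] by blast+
    then have "F \<subseteq> {a, b} \<or> F \<subseteq> {b, c} \<or> F \<subseteq> {c, d} \<or> F \<subseteq> {d, a}" using F(2) by blast
    then show "F \<in> generated_by {{a, b}, {b, c}, {c, d}, {d, a}}" unfolding generated_by_def by blast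
  qed
qed

text \<open>The 4-cycle is a circle in the sphere, and \<open>w\<close> provides the point off it
  from which \<open>circle_separates_two_sphere\<close> projects.\<close>

lemma four_cycle_separates:
  assumes S: "simplicial_sphere 2 \<Delta>" and C: "induced_C4 (edge \<Delta>) a b c d"
    and V: "{a, b, c, d} \<subseteq> vertices \<Delta>" "w \<in> vertices \<Delta>" "w \<notin> {a, b, c, d}"
  shows "\<not> connected_on (edge \<Delta>) (vertices \<Delta> - {a, b, c, d})"
proof
  assume conn: "connected_on (edge \<Delta>) (vertices \<Delta> - {a, b, c, d})"
  have D: "abstract_complex \<Delta>" "realization \<Delta> homeomorphic sph 2"
    using S unfolding simplicial_sphere_iff by auto
  let ?K = "realization (generated_by {{a, b}, {b, c}, {c, d}, {d, a}})"
  have K: "?K = realization \<Delta> \<inter> {f. {v. f v \<noteq> 0} \<subseteq> {a, b, c, d}}"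
    unfolding induced_C4_complex[OF D(1) C V(1), symmetric] realization_def induced_def by blast
  have "distinct [a, b, c, d]"
    using graph.C4_neq[OF graph_edge C] by auto
  then have "?K homeomorphic sph 1" by (rule four_cycle_circle)
  moreover have "bary {w} \<in> realization \<Delta>"
    using bary_in_realization[OF D(1) vertex_face[OF D(1) V(2)]] by simp
  moreover have "bary {w} \<notin> ?K" unfolding K using V(3) by (simp add: supp_bary)
  moreover have "?K \<subseteq> realization \<Delta>" unfolding K by blast
  ultimately have "\<not> connected (realization \<Delta> - ?K)"
    using circle_separates_two_sphere[OF D(2)] by blast
  moreover have "realization \<Delta> - ?K = realization \<Delta> - {f. {v. f v \<noteq> 0} \<subseteq> {a, b, c, d}}"
    unfolding K by blast
  ultimately show False using complement_connected[OF D(1) conn] by simp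
qed

subsection \<open>Combinatorics of the complex on twelve vertices\<close>

text \<open>Explicit lists keep adjacency quick to evaluate; \<open>nbl_edges\<close> checks them
  against the facets.\<close>

fun nbl :: "vertex12 \<Rightarrow> vertex12 list" where
  "nbl X1 = [X2, X3, Y2, Y3, Z1, Z2, V1, V3]"
| "nbl X2 = [X1, X3, Y1, Y3, Z2, Z3, V1, V3]"
| "nbl X3 = [X1, X2, Y1, Y2, Z1, Z3, V1, V3]"
| "nbl Y1 = [X2, X3, Y2, Y3, Z2, Z3, V1, V2]"
| "nbl Y2 = [X1, X3, Y1, Y3, Z1, Z3, V1, V2]"
| "nbl Y3 = [X1, X2, Y1, Y2, Z1, Z2, V1, V2]"
| "nbl Z1 = [X1, X3, Y2, Y3, Z2, Z3, V2, V3]"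
| "nbl Z2 = [X1, X2, Y1, Y3, Z1, Z3, V2, V3]"
| "nbl Z3 = [X2, X3, Y1, Y2, Z1, Z2, V2, V3]"
| "nbl V1 = [X1, X2, X3, Y1, Y2, Y3]"
| "nbl V2 = [Y1, Y2, Y3, Z1, Z2, Z3]"
| "nbl V3 = [X1, X2, X3, Z1, Z2, Z3]"

definition all12 :: "vertex12 list" where
  "all12 = [X1, X2, X3, Y1, Y2, Y3, Z1, Z2, Z3, V1, V2, V3]"

lemma set_all12: "set all12 = UNIV"
proof -
  have "v \<in> set all12" for v by (cases v) (simp_all add: all12_def)
  then show ?thesis by blast
qed

text \<open>Flagness as a search: each vertex is omitted or taken, a branch ends when the new vertex
  has a non-neighbour among those taken, and every clique that survives must lie in a facet.\<close>

fun clique_check :: "vertex12 list \<Rightarrow> vertex12 list \<Rightarrow> bool" where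
  "clique_check [] K = (\<exists>f\<in>set delta_facets. set K \<subseteq> set f)"
| "clique_check (v # vs) K = (clique_check vs K \<and>
     ((\<exists>u\<in>set K. u \<noteq> v \<and> v \<notin> set (nbl u)) \<or> clique_check vs (v # K)))"

lemma clique_check_sound:
  assumes "clique_check vs K" "set K \<subseteq> F" "F \<subseteq> set K \<union> set vs"
    and "\<And>u w. u \<in> F \<Longrightarrow> w \<in> F \<Longrightarrow> u \<noteq> w \<Longrightarrow> w \<in> set (nbl u)"
  shows "\<exists>f\<in>set delta_facets. F \<subseteq> set f"
  using assms(1-3)
proof (induction vs K rule: clique_check.induct)
  case (1 K)
  then have "F = set K" by auto
  then show ?case using 1 by auto
next
  case (2 v vs K)
  show ?case
  proof (cases "v \<in> F")
    case True
    then have "\<not> (\<exists>u\<in>set K. u \<noteq> v \<and> v \<notin> set (nbl u))" using assms(4) 2(4) by blast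
    then show ?thesis using 2 True by auto
  next
    case False
    then show ?thesis using 2 by auto
  qed
qed

text \<open>A search through all vertex sets, cut off as soon as a vertex has fewer than four neighbours left
  or a facet is contained in the set: neither happens for the vertex set of a flag 2-sphere.\<close>

fun equator_check :: "vertex12 list \<Rightarrow> vertex12 list \<Rightarrow> bool" where
  "equator_check [] W =
     ((\<exists>u\<in>set W. length (filter (\<lambda>x. x \<in> set (nbl u)) W) < 4) \<or>
      W = [] \<or> (\<exists>v\<in>set all12. set W = set (nbl v)))"
| "equator_check (v # vs) W =
     ((\<exists>u\<in>set W. length (filter (\<lambda>x. x \<in> set (nbl u)) (W @ v # vs)) < 4) \<or>
      (equator_check vs W \<and>
       ((\<exists>f\<in>set delta_facets. set f \<subseteq> set (v # W)) \<or> equator_check vs (v # W))))"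

text \<open>The set \<open>S\<close> lies between \<open>W\<close> and \<open>W\<close> enlarged by
  the undecided vertices. Degrees in the larger set bound those in \<open>S\<close> from above, and
  a facet inside the smaller set lies in \<open>S\<close>, so neither cut loses a candidate.\<close>

lemma equator_check_sound:
  assumes "equator_check vs W" "set W \<subseteq> S" "S \<subseteq> set W \<union> set vs"
    and "\<And>u. u \<in> S \<Longrightarrow> 4 \<le> card {x \<in> S. x \<in> set (nbl u)}"
    and "\<And>f. f \<in> set delta_facets \<Longrightarrow> \<not> set f \<subseteq> S"
  shows "S = {} \<or> (\<exists>v. S = set (nbl v))"
  using assms(1-3)
proof (induction vs W rule: equator_check.induct)
  have deg: "\<not> length (filter (\<lambda>x. x \<in> set (nbl u)) xs) < 4" if "u \<in> S" "S \<subseteq> set xs" for u xs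
  proof -
    have "{x \<in> S. x \<in> set (nbl u)} \<subseteq> set (filter (\<lambda>x. x \<in> set (nbl u)) xs)"
      using that by auto
    then have "card {x \<in> S. x \<in> set (nbl u)} \<le> card (set (filter (\<lambda>x. x \<in> set (nbl u)) xs))"
      by (intro card_mono) auto
    also have "\<dots> \<le> length (filter (\<lambda>x. x \<in> set (nbl u)) xs)" by (rule card_length)
    finally show ?thesis using assms(4)[of u] that by simp
  qed
  {
    case (1 W)
    then have "S = set W" by auto
    moreover have "\<not> length (filter (\<lambda>x. x \<in> set (nbl u)) W) < 4" if "u \<in> set W" for u
      using deg[of u W] that calculation by blast
    ultimately show ?case using 1(1) by (auto simp only: equator_check.simps set_simps)
  next
    case (2 v vs W)
    have "\<not> length (filter (\<lambda>x. x \<in> set (nbl u)) (W @ v # vs)) < 4" if "u \<in> set W" for u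
      using that 2(4,5) by (intro deg) auto
    then have ok: "equator_check vs W"
      "(\<exists>f\<in>set delta_facets. set f \<subseteq> set (v # W)) \<or> equator_check vs (v # W)"
      using 2(3) by (simp_all only: equator_check.simps) blast+
    show ?case
    proof (cases "v \<in> S")
      case True
      then have "set (v # W) \<subseteq> S" using 2(4) by simp
      then have "equator_check vs (v # W)" using ok(2) assms(5) by blast
      then show ?thesis using 2(2) 2(4,5) True by auto
    next
      case False
      then show ?thesis using 2(1) ok(1) 2(4,5) by auto
    qed
  }
qed

lemma nbl_edges:
  "\<forall>u\<in>set all12. \<forall>v\<in>set all12.
     (v \<in> set (nbl u)) = (u \<noteq> v \<and> (\<exists>f\<in>set delta_facets. u \<in> set f \<and> v \<in> set f))"
  by code_simp

lemma clique_check_delta: "clique_check all12 []"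
  by code_simp

lemma equator_check_delta: "equator_check all12 []"
  by code_simp

lemma facets_card: "\<forall>f\<in>set delta_facets. distinct f \<and> length f = 4"
  by code_simp

lemma nbl_C4: "\<forall>u\<in>set all12. \<forall>v\<in>set (nbl u). \<exists>w\<in>set (nbl v). \<exists>t\<in>set (nbl w).
    u \<in> set (nbl t) \<and> w \<notin> set (nbl u) \<and> t \<notin> set (nbl v) \<and> u \<noteq> w \<and> v \<noteq> t"
  by code_simp

lemma nbl_non_neighbours: "\<forall>v\<in>set all12. \<exists>a\<in>set all12. \<exists>b\<in>set all12.
    a \<noteq> b \<and> a \<noteq> v \<and> b \<noteq> v \<and> a \<notin> set (nbl v) \<and> b \<notin> set (nbl v)"
  by code_simp

lemma face_in_facet: "F \<in> Delta_12_33 \<longleftrightarrow> (\<exists>f\<in>set delta_facets. F \<subseteq> set f)"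
  unfolding Delta_facets facet_complex_def generated_by_def by blast

lemma edge_Delta: "edge Delta_12_33 u v \<longleftrightarrow> v \<in> set (nbl u)"
proof -
  have "v \<in> set (nbl u) \<longleftrightarrow> u \<noteq> v \<and> (\<exists>f\<in>set delta_facets. u \<in> set f \<and> v \<in> set f)"
    using nbl_edges unfolding set_all12 by blast
  then show ?thesis
    unfolding edge_def face_in_facet by (simp only: insert_subset empty_subsetI simp_thms)
qed

lemma Delta_clique:
  assumes "\<And>u w. u \<in> F \<Longrightarrow> w \<in> F \<Longrightarrow> u \<noteq> w \<Longrightarrow> {u, w} \<in> Delta_12_33"
  shows "F \<in> Delta_12_33"
proof -
  have "\<exists>f\<in>set delta_facets. F \<subseteq> set f"
  proof (rule clique_check_sound[OF clique_check_delta])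
    show "w \<in> set (nbl u)" if "u \<in> F" "w \<in> F" "u \<noteq> w" for u w
      using assms[OF that] that(3) edge_Delta[of u w] unfolding edge_def by blast
  qed (auto simp: set_all12)
  then show ?thesis unfolding face_in_facet .
qed

lemma vertices_Delta: "vertices Delta_12_33 = UNIV"
proof -
  have "{v} \<in> Delta_12_33" for v by (rule Delta_clique) simp
  then show ?thesis unfolding vertices_def by blast
qed

lemma Delta_flag: "flag Delta_12_33"
  unfolding flag_def
proof (intro allI impI)
  fix N assume N: "N \<subseteq> vertices Delta_12_33 \<and> N \<notin> Delta_12_33 \<and> (\<forall>M. M \<subset> N \<longrightarrow> M \<in> Delta_12_33)"
  then obtain u w where uw: "u \<in> N" "w \<in> N" "u \<noteq> w" "{u, w} \<notin> Delta_12_33"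
    using Delta_clique[of N] by blast
  then have "\<not> {u, w} \<subset> N" using N by blast
  then have "N = {u, w}" using uw(1,2) by blast
  then show "card N = 2" using uw(3) by simp
qed

lemma card_vertices_Delta: "card (vertices Delta_12_33) = 12"
proof -
  have "distinct all12" by (simp add: all12_def)
  then have "card (set all12) = 12" by (simp add: distinct_card all12_def)
  then show ?thesis unfolding vertices_Delta set_all12 .
qed

lemma suspension_non_neighbour:
  assumes "is_suspension \<Delta>"
  shows "\<exists>v w. v \<in> vertices \<Delta> \<and> (\<forall>x\<in>vertices \<Delta>. x \<noteq> v \<and> x \<noteq> w \<longrightarrow> edge \<Delta> v x)"
proof -
  obtain \<Gamma> v w where \<Gamma>: "abstract_complex \<Gamma>" "v \<noteq> w" "v \<notin> vertices \<Gamma>"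
    "\<Delta> = Defs.join \<Gamma> (generated_by {{v}, {w}})"
    using assms unfolding is_suspension_def by blast
  have join: "F \<union> G \<in> \<Delta>" if "F \<in> \<Gamma>" "G \<subseteq> {v} \<or> G \<subseteq> {w}" for F G
    using that unfolding \<Gamma>(4) Defs.join_def generated_by_def by blast
  have "{} \<in> \<Gamma>" using \<Gamma>(1) unfolding abstract_complex_def by blast
  then have "{v} \<in> \<Delta>" using join[of "{}" "{v}"] by simp
  moreover have "edge \<Delta> v x" if x: "x \<in> vertices \<Delta>" "x \<noteq> v" "x \<noteq> w" for x
  proof -
    obtain F where "F \<in> \<Delta>" "x \<in> F" using x(1) unfolding vertices_def by blast
    then obtain H where "H \<in> \<Gamma>" "x \<in> H"
      using x(2,3) unfolding \<Gamma>(4) Defs.join_def generated_by_def by blast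
    then have "{x} \<in> \<Gamma>" using complex_subset[OF \<Gamma>(1)] by blast
    then show ?thesis using join[of "{x}" "{v}"] x(2) unfolding edge_def by (simp add: insert_commute)
  qed
  ultimately show ?thesis unfolding vertices_def by blast
qed

lemma Delta_not_suspension: "\<not> is_suspension Delta_12_33"
proof
  assume "is_suspension Delta_12_33"
  from suspension_non_neighbour[OF this]
  have "\<exists>v w. \<forall>x. x \<noteq> v \<and> x \<noteq> w \<longrightarrow> x \<in> set (nbl v)"
    by (simp add: vertices_Delta edge_Delta)
  then obtain v w where vw: "\<forall>x. x \<noteq> v \<and> x \<noteq> w \<longrightarrow> x \<in> set (nbl v)" by blast
  obtain a b where "a \<noteq> b" "a \<noteq> v" "b \<noteq> v" "a \<notin> set (nbl v)" "b \<notin> set (nbl v)"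
    using nbl_non_neighbours unfolding set_all12 by blast
  then show False using vw by blast
qed

lemma image_generated_by: "(\<lambda>F. f ` F) ` generated_by \<F> = generated_by ((\<lambda>F. f ` F) ` \<F>)"
proof
  show "(\<lambda>F. f ` F) ` generated_by \<F> \<subseteq> generated_by ((\<lambda>F. f ` F) ` \<F>)"
    unfolding generated_by_def by blast
  show "generated_by ((\<lambda>F. f ` F) ` \<F>) \<subseteq> (\<lambda>F. f ` F) ` generated_by \<F>"
  proof
    fix G assume "G \<in> generated_by ((\<lambda>F. f ` F) ` \<F>)"
    then obtain F where F: "F \<in> \<F>" "G \<subseteq> f ` F" unfolding generated_by_def by blast
    then have "G = f ` (F \<inter> f -` G)" by blast
    moreover have "F \<inter> f -` G \<in> generated_by \<F>" using F(1) unfolding generated_by_def by blast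
    ultimately show "G \<in> (\<lambda>F. f ` F) ` generated_by \<F>" by blast
  qed
qed

lemma vertices_generated_by: "vertices (generated_by \<F>) = \<Union>\<F>"
  unfolding vertices_def generated_by_def by blast

lemma induced_C4_isomorphic:
  assumes D: "abstract_complex \<Delta>" and C: "induced_C4 (edge \<Delta>) a b c d"
    and V: "{a, b, c, d} \<subseteq> vertices \<Delta>"
  shows "isomorphic_complexes (induced \<Delta> {a, b, c, d}) four_cycle"
proof -
  note neq = graph.C4_neq[OF graph_edge C]
  define f where "f x = (if x = a then 0 else if x = b then 1 else if x = c then 2 else 3 :: nat)" for x
  have f: "f a = 0" "f b = 1" "f c = 2" "f d = 3" using neq unfolding f_def by auto
  have V4: "vertices (induced \<Delta> {a, b, c, d}) = {a, b, c, d}"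
    unfolding induced_C4_complex[OF D C V] vertices_generated_by by auto
  have "vertices four_cycle = {0, 1, 2, 3}"
    unfolding four_cycle_def vertices_generated_by by auto
  then have "bij_betw f (vertices (induced \<Delta> {a, b, c, d})) (vertices four_cycle)"
    unfolding V4 bij_betw_def inj_on_def using f by auto
  moreover have "four_cycle = (\<lambda>F. f ` F) ` induced \<Delta> {a, b, c, d}"
    unfolding induced_C4_complex[OF D C V] image_generated_by four_cycle_def by (simp add: f)
  ultimately show ?thesis unfolding isomorphic_complexes_def by blast
qed

lemma Delta_no_contractible_edge: "\<not> contractible_edge Delta_12_33 e"
proof
  assume c: "contractible_edge Delta_12_33 e"
  then obtain u v where e: "e = {u, v}" "u \<noteq> v" "e \<in> Delta_12_33"
    unfolding contractible_edge_def by (meson card_2_iff)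
  then have uv: "v \<in> set (nbl u)" using edge_Delta unfolding edge_def by blast
  then obtain w t where wt: "w \<in> set (nbl v)" "t \<in> set (nbl w)" "u \<in> set (nbl t)"
    "w \<notin> set (nbl u)" "t \<notin> set (nbl v)" "u \<noteq> w" "v \<noteq> t"
    using nbl_C4 unfolding set_all12 by blast
  then have C: "induced_C4 (edge Delta_12_33) u v w t"
    using uv unfolding induced_C4_def edge_Delta by blast
  have D: "abstract_complex Delta_12_33" using Delta_sphere unfolding simplicial_sphere_iff by blast
  have "isomorphic_complexes (induced Delta_12_33 {u, v, w, t}) four_cycle"
    by (rule induced_C4_isomorphic[OF D C]) (simp add: vertices_Delta)
  moreover have "e \<in> induced Delta_12_33 {u, v, w, t}" using e unfolding induced_def by blast
  ultimately show False using c unfolding contractible_edge_def vertices_Delta by blast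
qed

section \<open>Induced equators of the complex on twelve vertices\<close>

lemma pm_cong:
  assumes "\<And>u v. u \<in> V \<Longrightarrow> v \<in> V \<Longrightarrow> E u v = E' u v"
  shows "pm E d V = pm E' d V"
  using assms
proof (induction d arbitrary: V)
  case 0
  then show ?case by auto
next
  case (Suc d)
  have "pm E d {w \<in> V. E v w} = pm E' d {w \<in> V. E' v w}" if "v \<in> V" for v
  proof -
    have "{w \<in> V. E v w} = {w \<in> V. E' v w}" using Suc.prems that by blast
    moreover have "pm E d {w \<in> V. E' v w} = pm E' d {w \<in> V. E' v w}"
      by (rule Suc.IH) (use Suc.prems in blast)
    ultimately show ?thesis by simp
  qed
  then show ?case by simp
qed

text \<open>Passing to the link of a vertex of the clique lowers dimension and size by one. This
  keeps the tetrahedra of the complex out of an equator.\<close>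

lemma (in graph) clique_card:
  assumes "pm E d V" "K \<subseteq> V" "\<And>u v. u \<in> K \<Longrightarrow> v \<in> K \<Longrightarrow> u \<noteq> v \<Longrightarrow> E u v"
  shows "card K \<le> d + 1"
  using assms
proof (induction d arbitrary: V K)
  case 0
  then obtain a b where ab: "V = {a, b}" "\<not> E a b" "a \<noteq> b" by auto
  then have "K \<subseteq> {a} \<or> K \<subseteq> {b}" using 0(2,3) by blast
  then show ?case using card_mono[of "{a}" K] card_mono[of "{b}" K] by auto
next
  case (Suc d)
  show ?case
  proof (cases "K = {}")
    case False
    then obtain v where v: "v \<in> K" by blast
    have "card (K - {v}) \<le> d + 1"
    proof (rule Suc.IH)
      show "pm E d (nb V v)" using pm_nb[OF Suc.prems(1)] v Suc.prems(2) by blast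
    qed (use Suc.prems(2,3) v in blast)+
    moreover have "finite K" using Suc.prems(1,2) pm_finite finite_subset by blast
    ultimately show ?thesis using v by simp
  qed simp
qed

lemma flag_induced:
  assumes "flag \<Delta>"
  shows "flag (induced \<Delta> W)"
  unfolding flag_def
proof (intro allI impI)
  fix N assume N: "N \<subseteq> vertices (induced \<Delta> W) \<and> N \<notin> induced \<Delta> W \<and> (\<forall>M. M \<subset> N \<longrightarrow> M \<in> induced \<Delta> W)"
  have "N \<subseteq> W" "N \<subseteq> vertices \<Delta>" using N unfolding vertices_def induced_def by blast+
  moreover have "N \<notin> \<Delta>" using N calculation(1) unfolding induced_def by blast
  moreover have "\<forall>M. M \<subset> N \<longrightarrow> M \<in> \<Delta>" using N unfolding induced_def by blast
  ultimately show "card N = 2" using assms unfolding flag_def by blast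
qed

lemma Delta_equators: "equators_are_vertex_links 3 Delta_12_33"
  unfolding equators_are_vertex_links_def
proof (intro allI impI)
  fix \<Gamma> assume "induced_equator 3 Delta_12_33 \<Gamma>"
  then obtain W where \<Gamma>: "\<Gamma> = induced Delta_12_33 W" and S: "simplicial_sphere 2 \<Gamma>"
    unfolding induced_equator_def by (auto simp: numeral_3_eq_3 numeral_2_eq_2)
  have sing: "{v} \<in> Delta_12_33" for v by (rule Delta_clique) simp
  have VW: "vertices \<Gamma> = W" unfolding \<Gamma> vertices_def induced_def using sing by blast
  have "pm (edge \<Gamma>) 2 W"
    using flag_sphere_pm[OF S] flag_induced[OF Delta_flag, of W] VW \<Gamma> by simp
  moreover have "edge \<Gamma> u v = edge Delta_12_33 u v" if "u \<in> W" "v \<in> W" for u v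
    using that unfolding \<Gamma> edge_def induced_def by blast
  ultimately have pmW: "pm (edge Delta_12_33) 2 W"
    using pm_cong[of W "edge \<Gamma>" "edge Delta_12_33" 2] by blast
  have "W = {} \<or> (\<exists>v. W = set (nbl v))"
  proof (rule equator_check_sound[OF equator_check_delta])
    show "4 \<le> card {x \<in> W. x \<in> set (nbl u)}" if "u \<in> W" for u
    proof -
      have "pm (edge Delta_12_33) (Suc 0) {x \<in> W. edge Delta_12_33 u x}"
        using pmW that by (simp add: numeral_2_eq_2)
      then have "2 * (Suc 0 + 1) \<le> card {x \<in> W. edge Delta_12_33 u x}"
        by (rule graph.card_pm[OF graph_edge])
      then show ?thesis unfolding edge_Delta by simp
    qed
    show "\<not> set f \<subseteq> W" if f: "f \<in> set delta_facets" for f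
    proof
      assume "set f \<subseteq> W"
      then have "card (set f) \<le> 2 + 1"
      proof (rule graph.clique_card[OF graph_edge pmW])
        show "edge Delta_12_33 u v" if "u \<in> set f" "v \<in> set f" "u \<noteq> v" for u v
          using that f unfolding edge_def face_in_facet by blast
      qed
      moreover have "card (set f) = 4" using facets_card f distinct_card by fastforce
      ultimately show False by simp
    qed
  qed (auto simp: set_all12)
  \<comment> \<open>The search lets the empty set pass, but it carries no 2-sphere.\<close>
  moreover have "W \<noteq> {}" using pmW by (simp add: numeral_2_eq_2)
  ultimately obtain v where v: "W = set (nbl v)" by blast
  \<comment> \<open>By flagness the link of \<open>v\<close> is the full induced subcomplex on its
    neighbours.\<close>
  have "\<Gamma> = link Delta_12_33 {v}"
  proof
    show "\<Gamma> \<subseteq> link Delta_12_33 {v}"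
    proof
      fix F assume "F \<in> \<Gamma>"
      then have F: "F \<in> Delta_12_33" "\<And>x. x \<in> F \<Longrightarrow> edge Delta_12_33 v x"
        unfolding \<Gamma> v induced_def edge_Delta by auto
      have D: "abstract_complex Delta_12_33" using Delta_sphere unfolding simplicial_sphere_iff by blast
      have "{v} \<union> F \<in> Delta_12_33"
      proof (rule Delta_clique)
        fix u w assume "u \<in> {v} \<union> F" "w \<in> {v} \<union> F" "u \<noteq> w"
        then consider "u = v" "w \<in> F" | "w = v" "u \<in> F" | "{u, w} \<subseteq> F" by blast
        then show "{u, w} \<in> Delta_12_33"
        proof cases
          case 1
          then show ?thesis using F(2) unfolding edge_def by blast
        next
          case 2
          then have "{v, u} \<in> Delta_12_33" using F(2) unfolding edge_def by blast
          then show ?thesis using 2(1) by (simp add: insert_commute)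
        next
          case 3
          then show ?thesis using complex_subset[OF D F(1)] by blast
        qed
      qed
      moreover have "v \<notin> F" using F(2) unfolding edge_def by blast
      ultimately show "F \<in> link Delta_12_33 {v}" using F(1) unfolding link_def by blast
    qed
    show "link Delta_12_33 {v} \<subseteq> \<Gamma>"
    proof
      fix F assume F: "F \<in> link Delta_12_33 {v}"
      have "x \<in> set (nbl v)" if "x \<in> F" for x
      proof -
        have "{v} \<union> F \<in> Delta_12_33" "v \<noteq> x" using F that unfolding link_def by auto
        then have "edge Delta_12_33 v x"
          using that unfolding edge_def face_in_facet by blast
        then show ?thesis unfolding edge_Delta .
      qed
      then show "F \<in> \<Gamma>" using F unfolding \<Gamma> v induced_def link_def by blast
    qed
  qed
  then show "\<exists>v\<in>vertices Delta_12_33. \<Gamma> = link Delta_12_33 {v}" unfolding vertices_Delta by blast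
qed

subsection \<open>The lower bound\<close>

lemma four_cycle_faces: "F \<in> four_cycle \<longleftrightarrow> F \<subseteq> {0, 1} \<or> F \<subseteq> {1, 2} \<or> F \<subseteq> {2, 3} \<or> F \<subseteq> {3, 0}"
  unfolding four_cycle_def generated_by_def by auto

lemma vertices_four_cycle: "vertices four_cycle = {0, 1, 2, 3}"
  unfolding four_cycle_def vertices_generated_by by auto

lemma four_cycle_edge_extends:
  assumes "edge four_cycle i j"
  shows "\<exists>k\<in>{0, 1, 2, 3}. \<exists>l\<in>{0, 1, 2, 3}. induced_C4 (edge four_cycle) i j k l"
proof -
  have "i \<noteq> j" "{i, j} \<in> four_cycle" using assms unfolding edge_def by auto
  then consider "i = 0" "j = 1" | "i = 1" "j = 0" | "i = 1" "j = 2" | "i = 2" "j = 1"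
    | "i = 2" "j = 3" | "i = 3" "j = 2" | "i = 3" "j = 0" | "i = 0" "j = 3"
    unfolding four_cycle_faces by auto
  then show ?thesis
    by cases (simp_all add: induced_C4_def edge_def four_cycle_faces)
qed

lemma isomorphic_face_iff:
  assumes f: "bij_betw f (vertices \<Delta>) (vertices \<Gamma>)" "\<Gamma> = (\<lambda>F. f ` F) ` \<Delta>"
    and F: "F \<subseteq> vertices \<Delta>"
  shows "F \<in> \<Delta> \<longleftrightarrow> f ` F \<in> \<Gamma>"
proof
  show "F \<in> \<Delta> \<Longrightarrow> f ` F \<in> \<Gamma>" using f(2) by blast
  assume "f ` F \<in> \<Gamma>"
  then obtain G where G: "G \<in> \<Delta>" "f ` F = f ` G" using f(2) by blast
  have "G \<subseteq> vertices \<Delta>" using G(1) unfolding vertices_def by blast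
  then have "F = G" using G(2) F f(1) inj_on_image_eq_iff unfolding bij_betw_def by metis
  then show "F \<in> \<Delta>" using G(1) by simp
qed

text \<open>Every edge of the standard 4-cycle can serve as its first one, and the isomorphism
  carries this back to the induced subcomplex through the given edge.\<close>

lemma non_contractible_edge_in_C4:
  assumes D: "abstract_complex \<Delta>" and no: "\<not> contractible_edge \<Delta> {u, v}" and e: "edge \<Delta> u v"
  shows "\<exists>w\<in>vertices \<Delta>. \<exists>t\<in>vertices \<Delta>. induced_C4 (edge \<Delta>) u v w t"
proof -
  have uv: "u \<noteq> v" "{u, v} \<in> \<Delta>" using e unfolding edge_def by auto
  then have "card {u, v} = 2" by simp
  then obtain W where W: "W \<subseteq> vertices \<Delta>" "isomorphic_complexes (induced \<Delta> W) four_cycle"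
    "{u, v} \<in> induced \<Delta> W"
    using no uv(2) unfolding contractible_edge_def by blast
  then obtain f where f: "bij_betw f (vertices (induced \<Delta> W)) (vertices four_cycle)"
    "four_cycle = (\<lambda>F. f ` F) ` induced \<Delta> W"
    unfolding isomorphic_complexes_def by blast
  have VW: "vertices (induced \<Delta> W) = W"
  proof
    show "W \<subseteq> vertices (induced \<Delta> W)"
    proof
      fix x assume "x \<in> W"
      then have "{x} \<in> induced \<Delta> W" using W(1) vertex_face[OF D] unfolding induced_def by blast
      then show "x \<in> vertices (induced \<Delta> W)" unfolding vertices_def by blast
    qed
  qed (auto simp: vertices_def induced_def)
  have inj: "f x = f y \<longleftrightarrow> x = y" if "x \<in> W" "y \<in> W" for x y
    using f(1) that unfolding VW bij_betw_def inj_on_def by blast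
  have edge_iff: "edge \<Delta> x y \<longleftrightarrow> edge four_cycle (f x) (f y)" if xy: "x \<in> W" "y \<in> W" for x y
  proof -
    have "{x, y} \<in> \<Delta> \<longleftrightarrow> {x, y} \<in> induced \<Delta> W" using xy unfolding induced_def by blast
    also have "\<dots> \<longleftrightarrow> f ` {x, y} \<in> four_cycle"
      by (rule isomorphic_face_iff[OF f]) (use xy VW in auto)
    finally show ?thesis using inj[OF xy] unfolding edge_def by simp
  qed
  have uvW: "u \<in> W" "v \<in> W" using W(3) unfolding induced_def by auto
  then have "edge four_cycle (f u) (f v)" using edge_iff e by blast
  then obtain k l where kl: "k \<in> {0, 1, 2, 3}" "l \<in> {0, 1, 2, 3}"
    "induced_C4 (edge four_cycle) (f u) (f v) k l"
    using four_cycle_edge_extends by blast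
  have "f ` W = {0, 1, 2, 3}" using f(1) by (simp add: VW vertices_four_cycle bij_betw_def)
  then have "k \<in> f ` W" "l \<in> f ` W" using kl(1,2) by simp_all
  then obtain w t where wt: "w \<in> W" "f w = k" "t \<in> W" "f t = l" by blast
  have "induced_C4 (edge \<Delta>) u v w t"
    using kl(3) wt uvW edge_iff inj unfolding induced_C4_def by auto
  then show ?thesis using wt W(1) by blast
qed

text \<open>\<open>v\<close> and \<open>w\<close> are the poles: each is joined to all other
  vertices, so by flagness every face avoiding both can be enlarged by either one.\<close>

lemma suspension_of_unique_non_neighbours:
  assumes D: "abstract_complex \<Delta>" "flag \<Delta>" and vw: "v \<in> vertices \<Delta>" "w \<in> vertices \<Delta>" "v \<noteq> w"
    and v: "vertices \<Delta> - {x \<in> vertices \<Delta>. edge \<Delta> v x} = {v, w}"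
    and w: "vertices \<Delta> - {x \<in> vertices \<Delta>. edge \<Delta> w x} = {v, w}"
  shows "is_suspension \<Delta>"
proof -
  define \<Gamma> where "\<Gamma> = induced \<Delta> (vertices \<Delta> - {v, w})"
  have "vertices \<Gamma> \<subseteq> vertices \<Delta> - {v, w}" unfolding \<Gamma>_def induced_def vertices_def by blast
  then have vG: "v \<notin> vertices \<Gamma>" "w \<notin> vertices \<Gamma>" "finite (vertices \<Gamma>)"
    using D(1) finite_subset unfolding abstract_complex_def by blast+
  then have "abstract_complex \<Gamma>"
    using D(1) unfolding abstract_complex_def \<Gamma>_def induced_def by blast
  moreover have "\<Delta> = Defs.join \<Gamma> (generated_by {{v}, {w}})"
  proof
    show "\<Delta> \<subseteq> Defs.join \<Gamma> (generated_by {{v}, {w}})"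
    proof
      fix F assume F: "F \<in> \<Delta>"
      have "\<not> edge \<Delta> v w" using v vw by blast
      then have "\<not> {v, w} \<subseteq> F" using complex_subset[OF D(1) F] vw(3) unfolding edge_def by blast
      then have "F \<inter> {v, w} \<in> generated_by {{v}, {w}}" unfolding generated_by_def by blast
      moreover have "F - {v, w} \<in> \<Gamma>"
        using complex_subset[OF D(1) F] F unfolding \<Gamma>_def induced_def vertices_def by blast
      moreover have "F = (F - {v, w}) \<union> (F \<inter> {v, w})" by blast
      ultimately show "F \<in> Defs.join \<Gamma> (generated_by {{v}, {w}})" unfolding Defs.join_def by blast
    qed
    show "Defs.join \<Gamma> (generated_by {{v}, {w}}) \<subseteq> \<Delta>"
    proof
      fix H assume "H \<in> Defs.join \<Gamma> (generated_by {{v}, {w}})"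
      then obtain F G where H: "H = F \<union> G" "F \<in> \<Gamma>" "G \<subseteq> {v} \<or> G \<subseteq> {w}"
        unfolding Defs.join_def generated_by_def by blast
      then obtain s where s: "s \<in> {v, w}" "H \<subseteq> insert s F" by blast
      have F: "F \<in> \<Delta>" "F \<subseteq> vertices \<Delta> - {v, w}" using H(2) unfolding \<Gamma>_def induced_def by auto
      have adj: "{s, x} \<in> \<Delta>" if "x \<in> F" for x
        using that F(2) s(1) v w unfolding edge_def by blast
      have "insert s F \<in> \<Delta>"
      proof (rule flag_clique[OF D])
        show "insert s F \<subseteq> vertices \<Delta>" using F(2) s(1) vw by blast
        fix x y assume "x \<in> insert s F" "y \<in> insert s F" "x \<noteq> y"
        then consider "x = s" "y \<in> F" | "y = s" "x \<in> F" | "{x, y} \<subseteq> F" by blast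
        then show "{x, y} \<in> \<Delta>"
        proof cases
          case 1
          then show ?thesis using adj by blast
        next
          case 2
          then show ?thesis using adj[of x] by (simp add: insert_commute)
        next
          case 3
          then show ?thesis using complex_subset[OF D(1) F(1)] by blast
        qed
      qed
      then show "H \<in> \<Delta>" using complex_subset[OF D(1)] s(2) by blast
    qed
  qed
  ultimately show ?thesis unfolding is_suspension_def using vG vw(3) by blast
qed

theorem flag_sphere_twelve_vertices:
  assumes S: "simplicial_sphere d \<Delta>" "flag \<Delta>"
    and no_susp: "\<not> is_suspension \<Delta>" and no_contr: "\<nexists>e. contractible_edge \<Delta> e"
  shows "12 \<le> card (vertices \<Delta>)"
proof (rule graph.twelve_vertices[OF graph_edge flag_sphere_pm[OF S]])
  have D: "abstract_complex \<Delta>" using S(1) unfolding simplicial_sphere_iff by blast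
  show "\<exists>w\<in>vertices \<Delta>. \<exists>t\<in>vertices \<Delta>. induced_C4 (edge \<Delta>) u v w t" if "edge \<Delta> u v" for u v
    using non_contractible_edge_in_C4[OF D _ that] no_contr by blast
  show False if "v \<in> vertices \<Delta>" "w \<in> vertices \<Delta>" "v \<noteq> w"
    "vertices \<Delta> - {x \<in> vertices \<Delta>. edge \<Delta> v x} = {v, w}"
    "vertices \<Delta> - {x \<in> vertices \<Delta>. edge \<Delta> w x} = {v, w}" for v w
    using suspension_of_unique_non_neighbours[OF D S(2) that] no_susp by blast
  show "connected_on (edge \<Delta>) (vertices \<Delta>)" if "d = 1"
    using circle_connected S(1) that by simp
  show "connected_on (edge \<Delta>) (vertices \<Delta> - {v})" if "d = 2" "v \<in> vertices \<Delta>" for v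
    using sphere_minus_vertex_connected[of \<Delta> v] S(1) that by simp
  show "\<not> connected_on (edge \<Delta>) (vertices \<Delta> - {a, b, c, e})"
    if d: "d = 2" and C: "induced_C4 (edge \<Delta>) a b c e" "{a, b, c, e} \<subseteq> vertices \<Delta>" for a b c e
  proof -
    \<comment> \<open>At least six vertices, so one lies off the 4-cycle; otherwise the complement
      would be empty and count as connected.\<close>
    have "2 * (2 + 1) \<le> card (vertices \<Delta>)"
      using graph.card_pm[OF graph_edge flag_sphere_pm[OF S]] d by simp
    moreover have "card {a, b, c, e} \<le> 4" by (simp add: card_insert_if)
    ultimately have "vertices \<Delta> \<noteq> {a, b, c, e}" by auto
    then obtain w where "w \<in> vertices \<Delta>" "w \<notin> {a, b, c, e}" using C(2) by blast
    then show ?thesis using four_cycle_separates[OF _ C] S(1) d by simp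
  qed
qed

theorem mainTheorem4:
  shows "(\<forall>(d::nat) (\<Delta>::'a set set).
            simplicial_sphere d \<Delta> \<and> flag \<Delta> \<and>
            \<not> is_suspension \<Delta> \<and>
            (\<nexists>e. contractible_edge \<Delta> e) \<and>
            equators_are_vertex_links d \<Delta> \<longrightarrow>
            12 \<le> card (vertices \<Delta>)) \<and>
         simplicial_sphere 3 Delta_12_33 \<and> flag Delta_12_33 \<and>
         card (vertices Delta_12_33) = 12 \<and>
         \<not> is_suspension Delta_12_33 \<and>
         (\<nexists>e. contractible_edge Delta_12_33 e) \<and>
         equators_are_vertex_links 3 Delta_12_33"
  using Delta_sphere Delta_flag card_vertices_Delta Delta_not_suspension
    Delta_no_contractible_edge Delta_equators
  by (auto intro: flag_sphere_twelve_vertices)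

end
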